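(* There exists a polynomial reduction from the problem (MBFH) to the problem (TR-IP) with binary control set $\Xi=\{0,1\}$, in which the produced instances have a cost matrix $c$ with rational entries that are bounded below by $-9$ and above by $5$ and that become integers, polynomial in the size of the grid graph, when multiplied by $n^4$. Here $n$ denotes the number of nodes of the input grid graph of (MBFH) (after one isolated node has been added in case the number of nodes is odd).
   Context: (MBP), minimum bisection problem: given a finite graph $G=(V,E)$, find a partition of $V$ into $S$ and $V\setminus S$ with $|S|,|V\setminus S|\le\lceil |V|/2\rceil$ minimizing the number of cut edges $|\{(v,w)\in E : v\in S,\ w\in V\setminus S\}|$ (the bisection width). (MBFH): the problem (MBP) restricted to finite subgraphs of the infinite grid graph $\mathbb{Z}\times\mathbb{Z}$ (nodes are integer points, edges join points at Euclidean distance one) with an arbitrary number of holes. (TR-IP): given $N,M\in\mathbb{N}$, a finite contiguous set of integers $\Xi\subset\mathbb{Z}$, $x\in\Xi^{N\times M}$, $c\in\mathbb{R}^{N\times M}$, $\alpha>0$ and $\Delta\in\mathbb{N}$, solve $$\min_{d\in\mathbb{Z}^{N\times M}}\ \sum_{i=1}^N\sum_{j=1}^M c_{i,j}d_{i,j}+\alpha\sum_{j=1}^M\sum_{i=1}^{N-1}|x_{i+1,j}+d_{i+1,j}-x_{i,j}-d_{i,j}|+\alpha\sum_{i=1}^N\sum_{j=1}^{M-1}|x_{i,j+1}+d_{i,j+1}-x_{i,j}-d_{i,j}|$$ subject to $x_{i,j}+d_{i,j}\in\Xi$ for all $i\in\{1,\dots,N\}$, $j\in\{1,\dots,M\}$,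 and $\sum_{i=1}^N\sum_{j=1}^M|d_{i,j}|\le\Delta$. A polynomial reduction here means a polynomial-time computable map from instances of the first problem to instances of the second problem such that an optimal solution (and the optimal value) of the first instance can be obtained in polynomial time from an optimal solution (and the optimal value) of the second. *)

theory Defs
  imports
    Complex_Main
    "HOL-Computational_Algebra.Polynomial"
    "Graph_Theory.Graph_Theory"
    "Jordan_Normal_Form.Matrix"
begin

section \<open>Polynomial-time computability\<close>

text \<open>
  The machine model is N. D. Jones' WHILE language over binary trees. The price of evaluating an
  expression is one plus the size of the value, summed over all subexpressions, i.e. building
  or copying a tree is charged in full and no sharing of subtrees is assumed.
  With these prices WHILE programs and multi-tape Turing machines simulate each other with
  polynomial overhead; in particular the size of an output is bounded by the size of the input plus
  the running time.
\<close>

datatype btree = Atom | Cell btree btree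

datatype wexp = WVar nat | WAtom | WCell wexp wexp | WHd wexp | WTl wexp

datatype wcom =
    WSkip
  | WAssign nat wexp
  | WSeq wcom wcom
  | WIf wexp wcom wcom
  | WWhile wexp wcom

type_synonym wstate = "nat \<Rightarrow> btree"

fun tree_hd :: "btree \<Rightarrow> btree" where
  "tree_hd Atom = Atom"
| "tree_hd (Cell a b) = a"

fun tree_tl :: "btree \<Rightarrow> btree" where
  "tree_tl Atom = Atom"
| "tree_tl (Cell a b) = b"

primrec weval :: "wexp \<Rightarrow> wstate \<Rightarrow> btree" where
  "weval (WVar x) s = s x"
| "weval WAtom s = Atom"
| "weval (WCell a b) s = Cell (weval a s) (weval b s)"
| "weval (WHd a) s = tree_hd (weval a s)"
| "weval (WTl a) s = tree_tl (weval a s)"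

primrec wcost :: "wexp \<Rightarrow> wstate \<Rightarrow> nat" where
  "wcost (WVar x) s = 1 + size (s x)"
| "wcost WAtom s = 1"
| "wcost (WCell a b) s = 1 + size (weval (WCell a b) s) + wcost a s + wcost b s"
| "wcost (WHd a) s = 1 + size (weval (WHd a) s) + wcost a s"
| "wcost (WTl a) s = 1 + size (weval (WTl a) s) + wcost a s"

text \<open>\<open>wexec c s k s'\<close>: started in \<open>s\<close>, the program \<open>c\<close> halts in \<open>s'\<close> at total cost \<open>k\<close>.
  A test succeeds iff its value differs from \<^const>\<open>Atom\<close>.\<close>

inductive wexec :: "wcom \<Rightarrow> wstate \<Rightarrow> nat \<Rightarrow> wstate \<Rightarrow> bool" where
  Skip: "wexec WSkip s 1 s"
| Assign: "wexec (WAssign x e) s (1 + wcost e s) (s(x := weval e s))"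
| Seq: "wexec c1 s k1 s1 \<Longrightarrow> wexec c2 s1 k2 s2 \<Longrightarrow> wexec (WSeq c1 c2) s (1 + k1 + k2) s2"
| IfTrue: "weval e s \<noteq> Atom \<Longrightarrow> wexec c1 s k s1
    \<Longrightarrow> wexec (WIf e c1 c2) s (1 + wcost e s + k) s1"
| IfFalse: "weval e s = Atom \<Longrightarrow> wexec c2 s k s1
    \<Longrightarrow> wexec (WIf e c1 c2) s (1 + wcost e s + k) s1"
| WhileFalse: "weval e s = Atom \<Longrightarrow> wexec (WWhile e c) s (1 + wcost e s) s"
| WhileTrue: "weval e s \<noteq> Atom \<Longrightarrow> wexec c s k1 s1 \<Longrightarrow> wexec (WWhile e c) s1 k2 s2
    \<Longrightarrow> wexec (WWhile e c) s (1 + wcost e s + k1 + k2) s2"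

text \<open>\<open>rep t a\<close> means that the tree \<open>t\<close> is a representation of the object \<open>a\<close>; an object may
  have several representations (a finite set can be listed in any order) or none
  (an irrational number).\<close>

type_synonym 'a rep = "btree \<Rightarrow> 'a \<Rightarrow> bool"

definition polytime_computable_on ::
  "'a set \<Rightarrow> 'a rep \<Rightarrow> 'b rep \<Rightarrow> ('a \<Rightarrow> 'b) \<Rightarrow> bool" where
  "polytime_computable_on D rin rout f \<longleftrightarrow>
     (\<exists>(c :: wcom) (p :: nat poly). \<forall>a \<in> D. \<forall>t. rin t a \<longrightarrow>
        (\<exists>k s. wexec c ((\<lambda>_. Atom)(0 := t)) k s \<and> k \<le> poly p (size t) \<and> rout (s 0) (f a)))"


section \<open>Representations\<close>

definition enc_bool :: "bool \<Rightarrow> btree" where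
  "enc_bool b = (if b then Cell Atom Atom else Atom)"

text \<open>Numbers are written in binary, least significant bit first.\<close>

fun enc_nat :: "nat \<Rightarrow> btree" where
  "enc_nat n = (if n = 0 then Atom else Cell (enc_bool (odd n)) (enc_nat (n div 2)))"

declare enc_nat.simps [simp del]

definition enc_int :: "int \<Rightarrow> btree" where
  "enc_int z = Cell (enc_bool (z < 0)) (enc_nat (nat \<bar>z\<bar>))"

definition rep_nat :: "nat rep" where
  "rep_nat t n \<longleftrightarrow> t = enc_nat n"

definition rep_int :: "int rep" where
  "rep_int t z \<longleftrightarrow> t = enc_int z"

definition rep_real :: "real rep" where
  "rep_real t r \<longleftrightarrow> (\<exists>(a :: int) (b :: nat). b > 0 \<and> r = real_of_int a / real b \<and>
     t = Cell (enc_int a) (enc_nat b))"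

fun rep_prod :: "'a rep \<Rightarrow> 'b rep \<Rightarrow> ('a \<times> 'b) rep" where
  "rep_prod ra rb t (a, b) \<longleftrightarrow> (\<exists>u v. t = Cell u v \<and> ra u a \<and> rb v b)"

definition rep_list :: "'a rep \<Rightarrow> 'a list rep" where
  "rep_list r t xs \<longleftrightarrow> (\<exists>ts. t = foldr Cell ts Atom \<and> list_all2 r ts xs)"

definition rep_set :: "'a rep \<Rightarrow> 'a set rep" where
  "rep_set r t A \<longleftrightarrow> (\<exists>xs. distinct xs \<and> set xs = A \<and> rep_list r t xs)"

definition rep_mat :: "'a rep \<Rightarrow> 'a mat rep" where
  "rep_mat r t A \<longleftrightarrow>
     rep_prod rep_nat (rep_prod rep_nat (rep_list (rep_list r))) t
       (dim_row A, dim_col A, mat_to_list A)"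


section \<open>Minimization problems and polynomial reductions\<close>

record ('i, 's) min_problem =
  instances :: "'i set"
  feasible :: "'i \<Rightarrow> 's set"
  objective :: "'i \<Rightarrow> 's \<Rightarrow> real"

definition optimal :: "('i, 's) min_problem \<Rightarrow> 'i \<Rightarrow> 's \<Rightarrow> bool" where
  "optimal P i s \<longleftrightarrow> s \<in> feasible P i \<and> (\<forall>s' \<in> feasible P i. objective P i s \<le> objective P i s')"

definition optimal_value :: "('i, 's) min_problem \<Rightarrow> 'i \<Rightarrow> real" where
  "optimal_value P i = (INF s \<in> feasible P i. objective P i s)"

text \<open>Besides the solution (or the value) of the produced instance, the two maps that translate
  back may also use the original instance.\<close>

definition polynomial_reduction ::
  "'i rep \<Rightarrow> 's rep \<Rightarrow> ('i, 's) min_problem \<Rightarrow> 'j rep \<Rightarrow> 't rep \<Rightarrow> ('j, 't) min_problem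
     \<Rightarrow> ('i \<Rightarrow> 'j) \<Rightarrow> bool" where
  "polynomial_reduction ri rs P rj rt Q f \<longleftrightarrow>
     (\<forall>i \<in> instances P. f i \<in> instances Q) \<and>
     polytime_computable_on (instances P) ri rj f \<and>
     (\<exists>g. polytime_computable_on {(i, s). i \<in> instances P \<and> optimal Q (f i) s}
            (rep_prod ri rt) rs g \<and>
          (\<forall>i \<in> instances P. \<forall>s. optimal Q (f i) s \<longrightarrow> optimal P i (g (i, s)))) \<and>
     (\<exists>h. polytime_computable_on {(i, v). i \<in> instances P \<and> v = optimal_value Q (f i)}
            (rep_prod ri rep_real) rep_real h \<and>
          (\<forall>i \<in> instances P. h (i, optimal_value Q (f i)) = optimal_value P i))"


section \<open>Minimum bisection\<close>

text \<open>An undirected edge is a pair of opposite arcs, of which exactly one leads from \<open>S\<close> to its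
  complement if the edge is cut.\<close>

definition cut_edges :: "'a pair_pre_digraph \<Rightarrow> 'a set \<Rightarrow> ('a \<times> 'a) set" where
  "cut_edges G S = {(v, w) \<in> parcs G. v \<in> S \<and> w \<in> pverts G - S}"

definition MBP :: "('a pair_pre_digraph, 'a set) min_problem" where
  "MBP = \<lparr> instances = {G. pair_graph G},
           feasible = (\<lambda>G. {S. S \<subseteq> pverts G \<and>
              int (card S) \<le> \<lceil>real (card (pverts G)) / 2\<rceil> \<and>
              int (card (pverts G - S)) \<le> \<lceil>real (card (pverts G)) / 2\<rceil>}),
           objective = (\<lambda>G S. real (card (cut_edges G S))) \<rparr>"

definition infinite_grid :: "(int \<times> int) pair_pre_digraph" where
  "infinite_grid = \<lparr> pverts = UNIV, parcs = {((a, b), (c, d)). (a - c)\<^sup>2 + (b - d)\<^sup>2 = 1} \<rparr>"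

definition MBFH :: "((int \<times> int) pair_pre_digraph, (int \<times> int) set) min_problem" where
  "MBFH = MBP \<lparr> instances :=
     {G \<in> instances MBP. subgraph (with_proj G) (with_proj infinite_grid)} \<rparr>"

definition rep_grid_node :: "(int \<times> int) rep" where
  "rep_grid_node = rep_prod rep_int rep_int"

definition rep_grid_graph :: "(int \<times> int) pair_pre_digraph rep" where
  "rep_grid_graph t G \<longleftrightarrow>
     rep_prod (rep_set rep_grid_node) (rep_set (rep_prod rep_grid_node rep_grid_node)) t
       (pverts G, parcs G)"

definition grid_graph_size :: "(int \<times> int) pair_pre_digraph \<Rightarrow> nat" where
  "grid_graph_size G = card (pverts G) + card (parcs G)"


section \<open>Trust-region integer programs with total variation\<close>

record tr_ip_instance =
  ti_N :: nat
  ti_M :: nat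
  ti_Xi :: "int set"
  ti_x :: "int mat"
  ti_c :: "real mat"
  ti_alpha :: real
  ti_Delta :: nat

text \<open>Matrix indices start at \<open>0\<close>.\<close>

definition tr_ip_valid :: "tr_ip_instance \<Rightarrow> bool" where
  "tr_ip_valid I \<longleftrightarrow>
     ti_N I \<ge> 1 \<and> ti_M I \<ge> 1 \<and>
     (\<exists>l u. ti_Xi I = {l..u}) \<and>
     ti_x I \<in> carrier_mat (ti_N I) (ti_M I) \<and>
     (\<forall>i < ti_N I. \<forall>j < ti_M I. ti_x I $$ (i, j) \<in> ti_Xi I) \<and>
     ti_c I \<in> carrier_mat (ti_N I) (ti_M I) \<and>
     ti_alpha I > 0"

definition tr_ip_feasible :: "tr_ip_instance \<Rightarrow> int mat set" where
  "tr_ip_feasible I =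
     {d \<in> carrier_mat (ti_N I) (ti_M I).
        (\<forall>i < ti_N I. \<forall>j < ti_M I. ti_x I $$ (i, j) + d $$ (i, j) \<in> ti_Xi I) \<and>
        (\<Sum>i < ti_N I. \<Sum>j < ti_M I. \<bar>d $$ (i, j)\<bar>) \<le> int (ti_Delta I)}"

definition tr_ip_objective :: "tr_ip_instance \<Rightarrow> int mat \<Rightarrow> real" where
  "tr_ip_objective I d =
     (let N = ti_N I; M = ti_M I; x = ti_x I; c = ti_c I; \<alpha> = ti_alpha I in
        (\<Sum>i < N. \<Sum>j < M. c $$ (i, j) * real_of_int (d $$ (i, j)))
        + \<alpha> * (\<Sum>j < M. \<Sum>i < N - 1.
            real_of_int \<bar>x $$ (i + 1, j) + d $$ (i + 1, j) - x $$ (i, j) - d $$ (i, j)\<bar>)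
        + \<alpha> * (\<Sum>i < N. \<Sum>j < M - 1.
            real_of_int \<bar>x $$ (i, j + 1) + d $$ (i, j + 1) - x $$ (i, j) - d $$ (i, j)\<bar>))"

definition TR_IP :: "(tr_ip_instance, int mat) min_problem" where
  "TR_IP = \<lparr> instances = {I. tr_ip_valid I}, feasible = tr_ip_feasible,
             objective = tr_ip_objective \<rparr>"

text \<open>Only instances with rational data have a representation.\<close>

definition rep_tr_ip :: "tr_ip_instance rep" where
  "rep_tr_ip t I \<longleftrightarrow>
     rep_prod rep_nat (rep_prod rep_nat (rep_prod (rep_set rep_int) (rep_prod (rep_mat rep_int)
       (rep_prod (rep_mat rep_real) (rep_prod rep_real rep_nat))))) t
       (ti_N I, ti_M I, ti_Xi I, ti_x I, ti_c I, ti_alpha I, ti_Delta I)"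

end

theory Submission
  imports Defs
begin

text \<open>
  A feasible point \<open>d\<close> is read as the black-and-white picture \<open>w = x + d\<close>
  with \<open>\<alpha> = 1\<close>, so that the objective charges one unit for every pair of neighbouring pixels of
  different colour. Every node of the grid graph becomes a square block of \<open>L \<times> L\<close> pixels and every
  edge becomes a bridge of two pixels (the stubs of its two arcs) between the facing sides of two
  blocks. All remaining pixels are made to keep their colour by costs of \<open>5\<close> or \<open>- 5\<close>: flipping one of
  them cannot save more than the four pairs it belongs to. A block or bridge pixel next to \<open>k\<close> such
  white pixels would be punished for being black; the cost \<open>- k\<close> cancels this. What remains of the
  objective counts the discordant pairs inside blocks and bridges. If all blocks are
  monochromatic, the cheapest colouring of the bridges leaves one discordant pair for every edge
  between a black and a white block, that is, the size of a cut.

  Let \<open>m\<close> be half the number of nodes, rounded up. The budget \<open>\<Delta>\<close> is \<open>L\<^sup>2 m\<close> plus the number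
  of stubs. The stubs are too few to pay for a large part of another block, so at most \<open>m\<close> blocks are
  black. Conversely five pixels of every block carry an additional cost of \<open>- 1\<close>; colouring a block
  black gains \<open>5\<close> and cuts at most \<open>4\<close> further edges, so in an optimum \<open>m\<close> blocks are black. For an odd
  number of nodes this loses nothing because complementary parts have the same cut. The gain \<open>5 m\<close>
  is offset by a strip of \<open>5 m - 1\<close> pixels that are black from the start and whose
  boundary has length \<open>5 m\<close>. Hence the optimal values of the two problems agree and the
  translation of values is the identity. All costs are integers between \<open>- 5\<close> and \<open>5\<close>, so the
  required bounds on the cost matrix are immediate.

  The crucial point is that it never pays to colour a block partially
  (\<open>block_dichotomy\<close>). A picture of a block that is not monochromatic has, for one of the two colours,
  many discordant pairs compared with the number of bridges, of rewarded pixels and of pixels that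
  have the other colour. Bridges and rewarded pixels are spread over the rows and columns, so that each
  of them forces additional discordant pairs. \<open>energy_lower_bound\<close> sums this over all blocks, and
  \<open>energy_upper_bound\<close> evaluates the picture of a bisection.

  Coordinates of nodes are binary numbers, so the bounding box of a graph may be exponentially
  large. A coordinate is therefore replaced by its rank among the coordinates that occur; this keeps
  neighbouring coordinates neighbouring, and edges join ranks that differ by one.

  Functions between encoded types that are computed by WHILE programs in polynomial
  time (\<open>ptime\<close>) are closed under composition, pairing, branching and those loops whose accumulator grows by a
  polynomial amount per step (\<open>ptime_fold\<close>). The reduction and the decoding of
  solutions are list functions built from these closure properties; sizes are handled in unary, as
  lengths of lists, until the final conversion.
\<close>

section \<open>WHILE programs with postconditions and cost bounds\<close>

definition halts_within :: "wcom \<Rightarrow> wstate \<Rightarrow> nat \<Rightarrow> (wstate \<Rightarrow> bool) \<Rightarrow> bool" where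
  "halts_within c s B Q \<longleftrightarrow> (\<exists>k s'. wexec c s k s' \<and> k \<le> B \<and> Q s')"

lemma halts_within_assign:
  "1 + wcost e s \<le> B \<Longrightarrow> Q (s(x := weval e s)) \<Longrightarrow> halts_within (WAssign x e) s B Q"
  unfolding halts_within_def using wexec.Assign by blast

lemma halts_within_seq:
  assumes "halts_within c1 s B1 R" and "\<And>s1. R s1 \<Longrightarrow> halts_within c2 s1 B2 Q" and "1 + B1 + B2 \<le> B"
  shows "halts_within (WSeq c1 c2) s B Q"
proof -
  obtain k1 s1 where 1: "wexec c1 s k1 s1" "k1 \<le> B1" "R s1"
    using assms(1) unfolding halts_within_def by blast
  obtain k2 s2 where 2: "wexec c2 s1 k2 s2" "k2 \<le> B2" "Q s2"
    using assms(2)[OF 1(3)] unfolding halts_within_def by blast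
  show ?thesis unfolding halts_within_def
    using wexec.Seq[OF 1(1) 2(1)] 1 2 assms(3)
    by (intro exI[of _ "1 + k1 + k2"] exI[of _ s2]) auto
qed

lemma halts_within_assign_seq:
  assumes "halts_within c2 (s(x := weval e s)) B2 Q" and "2 + wcost e s + B2 \<le> B"
  shows "halts_within (WSeq (WAssign x e) c2) s B Q"
  by (rule halts_within_seq[where R = "\<lambda>s1. s1 = s(x := weval e s)" and ?B1.0 = "1 + wcost e s"
        and ?B2.0 = B2])
    (use assms in \<open>auto intro: halts_within_assign\<close>)

lemma halts_within_if:
  assumes "weval e s \<noteq> Atom \<Longrightarrow> halts_within c1 s B1 Q"
    and "weval e s = Atom \<Longrightarrow> halts_within c2 s B1 Q"
    and "1 + wcost e s + B1 \<le> B"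
  shows "halts_within (WIf e c1 c2) s B Q"
proof (cases "weval e s = Atom")
  case True
  then obtain k s' where "wexec c2 s k s'" "k \<le> B1" "Q s'"
    using assms(2) unfolding halts_within_def by blast
  then show ?thesis unfolding halts_within_def
    using wexec.IfFalse[OF True] assms(3) by (meson add_left_mono le_trans)
next
  case False
  then obtain k s' where "wexec c1 s k s'" "k \<le> B1" "Q s'"
    using assms(1) unfolding halts_within_def by blast
  then show ?thesis unfolding halts_within_def
    using wexec.IfTrue[OF False] assms(3) by (meson add_left_mono le_trans)
qed

lemma halts_within_while_step:
  assumes "weval e s \<noteq> Atom" and "halts_within c s B1 R"
    and "\<And>s1. R s1 \<Longrightarrow> halts_within (WWhile e c) s1 B2 Q"
    and "1 + wcost e s + B1 + B2 \<le> B"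
  shows "halts_within (WWhile e c) s B Q"
proof -
  obtain k1 s1 where 1: "wexec c s k1 s1" "k1 \<le> B1" "R s1"
    using assms(2) unfolding halts_within_def by blast
  obtain k2 s2 where 2: "wexec (WWhile e c) s1 k2 s2" "k2 \<le> B2" "Q s2"
    using assms(3)[OF 1(3)] unfolding halts_within_def by blast
  show ?thesis unfolding halts_within_def
    using wexec.WhileTrue[OF assms(1) 1(1) 2(1)] 1 2 assms(4)
    by (intro exI[of _ "1 + wcost e s + k1 + k2"] exI[of _ s2]) auto
qed

lemma halts_within_while_stop:
  "weval e s = Atom \<Longrightarrow> 1 + wcost e s \<le> B \<Longrightarrow> Q s \<Longrightarrow> halts_within (WWhile e c) s B Q"
  unfolding halts_within_def using wexec.WhileFalse by blast

lemma halts_within_mono: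
  "halts_within c s B Q \<Longrightarrow> B \<le> B' \<Longrightarrow> (\<And>s'. Q s' \<Longrightarrow> Q' s') \<Longrightarrow> halts_within c s B' Q'"
  unfolding halts_within_def by (meson le_trans)

text \<open>Time bounds size: the tree that an assignment builds is never larger than the price paid for it.\<close>

lemma size_weval_le_wcost: "size (weval e s) \<le> wcost e s"
  by (induct e) auto

lemma wexec_size: "wexec c s k s' \<Longrightarrow> size (s' x) \<le> size (s x) + k"
proof (induct rule: wexec.induct)
  case (Assign y e s)
  then show ?case using size_weval_le_wcost[of e s] by auto
qed auto

section \<open>Polynomial-time functions on encoded data\<close>

text \<open>Bounds of the shape \<open>(n + 2) ^ C\<close> are monotone, dominate constants, and are closed under sums,
  products and composition; a single exponent thus replaces a polynomial in all closure proofs.\<close>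

definition poly_bounded :: "(nat \<Rightarrow> nat) \<Rightarrow> bool" where
  "poly_bounded h \<longleftrightarrow> (\<exists>C. \<forall>n. h n \<le> (n + 2) ^ C)"

lemma poly_bounded_const: "poly_bounded (\<lambda>n. c)"
proof -
  have "c \<le> (n + 2) ^ c" for n :: nat
    using less_exp[of c] power_mono[of 2 "n + 2" c] by linarith
  then show ?thesis unfolding poly_bounded_def by blast
qed

lemma poly_bounded_id: "poly_bounded (\<lambda>n. n)"
  unfolding poly_bounded_def by (rule exI[of _ 1]) auto

lemma poly_bounded_add:
  assumes "poly_bounded f" "poly_bounded g"
  shows "poly_bounded (\<lambda>n. f n + g n)"
proof -
  obtain C D where "\<And>n. f n \<le> (n + 2) ^ C" "\<And>n. g n \<le> (n + 2) ^ D"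
    using assms unfolding poly_bounded_def by blast
  moreover have "(n + 2) ^ C + (n + 2) ^ D \<le> (n + 2) ^ (max C D + 1)" for n :: nat
  proof -
    have "(n + 2) ^ C \<le> (n + 2) ^ max C D" "(n + 2) ^ D \<le> (n + 2) ^ max C D"
      by (auto intro!: power_increasing)
    moreover have "2 * (n + 2) ^ max C D \<le> (n + 2) ^ (max C D + 1)" by simp
    ultimately show ?thesis by linarith
  qed
  ultimately show ?thesis unfolding poly_bounded_def
    by (meson add_mono le_trans)
qed

lemma poly_bounded_mult:
  assumes "poly_bounded f" "poly_bounded g"
  shows "poly_bounded (\<lambda>n. f n * g n)"
proof -
  obtain C D where "\<And>n. f n \<le> (n + 2) ^ C" "\<And>n. g n \<le> (n + 2) ^ D"
    using assms unfolding poly_bounded_def by blast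
  then have "f n * g n \<le> (n + 2) ^ (C + D)" for n
    by (simp add: power_add mult_mono)
  then show ?thesis unfolding poly_bounded_def by blast
qed

lemma poly_bounded_power: "poly_bounded f \<Longrightarrow> poly_bounded (\<lambda>n. f n ^ C)"
  by (induct C) (auto intro: poly_bounded_const poly_bounded_mult)

lemmas poly_bounded_intros =
  poly_bounded_const poly_bounded_id poly_bounded_add poly_bounded_mult poly_bounded_power

text \<open>Canonical encodings. They agree with the representations of numbers, pairs and lists, so that
  programs can be combined as functions between types instead of trees.\<close>

class encodable =
  fixes enc :: "'a \<Rightarrow> btree"

instantiation btree :: encodable
begin
definition enc_btree :: "btree \<Rightarrow> btree" where [simp]: "enc_btree t = t"
instance ..
end

instantiation unit :: encodable
begin
definition enc_unit :: "unit \<Rightarrow> btree" where [simp]: "enc_unit u = Atom"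
instance ..
end

instantiation bool :: encodable
begin
definition enc_bool_class: "enc b = enc_bool b" for b :: bool
instance ..
end

instantiation nat :: encodable
begin
definition enc_nat_class: "enc n = enc_nat n" for n :: nat
instance ..
end

instantiation int :: encodable
begin
definition enc_int_class: "enc z = enc_int z" for z :: int
instance ..
end

instantiation prod :: (encodable, encodable) encodable
begin
definition enc_prod :: "'a \<times> 'b \<Rightarrow> btree" where "enc_prod p = Cell (enc (fst p)) (enc (snd p))"
instance ..
end

instantiation list :: (encodable) encodable
begin
definition enc_list :: "'a list \<Rightarrow> btree" where "enc_list xs = foldr Cell (map enc xs) Atom"
instance ..
end

lemma enc_Pair [simp]: "enc (a, b) = Cell (enc a) (enc b)"
  by (simp add: enc_prod_def)

lemma enc_Nil [simp]: "enc [] = Atom"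
  and enc_Cons [simp]: "enc (x # xs) = Cell (enc x) (enc xs)"
  by (simp_all add: enc_list_def)

lemma enc_True [simp]: "enc True = Cell Atom Atom"
  and enc_False [simp]: "enc False = Atom"
  by (simp_all add: enc_bool_class enc_bool_def)

lemma size_enc_append [simp]: "size (enc (xs @ ys)) = size (enc xs) + size (enc ys)"
  by (induct xs) auto

lemma length_le_size_enc: "length xs \<le> size (enc xs)"
  by (induct xs) auto

text \<open>The calling convention: register \<open>0\<close> holds the argument and then the result, register \<open>2\<close> holds a
  stack that is found again as it was left, and all other registers are scratch. Programs that obey
  it can be composed without renaming registers, because intermediate results survive on the stack.
  The bound mentions the stack since pushing a value copies the whole stack.\<close>

definition computes :: "wcom \<Rightarrow> nat \<Rightarrow> ('a::encodable \<Rightarrow> 'b::encodable) \<Rightarrow> bool" where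
  "computes c C f \<longleftrightarrow> (\<forall>s a. s 0 = enc a \<longrightarrow>
     halts_within c s ((size (enc a) + size (s 2) + 2) ^ C) (\<lambda>s'. s' 0 = enc (f a) \<and> s' 2 = s 2))"

definition ptime :: "('a::encodable \<Rightarrow> 'b::encodable) \<Rightarrow> bool" where
  "ptime f \<longleftrightarrow> (\<exists>c C. computes c C f)"

lemma computesD:
  assumes "computes c C f" "s 0 = enc a" "size (enc a) + size (s 2) \<le> n"
  shows "halts_within c s ((n + 2) ^ C) (\<lambda>s'. s' 0 = enc (f a) \<and> s' 2 = s 2)"
proof (rule halts_within_mono)
  show "halts_within c s ((size (enc a) + size (s 2) + 2) ^ C) (\<lambda>s'. s' 0 = enc (f a) \<and> s' 2 = s 2)"
    using assms(1,2) unfolding computes_def by simp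
  show "(size (enc a) + size (s 2) + 2) ^ C \<le> (n + 2) ^ C"
    using assms(3) by (intro power_mono) simp_all
qed

lemma ptimeI:
  assumes "poly_bounded h"
    and "\<And>s a. s 0 = enc a \<Longrightarrow>
      halts_within c s (h (size (enc a) + size (s 2))) (\<lambda>s'. s' 0 = enc (f a) \<and> s' 2 = s 2)"
  shows "ptime f"
proof -
  obtain C where C: "\<And>n. h n \<le> (n + 2) ^ C"
    using assms(1) unfolding poly_bounded_def by blast
  have "computes c C f" unfolding computes_def
  proof (intro allI impI)
    fix s :: wstate and a :: 'a assume "s 0 = enc a"
    from halts_within_mono[OF assms(2)[where s = s and a = a, OF this] C]
    show "halts_within c s ((size (enc a) + size (s 2) + 2) ^ C) (\<lambda>s'. s' 0 = enc (f a) \<and> s' 2 = s 2)"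
      by simp
  qed
  then show ?thesis unfolding ptime_def by blast
qed

lemma computes_size:
  assumes "computes c C f"
  shows "size (enc (f a)) \<le> size (enc a) + (size (enc a) + 2) ^ C"
proof -
  let ?s = "(\<lambda>_. Atom)(0 := enc a)"
  obtain k s' where "wexec c ?s k s'" "k \<le> (size (enc a) + 2) ^ C" "s' 0 = enc (f a)"
    using computesD[OF assms, of ?s a "size (enc a)"] unfolding halts_within_def by auto
  then show ?thesis using wexec_size[of c ?s k s' 0] by simp
qed

text \<open>This is what makes composition work: the result of a polynomial-time function is again of
  polynomial size and may be the input of the next one.\<close>

lemma ptime_size:
  assumes "ptime f"
  obtains C where "\<And>a. size (enc (f a)) \<le> (size (enc a) + 2) ^ C"
proof -
  obtain c D where D: "computes c D f" using assms unfolding ptime_def by blast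
  have "poly_bounded (\<lambda>n. n + (n + 2) ^ D)" by (intro poly_bounded_intros)
  then obtain C where "\<And>n::nat. n + (n + 2) ^ D \<le> (n + 2) ^ C" unfolding poly_bounded_def by blast
  then show ?thesis using that[of C] le_trans[OF computes_size[OF D]] by simp
qed

lemma ptime_assign:
  fixes f :: "'a::encodable \<Rightarrow> 'b::encodable"
  assumes "poly_bounded h"
    and "\<And>s (a :: 'a). s 0 = enc a \<Longrightarrow> weval e s = enc (f a)"
    and "\<And>s (a :: 'a). s 0 = enc a \<Longrightarrow> wcost e s \<le> h (size (enc a) + size (s 2))"
  shows "ptime f"
proof (rule ptimeI[where h = "\<lambda>n. 1 + h n" and c = "WAssign 0 e"])
  show "poly_bounded (\<lambda>n. 1 + h n)" by (intro poly_bounded_intros assms)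
qed (use assms in \<open>auto intro!: halts_within_assign\<close>)

primrec const_exp :: "btree \<Rightarrow> wexp" where
  "const_exp Atom = WAtom"
| "const_exp (Cell a b) = WCell (const_exp a) (const_exp b)"

lemma weval_const_exp [simp]: "weval (const_exp t) s = t"
  by (induct t) auto

lemma wcost_const_exp: "wcost (const_exp t) s = wcost (const_exp t) s'"
  by (induct t) auto

lemma ptime_const: "ptime (\<lambda>x. c)"
  by (rule ptime_assign[where h = "\<lambda>_. wcost (const_exp (enc c)) (\<lambda>_. Atom)" and e = "const_exp (enc c)"])
     (auto intro: poly_bounded_const wcost_const_exp[THEN eq_refl])

text \<open>Only trees are computed, so a function may be replaced by one with another result type as long
  as the encodings of the results coincide.\<close>

lemma ptime_enc_cong:
  fixes f :: "'a::encodable \<Rightarrow> 'b::encodable" and g :: "'a \<Rightarrow> 'c::encodable"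
  assumes "ptime f" "\<And>x. enc (g x) = enc (f x)" shows "ptime g"
  using assms unfolding ptime_def computes_def by simp

lemma ptime_id: "ptime (\<lambda>x. x)"
proof (rule ptime_assign[where e = "WVar 0" and h = "\<lambda>n. 1 + n"])
  show "poly_bounded (\<lambda>n. 1 + n)" by (intro poly_bounded_intros)
qed auto

lemma ptime_comp:
  assumes "ptime g" "ptime f" shows "ptime (\<lambda>x. g (f x))"
proof -
  obtain cf Cf cg Cg where f: "computes cf Cf f" and g: "computes cg Cg g"
    using assms unfolding ptime_def by blast
  let ?h = "\<lambda>n. 1 + (n + 2) ^ Cf + (n + (n + 2) ^ Cf + 2) ^ Cg"
  show ?thesis
  proof (rule ptimeI[where c = "WSeq cf cg" and h = ?h])
    show "poly_bounded ?h" by (intro poly_bounded_intros)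
    fix s :: wstate and a :: 'c assume s: "s 0 = enc a"
    let ?n = "size (enc a) + size (s 2)"
    show "halts_within (WSeq cf cg) s (?h ?n) (\<lambda>s'. s' 0 = enc (g (f a)) \<and> s' 2 = s 2)"
    proof (rule halts_within_seq[OF computesD[OF f, of s a ?n]])
      fix s1 :: wstate assume s1: "s1 0 = enc (f a) \<and> s1 2 = s 2"
      have "(size (enc a) + 2) ^ Cf \<le> (?n + 2) ^ Cf" by (intro power_mono) auto
      then have "size (enc (f a)) + size (s1 2) \<le> ?n + (?n + 2) ^ Cf"
        using computes_size[OF f, of a] s1 by simp
      from computesD[where s = s1 and a = "f a", OF g _ this] s1
      show "halts_within cg s1 ((?n + (?n + 2) ^ Cf + 2) ^ Cg) (\<lambda>s'. s' 0 = enc (g (f a)) \<and> s' 2 = s 2)"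
        by simp
    qed (use s in simp_all)
  qed
qed

definition push_var :: wcom where
  "push_var = WAssign 2 (WCell (WVar 0) (WVar 2))"

lemma halts_within_push:
  "10 + 5 * size (s 0) + 5 * size (s 2) \<le> B \<Longrightarrow>
   halts_within push_var s B (\<lambda>s'. s' 0 = s 0 \<and> s' 2 = Cell (s 0) (s 2))"
  unfolding push_var_def by (rule halts_within_assign) auto

definition swap_var :: wcom where
  "swap_var = WSeq (WAssign 3 (WVar 0)) (WSeq (WAssign 0 (WHd (WVar 2)))
     (WAssign 2 (WCell (WVar 3) (WTl (WVar 2)))))"

lemma halts_within_swap:
  assumes "s 2 = Cell t r" "20 + 10 * size (s 0) + 10 * size (s 2) \<le> B"
  shows "halts_within swap_var s B (\<lambda>s'. s' 0 = t \<and> s' 2 = Cell (s 0) r)"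
  unfolding swap_var_def
  by (rule halts_within_assign_seq[OF halts_within_assign_seq[OF halts_within_assign[OF order_refl] order_refl]])
     (use assms in auto)

definition pop_pair :: wcom where
  "pop_pair = WSeq (WAssign 0 (WCell (WHd (WVar 2)) (WVar 0))) (WAssign 2 (WTl (WVar 2)))"

lemma halts_within_pop_pair:
  assumes "s 2 = Cell t r" "20 + 10 * size (s 0) + 10 * size (s 2) \<le> B"
  shows "halts_within pop_pair s B (\<lambda>s'. s' 0 = Cell t (s 0) \<and> s' 2 = r)"
  unfolding pop_pair_def
  by (rule halts_within_assign_seq[OF halts_within_assign[OF order_refl]]) (use assms in auto)

definition pop_var :: wcom where
  "pop_var = WSeq (WAssign 0 (WHd (WVar 2))) (WAssign 2 (WTl (WVar 2)))"

lemma halts_within_pop: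
  assumes "s 2 = Cell t r" "20 + 10 * size (s 2) \<le> B"
  shows "halts_within pop_var s B (\<lambda>s'. s' 0 = t \<and> s' 2 = r)"
  unfolding pop_var_def
  by (rule halts_within_assign_seq[OF halts_within_assign[OF order_refl]]) (use assms in auto)

lemma computes_size_le:
  "computes c C f \<Longrightarrow> size (enc a) \<le> n \<Longrightarrow> size (enc (f a)) \<le> n + (n + 2) ^ C"
  by (meson computes_size add_mono le_trans power_mono add_right_mono le0)

text \<open>The argument waits on the stack while \<open>f\<close> runs, and then the result of \<open>f\<close> while \<open>g\<close> runs.\<close>

lemma ptime_pair:
  assumes "ptime f" "ptime g" shows "ptime (\<lambda>x. (f x, g x))"
proof -
  obtain cf Cf cg Cg where f: "computes cf Cf f" and g: "computes cg Cg g"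
    using assms unfolding ptime_def by blast
  define Sf where "Sf = (\<lambda>n :: nat. n + (n + 2) ^ Cf)"
  define Sg where "Sg = (\<lambda>n :: nat. n + (n + 2) ^ Cg)"
  let ?c = "WSeq push_var (WSeq cf (WSeq swap_var (WSeq cg pop_pair)))"
  let ?h = "\<lambda>n. 200 + 50 * n + 50 * Sf n + 50 * Sg n + (2 * n + 1 + 2) ^ Cf + (n + Sf n + 1 + 2) ^ Cg"
  show ?thesis
  proof (rule ptimeI[where c = ?c and h = ?h])
    show "poly_bounded ?h" unfolding Sf_def Sg_def by (intro poly_bounded_intros)
    fix s :: wstate and a :: 'a assume s: "s 0 = enc a"
    define n where "n = size (enc a) + size (s 2)"
    have fa: "size (enc (f a)) \<le> Sf n" and ga: "size (enc (g a)) \<le> Sg n"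
      unfolding Sf_def Sg_def by (intro computes_size_le[OF f] computes_size_le[OF g]; simp add: n_def)+
    let ?Q = "\<lambda>s' :: wstate. s' 0 = enc (f a, g a) \<and> s' 2 = s 2"
    have 4: "halts_within pop_pair s4 (100 + 20 * n + 20 * Sf n + 20 * Sg n) ?Q"
      if "s4 0 = enc (g a) \<and> s4 2 = Cell (enc (f a)) (s 2)" for s4 :: wstate
      by (rule halts_within_mono[OF halts_within_pop_pair[where s = s4, OF conjunct2[OF that] order_refl]])
        (use that fa ga in \<open>auto simp: n_def\<close>)
    have 3: "halts_within (WSeq cg pop_pair) s3 (101 + 20 * n + 20 * Sf n + 20 * Sg n + (n + Sf n + 1 + 2) ^ Cg) ?Q"
      if s3: "s3 0 = enc a \<and> s3 2 = Cell (enc (f a)) (s 2)" for s3 :: wstate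
    proof (rule halts_within_seq[OF computesD[where s = s3, OF g conjunct1[OF s3], where n = "n + Sf n + 1"]])
      show "size (enc a) + size (s3 2) \<le> n + Sf n + 1" using s3 fa by (simp add: n_def)
    qed (rule 4, use s3 in simp, simp)
    have 2: "halts_within (WSeq swap_var (WSeq cg pop_pair)) s2
       (150 + 40 * n + 40 * Sf n + 20 * Sg n + (n + Sf n + 1 + 2) ^ Cg) ?Q"
      if s2: "s2 0 = enc (f a) \<and> s2 2 = Cell (enc a) (s 2)" for s2 :: wstate
    proof (rule halts_within_seq[OF halts_within_swap[where s = s2, OF conjunct2[OF s2] order_refl]])
      show "1 + (20 + 10 * size (s2 0) + 10 * size (s2 2)) +
        (101 + 20 * n + 20 * Sf n + 20 * Sg n + (n + Sf n + 1 + 2) ^ Cg)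
        \<le> 150 + 40 * n + 40 * Sf n + 20 * Sg n + (n + Sf n + 1 + 2) ^ Cg"
        using s2 fa by (simp add: n_def)
    qed (rule 3, use s2 in simp)
    have 1: "halts_within (WSeq cf (WSeq swap_var (WSeq cg pop_pair))) s1
       (151 + 40 * n + 40 * Sf n + 20 * Sg n + (n + Sf n + 1 + 2) ^ Cg + (2 * n + 1 + 2) ^ Cf) ?Q"
      if s1: "s1 0 = s 0 \<and> s1 2 = Cell (s 0) (s 2)" for s1 :: wstate
    proof (rule halts_within_seq[OF computesD[OF f, where n = "2 * n + 1" and a = a]])
      show "s1 0 = enc a" using s1 s by simp
      show "size (enc a) + size (s1 2) \<le> 2 * n + 1" using s1 s by (simp add: n_def)
    qed (rule 2, use s1 s in simp, simp)
    show "halts_within ?c s (?h (size (enc a) + size (s 2))) ?Q"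
      unfolding n_def[symmetric]
    proof (rule halts_within_seq[OF halts_within_push[where s = s, OF order_refl]])
      show "1 + (10 + 5 * size (s 0) + 5 * size (s 2)) +
        (151 + 40 * n + 40 * Sf n + 20 * Sg n + (n + Sf n + 1 + 2) ^ Cg + (2 * n + 1 + 2) ^ Cf) \<le> ?h n"
        using s by (simp add: n_def)
    qed (rule 1)
  qed
qed

text \<open>A test on an arbitrary encoded value, since the machine only distinguishes \<^const>\<open>Atom\<close> from other trees.\<close>

lemma ptime_if_Atom:
  assumes "ptime b" "ptime f" "ptime g" shows "ptime (\<lambda>x. if enc (b x) \<noteq> Atom then f x else g x)"
proof -
  obtain cb Cb cf Cf cg Cg where b: "computes cb Cb b" and f: "computes cf Cf f" and g: "computes cg Cg g"
    using assms unfolding ptime_def by blast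
  let ?c = "WSeq push_var (WSeq cb (WIf (WVar 0) (WSeq pop_var cf) (WSeq pop_var cg)))"
  let ?h = "\<lambda>n. 200 + 50 * n + (n + (n + 2) ^ Cb) + (2 * n + 1 + 2) ^ Cb + (n + 2) ^ Cf + (n + 2) ^ Cg"
  show ?thesis
  proof (rule ptimeI[where c = ?c and h = ?h])
    show "poly_bounded ?h" by (intro poly_bounded_intros)
    fix s :: wstate and a :: 'a assume s: "s 0 = enc a"
    define n where "n = size (enc a) + size (s 2)"
    let ?Q = "\<lambda>s' :: wstate. s' 0 = enc (if enc (b a) \<noteq> Atom then f a else g a) \<and> s' 2 = s 2"
    have ba: "size (enc (b a)) \<le> n + (n + 2) ^ Cb"
      by (rule computes_size_le[OF b]) (simp add: n_def)
    have branch: "halts_within (WSeq pop_var c) s2 (50 + 20 * n + (n + 2) ^ Cf + (n + 2) ^ Cg) ?Q"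
      if s2: "s2 2 = Cell (enc a) (s 2)"
        and c: "\<And>s3. s3 0 = enc a \<and> s3 2 = s 2 \<Longrightarrow> halts_within c s3 ((n + 2) ^ Cf + (n + 2) ^ Cg) ?Q"
      for s2 :: wstate and c
      by (rule halts_within_seq[OF halts_within_pop[where s = s2, OF s2 order_refl] c]) (use s2 in \<open>simp_all add: n_def\<close>)
    have 2: "halts_within (WIf (WVar 0) (WSeq pop_var cf) (WSeq pop_var cg)) s2
        (60 + 20 * n + (n + (n + 2) ^ Cb) + (n + 2) ^ Cf + (n + 2) ^ Cg) ?Q"
      if s2: "s2 0 = enc (b a) \<and> s2 2 = Cell (enc a) (s 2)" for s2 :: wstate
    proof (rule halts_within_if)
      show "halts_within (WSeq pop_var cf) s2 (50 + 20 * n + (n + 2) ^ Cf + (n + 2) ^ Cg) ?Q"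
        if "weval (WVar 0) s2 \<noteq> Atom"
      proof (rule branch)
        fix s3 :: wstate assume "s3 0 = enc a \<and> s3 2 = s 2"
        then show "halts_within cf s3 ((n + 2) ^ Cf + (n + 2) ^ Cg) ?Q"
          using that s2 by (intro halts_within_mono[OF computesD[OF f, where n = n and a = a]])
            (auto simp: n_def)
      qed (use s2 in simp)
      show "halts_within (WSeq pop_var cg) s2 (50 + 20 * n + (n + 2) ^ Cf + (n + 2) ^ Cg) ?Q"
        if "weval (WVar 0) s2 = Atom"
      proof (rule branch)
        fix s3 :: wstate assume "s3 0 = enc a \<and> s3 2 = s 2"
        then show "halts_within cg s3 ((n + 2) ^ Cf + (n + 2) ^ Cg) ?Q"
          using that s2 by (intro halts_within_mono[OF computesD[OF g, where n = n and a = a]])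
            (auto simp: n_def)
      qed (use s2 in simp)
    qed (use s2 ba in simp)
    have 1: "halts_within (WSeq cb (WIf (WVar 0) (WSeq pop_var cf) (WSeq pop_var cg))) s1
        (61 + 20 * n + (n + (n + 2) ^ Cb) + (n + 2) ^ Cf + (n + 2) ^ Cg + (2 * n + 1 + 2) ^ Cb) ?Q"
      if s1: "s1 0 = s 0 \<and> s1 2 = Cell (s 0) (s 2)" for s1 :: wstate
    proof (rule halts_within_seq[OF computesD[OF b, where n = "2 * n + 1" and a = a]])
      show "s1 0 = enc a" using s1 s by simp
      show "size (enc a) + size (s1 2) \<le> 2 * n + 1" using s1 s by (simp add: n_def)
    qed (rule 2, use s1 s in simp, simp)
    show "halts_within ?c s (?h (size (enc a) + size (s 2))) ?Q"
      unfolding n_def[symmetric]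
      by (rule halts_within_seq[OF halts_within_push[where s = s, OF order_refl] 1]) (use s in \<open>simp_all add: n_def\<close>)
  qed
qed

text \<open>A loop over a list keeps the accumulator in register \<open>0\<close>; on top of the stack lies the pair of the
  loop parameter and the part of the list that is still to be processed.\<close>

definition fold_body :: "wcom \<Rightarrow> wcom" where
  "fold_body c = WSeq (WAssign 0 (WCell (WHd (WHd (WVar 2))) (WCell (WHd (WTl (WHd (WVar 2)))) (WVar 0))))
     (WSeq (WAssign 2 (WCell (WCell (WHd (WHd (WVar 2))) (WTl (WTl (WHd (WVar 2))))) (WTl (WVar 2)))) c)"

definition fold_loop :: "wcom \<Rightarrow> wcom" where
  "fold_loop c = WWhile (WTl (WHd (WVar 2))) (fold_body c)"

definition fold_prog :: "wcom \<Rightarrow> wcom" where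
  "fold_prog c = WSeq
     (WSeq (WAssign 2 (WCell (WCell (WHd (WVar 0)) (WHd (WTl (WVar 0)))) (WVar 2)))
       (WAssign 0 (WTl (WTl (WVar 0)))))
     (WSeq (fold_loop c) (WAssign 2 (WTl (WVar 2))))"

lemma halts_within_fold_body:
  fixes f :: "'x::encodable \<times> 'a::encodable \<times> 'b::encodable \<Rightarrow> 'b"
  assumes c: "computes c C f"
    and s: "s 0 = enc acc" "s 2 = Cell (Cell (enc x) (enc (a # l))) r"
    and M: "size (enc x) + size (enc (a # l)) + size (enc acc) + size r + 10 \<le> M"
  shows "halts_within (fold_body c) s (100 + 50 * M + (3 * M + 2) ^ C)
    (\<lambda>s'. s' 0 = enc (f (x, a, acc)) \<and> s' 2 = Cell (Cell (enc x) (enc l)) r)"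
proof -
  let ?s = "s(0 := enc (x, a, acc), 2 := Cell (Cell (enc x) (enc l)) r)"
  have c': "halts_within c ?s ((3 * M + 2) ^ C) (\<lambda>s'. s' 0 = enc (f (x, a, acc)) \<and> s' 2 = ?s 2)"
    by (rule computesD[OF c]) (use M in auto)
  show ?thesis unfolding fold_body_def
    by (rule halts_within_assign_seq,
        rule halts_within_assign_seq[where ?B2.0 = "(3 * M + 2) ^ C", OF _ order_refl])
      (use c' s M in \<open>simp_all\<close>)
qed

text \<open>Every iteration costs at most a fixed polynomial of \<open>M\<close> because \<open>b\<close> bounds all intermediate
  accumulators, which are the results of folding over prefixes of the list.\<close>

lemma halts_within_fold_loop:
  fixes f :: "'x::encodable \<times> 'a::encodable \<times> 'b::encodable \<Rightarrow> 'b"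
  assumes c: "computes c C f"
  shows "s 0 = enc acc \<Longrightarrow> s 2 = Cell (Cell (enc x) (enc l)) r \<Longrightarrow>
    (\<And>ys zs. l = ys @ zs \<Longrightarrow> size (enc (fold (\<lambda>a acc. f (x, a, acc)) ys acc)) \<le> b) \<Longrightarrow>
    size (enc x) + size (enc l) + b + size r + 10 \<le> M \<Longrightarrow>
    halts_within (fold_loop c) s ((length l + 1) * (200 + 60 * M + (3 * M + 2) ^ C))
      (\<lambda>s'. s' 0 = enc (fold (\<lambda>a acc. f (x, a, acc)) l acc) \<and> s' 2 = Cell (Cell (enc x) Atom) r)"
proof (induct l arbitrary: s acc)
  case Nil
  then show ?case unfolding fold_loop_def
    by (intro halts_within_while_stop) auto
next
  case (Cons a l)
  have b: "size (enc acc) \<le> b" using Cons(4)[of "[]"] by simp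
  let ?T = "200 + 60 * M + (3 * M + 2) ^ C"
  show ?case unfolding fold_loop_def
  proof (rule halts_within_while_step[where ?B1.0 = "100 + 50 * M + (3 * M + 2) ^ C"
        and ?B2.0 = "(length l + 1) * ?T"])
    show "halts_within (fold_body c) s (100 + 50 * M + (3 * M + 2) ^ C)
      (\<lambda>s'. s' 0 = enc (f (x, a, acc)) \<and> s' 2 = Cell (Cell (enc x) (enc l)) r)"
      by (rule halts_within_fold_body[OF c Cons(2,3)]) (use Cons(5) b in simp)
    fix s1 :: wstate
    assume s1: "s1 0 = enc (f (x, a, acc)) \<and> s1 2 = Cell (Cell (enc x) (enc l)) r"
    have "halts_within (fold_loop c) s1 ((length l + 1) * ?T)
      (\<lambda>s'. s' 0 = enc (fold (\<lambda>a acc. f (x, a, acc)) l (f (x, a, acc))) \<and> s' 2 = Cell (Cell (enc x) Atom) r)"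
    proof (rule Cons(1))
      show "size (enc (fold (\<lambda>a acc. f (x, a, acc)) ys (f (x, a, acc)))) \<le> b" if "l = ys @ zs" for ys zs
        using Cons(4)[of "a # ys" zs] that by simp
    qed (use s1 Cons(5) in simp_all)
    then show "halts_within (WWhile (WTl (WHd (WVar 2))) (fold_body c)) s1 ((length l + 1) * ?T)
      (\<lambda>s'. s' 0 = enc (fold (\<lambda>a acc. f (x, a, acc)) (a # l) acc) \<and> s' 2 = Cell (Cell (enc x) Atom) r)"
      by (simp add: fold_loop_def)
  next
    show "weval (WTl (WHd (WVar 2))) s \<noteq> Atom" using Cons(3) by simp
    have "1 + wcost (WTl (WHd (WVar 2))) s + (100 + 50 * M + (3 * M + 2) ^ C) \<le> ?T"
      using Cons(3,5) by simp
    then show "1 + wcost (WTl (WHd (WVar 2))) s + (100 + 50 * M + (3 * M + 2) ^ C) + (length l + 1) * ?T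
       \<le> (length (a # l) + 1) * ?T" by simp
  qed
qed

text \<open>The growth of the accumulator in one step must be bounded by an amount that does not depend on
  the accumulator itself. Such amounts add up to a polynomial, whereas a growth by a factor per
  step would make the accumulator exponentially large.\<close>

lemma ptime_fold_uncurried:
  fixes f :: "'x::encodable \<times> 'a::encodable \<times> 'b::encodable \<Rightarrow> 'b"
  assumes f: "ptime f"
    and growth: "\<And>x a acc. size (enc (f (x, a, acc))) \<le> size (enc acc) + (size (enc x) + size (enc a) + 2) ^ D"
  shows "ptime (\<lambda>p. fold (\<lambda>a acc. f (fst p, a, acc)) (fst (snd p)) (snd (snd p)))"
proof -
  obtain c C where c: "computes c C f" using f unfolding ptime_def by blast
  define b where "b = (\<lambda>n :: nat. n + n * (n + 2) ^ D)"
  define M where "M = (\<lambda>n. 2 * n + b n + 10)"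
  let ?h = "\<lambda>n. 500 + 100 * M n + (n + 1) * (200 + 60 * M n + (3 * M n + 2) ^ C)"
  show ?thesis
  proof (rule ptimeI[where c = "fold_prog c" and h = ?h])
    show "poly_bounded ?h" unfolding M_def b_def by (intro poly_bounded_intros)
    fix s :: wstate and p :: "'x \<times> 'a list \<times> 'b" assume s0: "s 0 = enc p"
    define n where "n = size (enc p) + size (s 2)"
    obtain x l acc where p: "p = (x, l, acc)" by (metis prod.collapse)
    let ?F = "\<lambda>l acc. fold (\<lambda>a acc. f (x, a, acc)) l acc"
    let ?Q = "\<lambda>s' :: wstate. s' 0 = enc (?F l acc) \<and> s' 2 = s 2"
    have grow: "size (enc (?F ys acc')) \<le> size (enc acc') + length ys * (size (enc x) + size (enc ys) + 2) ^ D"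
      for ys acc'
    proof (induct ys arbitrary: acc')
      case (Cons a ys)
      have "size (enc (?F (a # ys) acc'))
        \<le> size (enc (f (x, a, acc'))) + length ys * (size (enc x) + size (enc ys) + 2) ^ D"
        using Cons[of "f (x, a, acc')"] by simp
      also have "\<dots> \<le> size (enc acc') + (size (enc x) + size (enc a) + 2) ^ D
          + length ys * (size (enc x) + size (enc ys) + 2) ^ D"
        using growth[of x a acc'] by simp
      also have "\<dots> \<le> size (enc acc') + (size (enc x) + size (enc (a # ys)) + 2) ^ D
          + length ys * (size (enc x) + size (enc (a # ys)) + 2) ^ D"
        by (intro add_mono mult_mono power_mono order_refl) auto
      finally show ?case by simp
    qed simp
    have bound: "size (enc (?F ys acc)) \<le> b n" if "l = ys @ zs" for ys zs
    proof -
      have "length ys * (size (enc x) + size (enc ys) + 2) ^ D \<le> n * (n + 2) ^ D"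
        using length_le_size_enc[of ys] that by (intro mult_mono power_mono) (auto simp: n_def p)
      then show ?thesis using grow[of ys acc] by (auto simp: b_def n_def p)
    qed
    have size: "size (enc x) + size (enc l) + size (enc acc) + size (s 2) + 2 \<le> n" "length l \<le> n"
      using length_le_size_enc[of l] by (auto simp: n_def p)
    have loop: "halts_within (fold_loop c) s1 ((n + 1) * (200 + 60 * M n + (3 * M n + 2) ^ C))
      (\<lambda>s'. s' 0 = enc (?F l acc) \<and> s' 2 = Cell (Cell (enc x) Atom) (s 2))"
      if s1: "s1 0 = enc acc \<and> s1 2 = Cell (Cell (enc x) (enc l)) (s 2)" for s1 :: wstate
    proof (rule halts_within_mono[OF halts_within_fold_loop[OF c, where s = s1 and b = "b n" and M = "M n"]])
      show "(length l + 1) * (200 + 60 * M n + (3 * M n + 2) ^ C)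
        \<le> (n + 1) * (200 + 60 * M n + (3 * M n + 2) ^ C)"
        using size by (intro mult_right_mono) auto
      show "size (enc (?F ys acc)) \<le> b n" if "l = ys @ zs" for ys zs using bound[OF that] .
      show "size (enc x) + size (enc l) + b n + size (s 2) + 10 \<le> M n" using size by (simp add: M_def)
    qed (use s1 in auto)
    have init: "halts_within (WSeq (WAssign 2 (WCell (WCell (WHd (WVar 0)) (WHd (WTl (WVar 0)))) (WVar 2)))
       (WAssign 0 (WTl (WTl (WVar 0))))) s (100 + 50 * M n)
       (\<lambda>s1. s1 0 = enc acc \<and> s1 2 = Cell (Cell (enc x) (enc l)) (s 2))"
      by (rule halts_within_assign_seq[OF halts_within_assign[OF order_refl]])
        (use s0 size in \<open>auto simp: p M_def\<close>)
    have fin: "halts_within (WAssign 2 (WTl (WVar 2))) s2 (100 + 20 * M n) ?Q"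
      if "s2 0 = enc (?F l acc) \<and> s2 2 = Cell (Cell (enc x) Atom) (s 2)" for s2 :: wstate
      by (rule halts_within_assign) (use that size in \<open>auto simp: M_def\<close>)
    have rest: "halts_within (WSeq (fold_loop c) (WAssign 2 (WTl (WVar 2)))) s1
        (200 + 20 * M n + (n + 1) * (200 + 60 * M n + (3 * M n + 2) ^ C)) ?Q"
      if s1: "s1 0 = enc acc \<and> s1 2 = Cell (Cell (enc x) (enc l)) (s 2)" for s1 :: wstate
      by (rule halts_within_seq[OF loop[OF s1] fin]) simp_all
    show "halts_within (fold_prog c) s (?h (size (enc p) + size (s 2)))
      (\<lambda>s'. s' 0 = enc (fold (\<lambda>a acc. f (fst p, a, acc)) (fst (snd p)) (snd (snd p))) \<and> s' 2 = s 2)"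
      unfolding n_def[symmetric] fold_prog_def
      by (rule halts_within_mono[OF halts_within_seq[OF init rest order_refl]]) (simp_all add: p)
  qed
qed

lemma ptime_fold:
  assumes f: "ptime (\<lambda>p. f (fst p) (fst (snd p)) (snd (snd p)))" and l: "ptime l" and i: "ptime i"
    and growth: "\<And>x a acc. size (enc (f x a acc)) \<le> size (enc acc) + (size (enc x) + size (enc a) + 2) ^ D"
  shows "ptime (\<lambda>x. fold (f x) (l x) (i x))"
  using ptime_comp[OF ptime_fold_uncurried[OF f] ptime_pair[OF ptime_id ptime_pair[OF l i]], of D] growth
  by simp

lemma ptime_if:
  assumes "ptime b" "ptime f" "ptime g" shows "ptime (\<lambda>x. if b x then f x else g x)"
proof (rule ptime_enc_cong[OF ptime_if_Atom[OF assms]])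
  show "enc (if b x then f x else g x) = enc (if enc (b x) \<noteq> Atom then f x else g x)" for x
    by (cases "b x") auto
qed

section \<open>Polynomial-time list processing and arithmetic\<close>

lemma ptime_tree_hd:
  assumes "ptime f" "\<And>x. enc (g x) = tree_hd (enc (f x))" shows "ptime g"
proof -
  have "ptime tree_hd"
  proof (rule ptime_assign[where e = "WHd (WVar 0)" and h = "\<lambda>n. 2 + 2 * n"])
    show "poly_bounded (\<lambda>n. 2 + 2 * n)" by (intro poly_bounded_intros)
    show "wcost (WHd (WVar 0)) s \<le> 2 + 2 * (size (enc a) + size (s 2))" if "s 0 = enc a" for s and a :: btree
      using that by (cases a) auto
  qed auto
  moreover have "ptime (\<lambda>x. enc (f x))" by (rule ptime_enc_cong[OF assms(1)]) simp
  ultimately have "ptime (\<lambda>x. tree_hd (enc (f x)))" by (rule ptime_comp)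
  then show ?thesis by (rule ptime_enc_cong) (simp add: assms(2))
qed

lemma ptime_tree_tl:
  assumes "ptime f" "\<And>x. enc (g x) = tree_tl (enc (f x))" shows "ptime g"
proof -
  have "ptime tree_tl"
  proof (rule ptime_assign[where e = "WTl (WVar 0)" and h = "\<lambda>n. 2 + 2 * n"])
    show "poly_bounded (\<lambda>n. 2 + 2 * n)" by (intro poly_bounded_intros)
    show "wcost (WTl (WVar 0)) s \<le> 2 + 2 * (size (enc a) + size (s 2))" if "s 0 = enc a" for s and a :: btree
      using that by (cases a) auto
  qed auto
  moreover have "ptime (\<lambda>x. enc (f x))" by (rule ptime_enc_cong[OF assms(1)]) simp
  ultimately have "ptime (\<lambda>x. tree_tl (enc (f x)))" by (rule ptime_comp)
  then show ?thesis by (rule ptime_enc_cong) (simp add: assms(2))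
qed

lemma ptime_fst: "ptime f \<Longrightarrow> ptime (\<lambda>x. fst (f x))"
  by (rule ptime_tree_hd) (auto simp: enc_prod_def)

lemma ptime_snd: "ptime f \<Longrightarrow> ptime (\<lambda>x. snd (f x))"
  by (rule ptime_tree_tl) (auto simp: enc_prod_def)

lemma ptime_not: "ptime f \<Longrightarrow> ptime (\<lambda>x. \<not> f x)"
  by (rule ptime_enc_cong[OF ptime_if[OF _ ptime_const ptime_const, of _ False True]]) auto

lemma ptime_conj:
  assumes "ptime f" "ptime g" shows "ptime (\<lambda>x. f x \<and> g x)"
  using ptime_if[OF assms ptime_const[of False]] by (rule ptime_enc_cong) auto

lemma ptime_disj:
  assumes "ptime f" "ptime g" shows "ptime (\<lambda>x. f x \<or> g x)"
  using ptime_if[OF assms(1) ptime_const[of True] assms(2)] by (rule ptime_enc_cong) auto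

lemma ptime_is_Nil: "ptime f \<Longrightarrow> ptime (\<lambda>x. f x = [])"
proof (rule ptime_enc_cong[OF ptime_if_Atom[OF _ ptime_const ptime_const, of f False True]])
  show "enc (f x = []) = enc (if enc (f x) \<noteq> Atom then False else True)" for x by (cases "f x") auto
qed

lemma ptime_tl: "ptime f \<Longrightarrow> ptime (\<lambda>x. tl (f x))"
proof (rule ptime_tree_tl)
  show "enc (tl (f x)) = tree_tl (enc (f x))" for x by (cases "f x") auto
qed

text \<open>The unspecified value \<open>hd []\<close> is a fixed tree and can be returned as a constant.\<close>

lemma ptime_hd:
  fixes f :: "'a::encodable \<Rightarrow> 'b::encodable list"
  assumes "ptime f" shows "ptime (\<lambda>x. hd (f x))"
proof -
  have "ptime (\<lambda>x. tree_hd (enc (f x)))" by (rule ptime_tree_hd[OF assms]) simp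
  from ptime_if_Atom[OF assms this ptime_const, of "enc (hd ([] :: 'b list))"]
  show ?thesis
  proof (rule ptime_enc_cong)
    show "enc (hd (f x)) = enc (if enc (f x) \<noteq> Atom then tree_hd (enc (f x)) else enc (hd ([] :: 'b list)))" for x
      by (cases "f x") auto
  qed
qed

lemma ptime_Cons: "ptime f \<Longrightarrow> ptime g \<Longrightarrow> ptime (\<lambda>x. f x # g x)"
  by (rule ptime_enc_cong[OF ptime_pair]) auto

lemmas ptime_intros = ptime_id ptime_const ptime_pair ptime_fst ptime_snd ptime_if ptime_not
  ptime_conj ptime_disj ptime_is_Nil ptime_tl ptime_hd ptime_Cons

lemma ptime_rev: "ptime f \<Longrightarrow> ptime (\<lambda>x. rev (f x))"
proof -
  assume f: "ptime f"
  have "ptime (\<lambda>x. fold (\<lambda>a acc. a # acc) (f x) [])"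
    by (rule ptime_fold[where D = 1]) (auto intro!: ptime_intros f)
  then show ?thesis by (simp add: rev_conv_fold)
qed

lemma ptime_append: "ptime f \<Longrightarrow> ptime g \<Longrightarrow> ptime (\<lambda>x. f x @ g x)"
proof -
  assume "ptime f" "ptime g"
  then have "ptime (\<lambda>x. fold (\<lambda>a acc. a # acc) (rev (f x)) (g x))"
    by (intro ptime_fold[where D = 1]) (auto intro!: ptime_intros ptime_rev)
  then show ?thesis by (simp add: fold_Cons_rev)
qed

lemma fold_rev_map: "fold (\<lambda>a acc. f a # acc) l acc = rev (map f l) @ acc"
  by (induct l arbitrary: acc) auto

lemma fold_rev_filter: "fold (\<lambda>a acc. if P a then a # acc else acc) l acc = rev (filter P l) @ acc"
  by (induct l arbitrary: acc) auto

lemma ptime_map: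
  assumes f: "ptime (\<lambda>p. f (fst p) (snd p))" and l: "ptime l"
  shows "ptime (\<lambda>x. map (f x) (l x))"
proof -
  obtain C where C: "\<And>p. size (enc (f (fst p) (snd p))) \<le> (size (enc p) + 2) ^ C"
    by (rule ptime_size[OF f]) blast
  have "poly_bounded (\<lambda>n. (n + 1 + 2) ^ C + 1)" by (intro poly_bounded_intros)
  then obtain D where D: "\<And>n :: nat. (n + 1 + 2) ^ C + 1 \<le> (n + 2) ^ D" unfolding poly_bounded_def by blast
  have fc: "ptime (\<lambda>p. f (fst p) (fst (snd p)))"
    using ptime_comp[OF f, of "\<lambda>p. (fst p, fst (snd p))"] by (simp add: ptime_intros)
  have "ptime (\<lambda>x. fold (\<lambda>a acc. f x a # acc) (l x) [])"
  proof (rule ptime_fold[where D = D])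
    show "size (enc (f x a # acc)) \<le> size (enc acc) + (size (enc x) + size (enc a) + 2) ^ D" for x a acc
      using C[of "(x, a)"] D[of "size (enc x) + size (enc a)"] by (simp add: add.assoc)
  qed (auto intro!: ptime_intros fc l)
  then have "ptime (\<lambda>x. rev (fold (\<lambda>a acc. f x a # acc) (l x) []))" by (rule ptime_rev)
  then show ?thesis by (simp add: fold_rev_map)
qed

lemma ptime_filter:
  assumes f: "ptime (\<lambda>p. P (fst p) (snd p))" and l: "ptime l"
  shows "ptime (\<lambda>x. filter (P x) (l x))"
proof -
  have fc: "ptime (\<lambda>p. P (fst p) (fst (snd p)))"
    using ptime_comp[OF f, of "\<lambda>p. (fst p, fst (snd p))"] by (simp add: ptime_intros)
  have "ptime (\<lambda>x. fold (\<lambda>a acc. if P x a then a # acc else acc) (l x) [])"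
    by (rule ptime_fold[where D = 1]) (auto intro!: ptime_intros fc l)
  then have "ptime (\<lambda>x. rev (fold (\<lambda>a acc. if P x a then a # acc else acc) (l x) []))" by (rule ptime_rev)
  then show ?thesis by (simp add: fold_rev_filter)
qed

lemma fold_append_concat: "fold (\<lambda>a acc. acc @ a) l acc = acc @ concat l"
  by (induct l arbitrary: acc) auto

lemma ptime_concat: "ptime l \<Longrightarrow> ptime (\<lambda>x. concat (l x))"
proof -
  assume "ptime l"
  then have "ptime (\<lambda>x. fold (\<lambda>a acc. acc @ a) (l x) [])"
    by (intro ptime_fold[where D = 1]) (auto intro!: ptime_intros ptime_append)
  then show ?thesis by (simp add: fold_append_concat)
qed

lemma fold_or_list_ex: "fold (\<lambda>a acc. P a \<or> acc) l acc \<longleftrightarrow> acc \<or> list_ex P l"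
  by (induct l arbitrary: acc) auto

lemma size_enc_bool: "size (enc (b :: bool)) \<le> 1"
  by (cases b) auto

lemma ptime_list_ex:
  assumes f: "ptime (\<lambda>p. P (fst p) (snd p))" and l: "ptime l"
  shows "ptime (\<lambda>x. list_ex (P x) (l x))"
proof -
  have fc: "ptime (\<lambda>p. P (fst p) (fst (snd p)))"
    using ptime_comp[OF f, of "\<lambda>p. (fst p, fst (snd p))"] by (simp add: ptime_intros)
  have "ptime (\<lambda>x. fold (\<lambda>a acc. P x a \<or> acc) (l x) False)"
  proof (rule ptime_fold[where D = 1])
    show "size (enc (P x a \<or> acc)) \<le> size (enc acc) + (size (enc x) + size (enc a) + 2) ^ 1" for x a acc
      using size_enc_bool[of "P x a \<or> acc"] by simp
  qed (auto intro!: ptime_intros fc l)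
  then show ?thesis by (simp add: fold_or_list_ex)
qed

lemma ptime_zip:
  assumes "ptime f" "ptime g" shows "ptime (\<lambda>x. zip (f x) (g x))"
proof -
  let ?step = "\<lambda>a acc. if fst acc = [] then acc else (tl (fst acc), (a, hd (fst acc)) # snd acc)"
  have fold: "snd (fold ?step xs (ys, out)) = rev (zip xs ys) @ out"
    for xs :: "'b list" and ys :: "'c list" and out
  proof (induct xs arbitrary: ys out)
    case (Cons x xs)
    then show ?case by (cases ys) auto
  qed simp
  have "ptime (\<lambda>x. fold ?step (f x) (g x, []))"
  proof (rule ptime_fold[where D = 1])
    show "size (enc (?step a acc)) \<le> size (enc acc) + (size (enc x) + size (enc a) + 2) ^ 1"
      for x :: 'a and a :: 'b and acc :: "'c list \<times> ('b \<times> 'c) list"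
      by (cases acc; cases "fst acc") auto
  qed (intro ptime_intros assms)+
  then have "ptime (\<lambda>x. rev (snd (fold ?step (f x) (g x, []))))" by (intro ptime_rev ptime_snd)
  then show ?thesis by (simp add: fold)
qed

text \<open>The bits of a number form a list with the same encoding as the number itself, so that loops can run over them.\<close>

fun nat_bits :: "nat \<Rightarrow> bool list" where
  "nat_bits n = (if n = 0 then [] else odd n # nat_bits (n div 2))"

declare nat_bits.simps [simp del]

lemma enc_nat_bits: "enc (nat_bits n) = enc n"
proof (induct n rule: nat_bits.induct)
  case (1 n)
  then show ?case
    by (subst nat_bits.simps, simp add: enc_nat_class enc_bool_class, subst (2) enc_nat.simps)
      (simp add: enc_nat.simps[of 0])
qed

lemma nat_less_two_power_bits: "n < 2 ^ length (nat_bits n)"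
proof (induct n rule: nat_bits.induct)
  case (1 n)
  then show ?case by (cases "n = 0") (auto simp: nat_bits.simps[of n])
qed

text \<open>Addition of a single carry bit, least significant bit first; the successor function starts with a carry.\<close>

fun add_carry :: "bool \<Rightarrow> bool list \<Rightarrow> bool list" where
  "add_carry c [] = (if c then [True] else [])"
| "add_carry c (b # bs) = (b \<noteq> c) # add_carry (b \<and> c) bs"

lemma nat_bits_add_carry: "nat_bits (n + of_bool c) = add_carry c (nat_bits n)"
proof (induct n arbitrary: c rule: nat_bits.induct)
  case (1 n)
  show ?case
  proof (cases "n = 0")
    case False
    have "(n + of_bool c) div 2 = n div 2 + of_bool (odd n \<and> c)" "odd (n + of_bool c) = (odd n \<noteq> c)"
      by (cases c; auto elim!: oddE evenE)+
    then show ?thesis using False 1[OF False, of "odd n \<and> c"]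
      by (simp add: nat_bits.simps[of n] nat_bits.simps[of "n + of_bool c"])
  qed (cases c; simp add: nat_bits.simps)
qed

lemma add_carry_fold:
  "(let r = fold (\<lambda>b acc. (b \<and> fst acc, (b \<noteq> fst acc) # snd acc)) bs (c, out)
    in rev (snd r) @ (if fst r then [True] else [])) = rev out @ add_carry c bs"
  by (induct bs arbitrary: c out) (auto simp: Let_def)

lemma ptime_nat_bits: "ptime f \<Longrightarrow> ptime (\<lambda>x. nat_bits (f x))"
  by (rule ptime_enc_cong) (simp_all add: enc_nat_bits)

lemma ptime_Suc:
  assumes "ptime f" shows "ptime (\<lambda>x. Suc (f x))"
proof -
  let ?step = "\<lambda>b acc. (b \<and> fst acc, (b \<noteq> fst acc) # snd acc)"
  let ?r = "\<lambda>x. fold ?step (nat_bits (f x)) (True, [])"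
  have "ptime ?r"
  proof (rule ptime_fold[where D = 2])
    show "size (enc (?step b acc)) \<le> size (enc acc) + (size (enc x) + size (enc b) + 2) ^ 2"
      for x :: 'a and b :: bool and acc
    proof -
      have "size (enc (?step b acc)) \<le> size (enc acc) + 2 ^ 2"
        using size_enc_bool[of "b \<and> fst acc"] size_enc_bool[of "b \<noteq> fst acc"]
        by (simp add: enc_prod_def)
      also have "\<dots> \<le> size (enc acc) + (size (enc x) + size (enc b) + 2) ^ 2"
        by (intro add_left_mono power_mono) auto
      finally show ?thesis .
    qed
    show "ptime (\<lambda>p. ?step (fst (snd p)) (snd (snd p)))"
    proof -
      have eq: "(b \<noteq> c) = (if b then \<not> c else c)" for b c by auto
      show ?thesis unfolding eq by (intro ptime_intros)
    qed
  qed (intro ptime_intros ptime_nat_bits assms)+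
  then have "ptime (\<lambda>x. rev (snd (?r x)) @ (if fst (?r x) then [True] else []))"
    by (intro ptime_append ptime_rev ptime_intros)
  moreover have "rev (snd (?r x)) @ (if fst (?r x) then [True] else []) = nat_bits (Suc (f x))" for x
    using add_carry_fold[of "nat_bits (f x)" True "[]"] nat_bits_add_carry[of "f x" True]
    by (simp add: Let_def)
  ultimately have "ptime (\<lambda>x. nat_bits (Suc (f x)))" by simp
  then show ?thesis by (rule ptime_enc_cong) (simp add: enc_nat_bits)
qed

lemma size_enc_Suc: "size (enc (Suc n)) \<le> size (enc n) + 2"
proof -
  have "size (enc (add_carry c bs)) \<le> size (enc bs) + 2" for c bs
  proof (induct bs arbitrary: c)
    case (Cons b bs)
    have "add_carry False bs = bs" for bs by (induct bs) auto
    then show ?case using Cons[of c] by (cases b; cases c) auto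
  qed auto
  from this[of True "nat_bits n"] show ?thesis
    using nat_bits_add_carry[of n True] by (metis Suc_eq_plus1 enc_nat_bits of_bool_eq(2))
qed

lemma ptime_length:
  assumes "ptime f" shows "ptime (\<lambda>x. length (f x))"
proof -
  have fold: "fold (\<lambda>_. Suc) xs n = n + length xs" for xs :: "'b list" and n
    by (induct xs arbitrary: n) auto
  have "ptime (\<lambda>x. fold (\<lambda>_. Suc) (f x) 0)"
  proof (rule ptime_fold[where D = 1])
    show "size (enc (Suc acc)) \<le> size (enc acc) + (size (enc x) + size (enc a) + 2) ^ 1"
      for x :: 'a and a :: 'b and acc
      using size_enc_Suc[of acc] by simp
  qed (intro ptime_intros ptime_Suc assms)+
  then show ?thesis by (simp add: fold)
qed

lemma enc_nat_eq: "enc n = (if n = 0 then Atom else Cell (enc (odd n)) (enc (n div 2)))" for n :: nat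
  unfolding enc_nat_class enc_bool_class by (subst enc_nat.simps) simp

lemma ptime_odd: "ptime f \<Longrightarrow> ptime (\<lambda>x. odd (f x :: nat))"
  by (rule ptime_tree_hd) (auto simp: enc_nat_eq[of "f _"])

lemma ptime_half: "ptime f \<Longrightarrow> ptime (\<lambda>x. f x div (2 :: nat))"
proof (rule ptime_tree_tl)
  show "enc (f x div 2) = tree_tl (enc (f x))" for x
    by (subst (2) enc_nat_eq) (simp add: enc_nat_eq[of 0])
qed

lemma size_enc_half: "size (enc (n div 2 :: nat)) \<le> size (enc n)"
  by (subst (2) enc_nat_eq) (simp add: enc_nat_eq[of 0])

text \<open>Both numbers are consumed starting with the least significant bit. A later bit in which they
  differ overrules the verdict so far. The bits of both numbers together serve as fuel.\<close>

lemma ptime_nat_less: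
  fixes f g :: "'a::encodable \<Rightarrow> nat"
  assumes "ptime f" "ptime g" shows "ptime (\<lambda>x. f x < g x)"
proof -
  let ?step = "\<lambda>(_ :: bool) acc. (fst acc div 2, fst (snd acc) div 2,
    if odd (fst acc) then (if odd (fst (snd acc)) then snd (snd acc) else False)
      else (if odd (fst (snd acc)) then True else snd (snd acc)))"
  have fold: "snd (snd (fold ?step bs (m, n, b))) \<longleftrightarrow> (if m = n then b else m < n)"
    if "m < 2 ^ length bs" "n < 2 ^ length bs" for bs and m n :: nat and b
    using that
  proof (induct bs arbitrary: m n b)
    case (Cons a bs)
    have "m div 2 < 2 ^ length bs" "n div 2 < 2 ^ length bs" using Cons(2,3) by auto
    note IH = Cons(1)[OF this]
    show ?case
      by (simp add: IH) (auto elim!: oddE evenE)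
  qed auto
  let ?fuel = "\<lambda>x. nat_bits (f x) @ nat_bits (g x)"
  have "ptime (\<lambda>x. fold ?step (?fuel x) (f x, g x, False))"
  proof (rule ptime_fold[where D = 1])
    show "size (enc (?step b acc)) \<le> size (enc acc) + (size (enc x) + size (enc b) + 2) ^ 1"
      for x :: 'a and b :: bool and acc :: "nat \<times> nat \<times> bool"
      using size_enc_half[of "fst acc"] size_enc_half[of "fst (snd acc)"]
        size_enc_bool[of "snd (snd acc)"]
      by (auto simp: enc_prod_def)
  qed (intro ptime_intros ptime_half ptime_odd ptime_append ptime_nat_bits assms)+
  then have "ptime (\<lambda>x. snd (snd (fold ?step (?fuel x) (f x, g x, False))))" by (intro ptime_snd)
  moreover have "snd (snd (fold ?step (?fuel x) (f x, g x, False))) \<longleftrightarrow> f x < g x" for x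
  proof (subst fold)
    show "f x < 2 ^ length (?fuel x)"
      using nat_less_two_power_bits[of "f x"] by (simp add: power_add) (metis less_le_trans mult.right_neutral mult_le_mono2 one_le_numeral one_le_power)
    show "g x < 2 ^ length (?fuel x)"
      using nat_less_two_power_bits[of "g x"] by (simp add: power_add) (metis less_le_trans mult_1 mult_le_mono1 one_le_numeral one_le_power)
  qed auto
  ultimately show ?thesis by simp
qed

lemma enc_int_eq: "enc z = Cell (enc (z < 0)) (enc (nat \<bar>z\<bar>))" for z :: int
  by (simp add: enc_int_class enc_int_def enc_bool_class enc_nat_class)

lemma ptime_int_less:
  fixes f g :: "'a::encodable \<Rightarrow> int"
  assumes "ptime f" "ptime g" shows "ptime (\<lambda>x. f x < g x)"
proof -
  have neg: "ptime (\<lambda>x. h x < 0)" if "ptime h" for h :: "'a \<Rightarrow> int"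
    by (rule ptime_tree_hd[OF that]) (simp add: enc_int_eq)
  have abs: "ptime (\<lambda>x. nat \<bar>h x\<bar>)" if "ptime h" for h :: "'a \<Rightarrow> int"
    by (rule ptime_tree_tl[OF that]) (simp add: enc_int_eq)
  have "ptime (\<lambda>x. if f x < 0 then (if g x < 0 then nat \<bar>g x\<bar> < nat \<bar>f x\<bar> else True)
    else (if g x < 0 then False else nat \<bar>f x\<bar> < nat \<bar>g x\<bar>))"
    by (intro ptime_intros neg abs ptime_nat_less assms)
  moreover have "(if f x < 0 then (if g x < 0 then nat \<bar>g x\<bar> < nat \<bar>f x\<bar> else True)
    else (if g x < 0 then False else nat \<bar>f x\<bar> < nat \<bar>g x\<bar>)) = (f x < g x)" for x
    by auto
  ultimately show ?thesis by simp
qed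

lemma ptime_int_eq:
  fixes f g :: "'a::encodable \<Rightarrow> int"
  assumes "ptime f" "ptime g" shows "ptime (\<lambda>x. f x = g x)"
proof -
  have eq: "f x = g x \<longleftrightarrow> \<not> f x < g x \<and> \<not> g x < f x" for x by auto
  show ?thesis unfolding eq by (intro ptime_intros ptime_int_less assms)
qed

text \<open>Insertion by two filters removes duplicates on the fly.\<close>

definition insert_strictly_sorted :: "'a::linorder \<Rightarrow> 'a list \<Rightarrow> 'a list" where
  "insert_strictly_sorted a l = filter (\<lambda>y. y < a) l @ a # filter (\<lambda>y. a < y) l"

lemma fold_insert_strictly_sorted:
  "fold insert_strictly_sorted l [] = sorted_list_of_set (set l)"
proof -
  have "sorted_wrt (<) acc \<Longrightarrow> sorted_wrt (<) (fold insert_strictly_sorted l acc) \<and>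
    set (fold insert_strictly_sorted l acc) = set acc \<union> set l" for acc :: "'a list"
  proof (induct l arbitrary: acc)
    case (Cons a l)
    have "sorted_wrt (<) (insert_strictly_sorted a acc)" "set (insert_strictly_sorted a acc) = insert a (set acc)"
      using Cons(2) by (auto simp: insert_strictly_sorted_def sorted_wrt_append intro: sorted_wrt_filter)
    then show ?case using Cons(1) by auto
  qed auto
  from this[of "[]"] show ?thesis
    by (metis List.finite_set Un_empty_left empty_set sorted_list_of_set.idem_if_sorted_distinct
        sorted_wrt.simps(1) strict_sorted_iff)
qed

lemma ptime_sorted_list_of_set:
  fixes f :: "'a::encodable \<Rightarrow> int list"
  assumes "ptime f" shows "ptime (\<lambda>x. sorted_list_of_set (set (f x)))"
proof -
  have "ptime (\<lambda>x. fold insert_strictly_sorted (f x) [])"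
  proof (rule ptime_fold[where D = 1])
    show "size (enc (insert_strictly_sorted a acc)) \<le> size (enc acc) + (size (enc x) + size (enc a) + 2) ^ 1"
      for x :: 'a and a :: int and acc
    proof -
      have "size (enc (filter (\<lambda>y. y < a) acc)) + size (enc (filter (\<lambda>y. a < y) acc)) \<le> size (enc acc)"
        by (induct acc) auto
      then show ?thesis by (simp add: insert_strictly_sorted_def)
    qed
    show "ptime (\<lambda>p. insert_strictly_sorted (fst (snd p)) (snd (snd p)) :: int list)"
      unfolding insert_strictly_sorted_def
      by (intro ptime_intros ptime_append ptime_filter ptime_int_less)
  qed (intro ptime_intros assms)+
  then show ?thesis by (simp add: fold_insert_strictly_sorted)
qed

text \<open>Every second element is kept, starting with the first; hence the rounding up.\<close>

lemma ptime_upper_half: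
  assumes "ptime f" shows "ptime (\<lambda>x. replicate ((length (f x) + 1) div 2) ())"
proof -
  let ?step = "\<lambda>_ acc. (\<not> fst acc, if fst acc then snd acc else () # snd acc)"
  have fold: "snd (fold ?step xs (b, replicate n ())) = replicate (n + (length xs + of_bool (\<not> b)) div 2) ()"
    for xs :: "'b list" and b n
  proof (induct xs arbitrary: b n)
    case (Cons x xs)
    show ?case using Cons[of "\<not> b" "if b then n else Suc n"] by (cases b) simp_all
  qed simp
  have "ptime (\<lambda>x. fold ?step (f x) (False, []))"
  proof (rule ptime_fold[where D = 1])
    show "size (enc (?step a acc)) \<le> size (enc acc) + (size (enc x) + size (enc a) + 2) ^ 1"
      for x :: 'a and a :: 'b and acc
      by (cases "fst acc") (auto simp: enc_prod_def)
  qed (intro ptime_intros assms)+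
  then have "ptime (\<lambda>x. snd (fold ?step (f x) (False, [])))" by (rule ptime_snd)
  then show ?thesis using fold[of _ False 0] by simp
qed

section \<open>Blocks of pixels\<close>

definition adj :: "nat \<times> nat \<Rightarrow> nat \<times> nat \<Rightarrow> bool" where
  "adj p q \<longleftrightarrow> (fst p = fst q \<and> (snd q = Suc (snd p) \<or> snd p = Suc (snd q)))
     \<or> (snd p = snd q \<and> (fst q = Suc (fst p) \<or> fst p = Suc (fst q)))"

lemma adj_sym: "adj p q \<longleftrightarrow> adj q p"
  unfolding adj_def by auto

definition adj_pairs :: "(nat \<times> nat) set \<Rightarrow> (nat \<times> nat) set \<Rightarrow> ((nat \<times> nat) \<times> (nat \<times> nat)) set" where
  "adj_pairs S T = {z \<in> S \<times> T. adj (fst z) (snd z)}"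

text \<open>The pairs are ordered: every neighbouring pair inside \<open>S \<inter> T\<close> counts twice.\<close>

definition variation :: "(nat \<times> nat \<Rightarrow> int) \<Rightarrow> (nat \<times> nat) set \<Rightarrow> (nat \<times> nat) set \<Rightarrow> int" where
  "variation w S T = (\<Sum>z \<in> adj_pairs S T. \<bar>w (fst z) - w (snd z)\<bar>)"

definition block :: "nat \<Rightarrow> (nat \<times> nat) set" where
  "block L = {1..L} \<times> {1..L}"

text \<open>The pixels of a block to which bridges can be attached, one on each side, away from the corners.\<close>

definition docks :: "nat \<Rightarrow> (nat \<times> nat) set" where
  "docks L = {(1, 7), (L, 7), (7, 1), (7, L)}"

lemma card_docks: "card (docks L) \<le> 4"
proof -
  have "docks L = set [(1, 7), (L, 7), (7, 1), (7, L)]" by (simp add: docks_def)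
  also have "card \<dots> \<le> 4" by (rule order_trans[OF card_length]) simp
  finally show ?thesis .
qed

lemma finite_adj_pairs [simp]: "finite S \<Longrightarrow> finite T \<Longrightarrow> finite (adj_pairs S T)"
  unfolding adj_pairs_def by simp

lemma nonconstant_consecutive:
  assumes "i \<in> {1..L}" "j \<in> {1..L}" "f i \<noteq> (f j :: 'a)"
  shows "\<exists>k \<in> {1..<L}. f k \<noteq> f (Suc k)"
proof (rule ccontr)
  assume "\<not> ?thesis"
  then have step: "f (Suc k) = f k" if "k \<in> {1..<L}" for k using that by metis
  have first: "k \<in> {1..L} \<Longrightarrow> f k = f 1" for k
  proof (induct k)
    case (Suc k)
    then show ?case using step[of k] by (cases "k = 0") auto
  qed simp
  show False using assms(3) first[OF assms(1)] first[OF assms(2)] by simp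
qed

text \<open>Every row and every column that is not monochromatic contains two neighbouring pixels of different colour.\<close>

lemma variation_block_ge:
  fixes w :: "nat \<times> nat \<Rightarrow> int" and L :: nat
  defines "R \<equiv> {i \<in> {1..L}. \<exists>j \<in> {1..L}. \<exists>j' \<in> {1..L}. w (i, j) \<noteq> w (i, j')}"
    and "C \<equiv> {j \<in> {1..L}. \<exists>i \<in> {1..L}. \<exists>i' \<in> {1..L}. w (i, j) \<noteq> w (i', j)}"
  shows "variation w (block L) (block L) \<ge> int (2 * (card R + card C))"
proof -
  have "\<forall>i \<in> R. \<exists>j. j \<in> {1..<L} \<and> w (i, j) \<noteq> w (i, Suc j)"
  proof
    fix i assume "i \<in> R"
    then obtain j j' where "j \<in> {1..L}" "j' \<in> {1..L}" "w (i, j) \<noteq> w (i, j')" unfolding R_def by blast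
    from nonconstant_consecutive[OF this(1,2), of "\<lambda>j. w (i, j)"] this(3)
    show "\<exists>j. j \<in> {1..<L} \<and> w (i, j) \<noteq> w (i, Suc j)" by blast
  qed
  from bchoice[OF this] obtain f where "\<forall>i \<in> R. f i \<in> {1..<L} \<and> w (i, f i) \<noteq> w (i, Suc (f i))" ..
  then have f: "f i \<ge> 1" "f i < L" "w (i, f i) \<noteq> w (i, Suc (f i))" if "i \<in> R" for i using that by auto
  have "\<forall>j \<in> C. \<exists>i. i \<in> {1..<L} \<and> w (i, j) \<noteq> w (Suc i, j)"
  proof
    fix j assume "j \<in> C"
    then obtain i i' where "i \<in> {1..L}" "i' \<in> {1..L}" "w (i, j) \<noteq> w (i', j)" unfolding C_def by blast
    from nonconstant_consecutive[OF this(1,2), of "\<lambda>i. w (i, j)"] this(3)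
    show "\<exists>i. i \<in> {1..<L} \<and> w (i, j) \<noteq> w (Suc i, j)" by blast
  qed
  from bchoice[OF this] obtain g where "\<forall>j \<in> C. g j \<in> {1..<L} \<and> w (g j, j) \<noteq> w (Suc (g j), j)" ..
  then have g: "g j \<ge> 1" "g j < L" "w (g j, j) \<noteq> w (Suc (g j), j)" if "j \<in> C" for j using that by auto
  define Z where "Z = adj_pairs (block L) (block L)"
  define Z1 where "Z1 = (\<lambda>i. ((i, f i), (i, Suc (f i)))) ` R"
  define Z2 where "Z2 = (\<lambda>i. ((i, Suc (f i)), (i, f i))) ` R"
  define Z3 where "Z3 = (\<lambda>j. ((g j, j), (Suc (g j), j))) ` C"
  define Z4 where "Z4 = (\<lambda>j. ((Suc (g j), j), (g j, j))) ` C"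
  have fin: "finite R" "finite C" unfolding R_def C_def by auto
  then have finZ: "finite Z1" "finite Z2" "finite Z3" "finite Z4" unfolding Z1_def Z2_def Z3_def Z4_def by auto
  have cards: "card Z1 = card R" "card Z2 = card R" "card Z3 = card C" "card Z4 = card C"
    unfolding Z1_def Z2_def Z3_def Z4_def by (intro card_image inj_onI; simp)+
  have "card (Z1 \<union> Z2 \<union> Z3 \<union> Z4) = card Z1 + card Z2 + card Z3 + card Z4"
  proof -
    have "Z1 \<inter> Z2 = {}" "(Z1 \<union> Z2) \<inter> Z3 = {}" "(Z1 \<union> Z2 \<union> Z3) \<inter> Z4 = {}"
      unfolding Z1_def Z2_def Z3_def Z4_def by auto
    then show ?thesis using finZ by (simp add: card_Un_disjoint)
  qed
  then have card: "card (Z1 \<union> Z2 \<union> Z3 \<union> Z4) = 2 * (card R + card C)" using cards by simp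
  have in_L: "i \<in> R \<Longrightarrow> 1 \<le> i \<and> i \<le> L" "j \<in> C \<Longrightarrow> 1 \<le> j \<and> j \<le> L" for i j
    unfolding R_def C_def by auto
  have sub: "Z1 \<union> Z2 \<union> Z3 \<union> Z4 \<subseteq> Z"
    unfolding Z_def Z1_def Z2_def Z3_def Z4_def block_def adj_def adj_pairs_def
    using f(1,2) g(1,2) in_L by (auto simp: Suc_le_eq less_imp_le)
  have "int (2 * (card R + card C)) = (\<Sum>z \<in> Z1 \<union> Z2 \<union> Z3 \<union> Z4. 1)" using card by simp
  also have "\<dots> \<le> (\<Sum>z \<in> Z1 \<union> Z2 \<union> Z3 \<union> Z4. \<bar>w (fst z) - w (snd z)\<bar>)"
  proof (rule sum_mono)
    fix z assume "z \<in> Z1 \<union> Z2 \<union> Z3 \<union> Z4"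
    then have "w (fst z) \<noteq> w (snd z)" 
      unfolding Z1_def Z2_def Z3_def Z4_def using f(3) g(3) by (auto simp: eq_commute[of "w (_, Suc _)"] eq_commute[of "w (Suc _, _)"])
    then show "1 \<le> \<bar>w (fst z) - w (snd z)\<bar>" by linarith
  qed
  also have "\<dots> \<le> (\<Sum>z \<in> Z. \<bar>w (fst z) - w (snd z)\<bar>)"
    by (rule sum_mono2[OF _ sub]) (auto simp: Z_def block_def)
  finally show ?thesis unfolding variation_def Z_def .
qed

text \<open>Either some row and some column are monochromatic; then they cross, share a colour \<open>val\<close>, and all
  pixels of the other colour lie where a mixed row meets a mixed column. Or all rows or all columns
  are mixed, and then the variation is at least \<open>2 L\<close> and any \<open>val\<close> will do.

  For a block that is not monochromatic, the variation of its picture exceeds what is at stake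
  outside: \<open>a\<close> bridges that may have adapted to the wrong colour, and \<open>rd\<close> rewarded pixels of the
  wrong colour. By the second inequality, the excess over \<open>a\<close> is at least \<open>12\<close> times the share of
  the block that has the wrong colour (\<open>24\<close> times if the variation counts ordered pairs). A gain of \<open>5\<close> and up to \<open>4\<close> edges per surplus black block
  make \<open>9\<close> the critical factor.\<close>

lemma block_dichotomy:
  fixes w :: "nat \<times> nat \<Rightarrow> int"
  assumes w: "\<And>p. p \<in> block L \<Longrightarrow> w p \<in> {0, 1}" and L: "L \<ge> 40"
  shows "\<exists>val \<in> {0, 1}. let dis = card {p \<in> block L. w p \<noteq> val}; a = card {p \<in> docks L. w p \<noteq> val};
      rd = card {k \<in> {2..6}. w (k, k) \<noteq> val}; X = variation w (block L) (block L)
    in dis = 0 \<or> (X \<ge> 2 * int (a + rd + 1) \<and> (X - 2 * int a) * int (L * L) \<ge> 24 * int dis)"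
proof -
  define R where "R = {i \<in> {1..L}. \<exists>j \<in> {1..L}. \<exists>j' \<in> {1..L}. w (i, j) \<noteq> w (i, j')}"
  define C where "C = {j \<in> {1..L}. \<exists>i \<in> {1..L}. \<exists>i' \<in> {1..L}. w (i, j) \<noteq> w (i', j)}"
  define X where "X = variation w (block L) (block L)"
  have X: "X \<ge> 2 * (int (card R) + int (card C))"
    using variation_block_ge[where w = w and L = L] unfolding X_def R_def C_def by simp
  have RC: "R \<subseteq> {1..L}" "C \<subseteq> {1..L}" unfolding R_def C_def by blast+
  then have fin: "finite R" "finite C" by (auto intro: finite_subset)
  define dis where "dis = (\<lambda>val. card {p \<in> block L. w p \<noteq> val})"
  define a where "a = (\<lambda>val. card {p \<in> docks L. w p \<noteq> val})"
  define rd where "rd = (\<lambda>val. card {k \<in> {2..6 :: nat}. w (k, k) \<noteq> val})"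
  have a4: "a val \<le> 4" for val
  proof -
    have "a val \<le> card (docks L)" unfolding a_def by (rule card_mono) (auto simp: docks_def)
    also have "\<dots> \<le> 4" by (rule card_docks)
    finally show ?thesis .
  qed
  have rd5: "rd val \<le> 5" for val
    unfolding rd_def by (rule order_trans[OF card_mono[of "{2..6 :: nat}"]]) auto
  have dis_le: "dis val \<le> L * L" for val
    using card_mono[of "block L" "{p \<in> block L. w p \<noteq> val}"] unfolding dis_def by (auto simp: block_def)
  \<comment> \<open>the two claims without factors \<open>2\<close>, in terms of the numbers of mixed rows and columns\<close>
  have main: "\<exists>val \<in> {0, 1}. dis val = 0 \<or> (a val + rd val + 1 \<le> card R + card C \<and>
      12 * dis val + a val * (L * L) \<le> (card R + card C) * (L * L))"
  proof (cases "card R = L \<or> card C = L")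
    case True
    then have "card R + card C \<ge> 40" using L by auto
    moreover have "12 * dis 0 + a 0 * (L * L) \<le> 16 * (L * L)"
      using dis_le[of 0] a4[of 0] mult_right_mono[OF a4[of 0], of "L * L"] by linarith
    moreover have "16 * (L * L) \<le> (card R + card C) * (L * L)"
      using calculation(1) by (intro mult_right_mono) auto
    ultimately have "12 * dis 0 + a 0 * (L * L) \<le> (card R + card C) * (L * L)" by (rule_tac order_trans)
    moreover have "a 0 + rd 0 + 1 \<le> card R + card C" using a4[of 0] rd5[of 0] \<open>card R + card C \<ge> 40\<close> by linarith
    ultimately show ?thesis by blast
  next
    case False
    then have "R \<noteq> {1..L}" "C \<noteq> {1..L}" by auto
    then obtain i0 j0 where ij0: "i0 \<in> {1..L}" "i0 \<notin> R" "j0 \<in> {1..L}" "j0 \<notin> C" using RC by blast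
    define val where "val = w (i0, j0)"
    have val: "val \<in> {0, 1}" using w[of "(i0, j0)"] ij0 by (auto simp: val_def block_def)
    have in_RC: "i \<in> R \<and> j \<in> C" if "(i, j) \<in> block L" "w (i, j) \<noteq> val" for i j
    proof -
      have ij: "i \<in> {1..L}" "j \<in> {1..L}" using that(1) by (auto simp: block_def)
      have 1: "w (i, j0) = val" using ij0 ij unfolding C_def val_def by blast
      have 2: "w (i0, j) = val" using ij0 ij unfolding R_def val_def by blast
      show ?thesis using 1 2 that(2) ij ij0 unfolding R_def C_def by (metis (mono_tags, lifting) mem_Collect_eq)
    qed
    have dis_rs: "dis val \<le> card R * card C"
    proof -
      have "{p \<in> block L. w p \<noteq> val} \<subseteq> R \<times> C" using in_RC by auto
      from card_mono[OF _ this] show ?thesis using fin by (simp add: dis_def card_cartesian_product)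
    qed
    define t b l r where "t = (w (1, 7) \<noteq> val)" and "b = (w (L, 7) \<noteq> val)"
      and "l = (w (7, 1) \<noteq> val)" and "r = (w (7, L) \<noteq> val)"
    define Q where "Q = {k \<in> {2..6 :: nat}. w (k, k) \<noteq> val}"
    have blk: "(1, 7) \<in> block L" "(L, 7) \<in> block L" "(7, 1) \<in> block L" "(7, L) \<in> block L"
      "k \<in> {2..6} \<Longrightarrow> (k, k) \<in> block L" for k
      using L by (auto simp: block_def)
    have aval: "a val = of_bool t + of_bool b + of_bool l + of_bool r"
    proof -
      have "{p \<in> docks L. w p \<noteq> val} = (if t then {(1, 7)} else {}) \<union> (if b then {(L, 7)} else {})
         \<union> (if l then {(7, 1)} else {}) \<union> (if r then {(7, L)} else {})"
        by (auto simp: docks_def t_def b_def l_def r_def)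
      then show ?thesis unfolding a_def using L by (simp add: card_insert_if)
    qed
    \<comment> \<open>each rewarded pixel and each dock of the wrong colour makes a row and a column mixed; only docks on opposite sides share one of them\<close>
    have QR: "Q \<union> (if t then {1} else {}) \<union> (if b then {L} else {}) \<union> (if l \<or> r then {7} else {}) \<subseteq> R"
      using in_RC blk by (auto simp: Q_def t_def b_def l_def r_def)
    have QC: "Q \<union> (if l then {1} else {}) \<union> (if r then {L} else {}) \<union> (if t \<or> b then {7} else {}) \<subseteq> C"
      using in_RC blk by (auto simp: Q_def t_def b_def l_def r_def)
    have Q: "finite Q" "1 \<notin> Q" "L \<notin> Q" "7 \<notin> Q" "Suc 0 \<notin> Q" using L by (auto simp: Q_def)
    have r1: "card Q + of_bool t + of_bool b + of_bool (l \<or> r) \<le> card R"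
      using card_mono[OF fin(1) QR] Q L by (cases t; cases b; cases "l \<or> r") (simp_all add: card_insert_if)
    have s1: "card Q + of_bool l + of_bool r + of_bool (t \<or> b) \<le> card C"
      using card_mono[OF fin(2) QC] Q L by (cases l; cases r; cases "t \<or> b") (simp_all add: card_insert_if)
    have rdQ: "rd val = card Q" by (simp add: rd_def Q_def)
    show ?thesis
    proof (cases "dis val = 0")
      case False
      then have "{p \<in> block L. w p \<noteq> val} \<noteq> {}" unfolding dis_def by (metis card.empty)
      then obtain i j where "(i, j) \<in> block L" "w (i, j) \<noteq> val" by auto
      then have "R \<noteq> {}" "C \<noteq> {}" using in_RC by auto
      then have "card R \<ge> 1" "card C \<ge> 1" using fin by (simp_all add: Suc_leI card_gt_0_iff)
      then have c1: "a val + rd val + 1 \<le> card R + card C"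
        using r1 s1 unfolding aval rdQ by (cases t; cases b; cases l; cases r) auto
      have c2: "12 * dis val + a val * (L * L) \<le> (card R + card C) * (L * L)"
      proof (cases "12 * (card R * card C) \<le> L * L")
        case True
        have "12 * dis val + a val * (L * L) \<le> (a val + 1) * (L * L)" using True dis_rs by simp
        also have "\<dots> \<le> (card R + card C) * (L * L)" using c1 by (intro mult_right_mono) auto
        finally show ?thesis .
      next
        case False
        \<comment> \<open>at least \<open>20 - 4\<close> pairs remain after paying for the docks, more than the required \<open>12\<close>\<close>
        have "card R + card C \<ge> 20"
        proof (rule ccontr)
          assume "\<not> ?thesis"
          then have "(card R + card C) * (card R + card C) \<le> 19 * 19" by (intro mult_mono) auto
          moreover have "4 * (card R * card C) \<le> (card R + card C) * (card R + card C)"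
          proof -
            have "0 \<le> (int (card R) - int (card C)) * (int (card R) - int (card C))" by simp
            then have "int (4 * (card R * card C)) \<le> int ((card R + card C) * (card R + card C))"
              by (simp add: algebra_simps)
            then show ?thesis by linarith
          qed
          moreover have "40 * 40 \<le> L * L" using L by (intro mult_mono) auto
          ultimately show False using False by linarith
        qed
        then have "16 * (L * L) \<le> (card R + card C) * (L * L)" by (intro mult_right_mono) auto
        moreover have "12 * dis val + a val * (L * L) \<le> 16 * (L * L)"
          using dis_le[of val] mult_right_mono[OF a4[of val], of "L * L"] by linarith
        ultimately show ?thesis by linarith
      qed
      show ?thesis using val c1 c2 by blast
    qed (use val in blast)
  qed
  then obtain val where val: "val \<in> {0, 1}"
    "dis val = 0 \<or> (a val + rd val + 1 \<le> card R + card C \<and>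
      12 * dis val + a val * (L * L) \<le> (card R + card C) * (L * L))" by blast
  have "dis val = 0 \<or> (X \<ge> 2 * int (a val + rd val + 1) \<and> (X - 2 * int (a val)) * int (L * L) \<ge> 24 * int (dis val))"
    using val(2)
  proof
    assume h: "a val + rd val + 1 \<le> card R + card C \<and>
      12 * dis val + a val * (L * L) \<le> (card R + card C) * (L * L)"
    have "int (12 * dis val + a val * (L * L)) \<le> int ((card R + card C) * (L * L))"
      using conjunct2[OF h] by (rule of_nat_mono)
    then have "24 * int (dis val) \<le> (2 * (int (card R) + int (card C)) - 2 * int (a val)) * int (L * L)"
      by (simp add: algebra_simps)
    also have "\<dots> \<le> (X - 2 * int (a val)) * int (L * L)" using X by (intro mult_right_mono) auto
    finally have "24 * int (dis val) \<le> (X - 2 * int (a val)) * int (L * L)" .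
    moreover have "2 * int (a val + rd val + 1) \<le> X"
    proof -
      have "int (a val + rd val + 1) \<le> int (card R + card C)"
        using conjunct1[OF h] by (rule of_nat_mono)
      then show ?thesis using X by simp
    qed
    ultimately show ?thesis by blast
  qed simp
  then show ?thesis using val(1) unfolding Let_def dis_def a_def rd_def X_def by blast
qed

section \<open>Total variation\<close>

definition tv :: "nat \<Rightarrow> nat \<Rightarrow> (nat \<times> nat \<Rightarrow> int) \<Rightarrow> int" where
  "tv N M w = (\<Sum>j<M. \<Sum>i<N - 1. \<bar>w (i + 1, j) - w (i, j)\<bar>) + (\<Sum>i<N. \<Sum>j<M - 1. \<bar>w (i, j + 1) - w (i, j)\<bar>)"

lemma variation_eq_tv: "variation w ({..<N} \<times> {..<M}) ({..<N} \<times> {..<M}) = 2 * tv N M w"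
proof -
  define Z where "Z = adj_pairs ({..<N} \<times> {..<M}) ({..<N} \<times> {..<M})"
  define down where "down = (\<lambda>(j, i). ((i :: nat, j :: nat), (Suc i, j)))"
  define right where "right = (\<lambda>(i, j). ((i :: nat, j :: nat), (i, Suc j)))"
  let ?V = "{..<M} \<times> {..<N - 1}" and ?H = "{..<N} \<times> {..<M - 1}"
  let ?g = "\<lambda>z. \<bar>w (fst z) - w (snd z)\<bar>"
  have Z: "Z = down ` ?V \<union> (prod.swap \<circ> down) ` ?V \<union> right ` ?H \<union> (prod.swap \<circ> right) ` ?H"
  proof (intro equalityI subsetI)
    fix z assume "z \<in> Z"
    then obtain i j i' j' where z: "z = ((i, j), (i', j'))" "i < N" "j < M" "i' < N" "j' < M" "adj (i, j) (i', j')"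
      unfolding Z_def adj_pairs_def by auto
    then consider "i = i'" "j' = Suc j" | "i = i'" "j = Suc j'" | "j = j'" "i' = Suc i" | "j = j'" "i = Suc i'"
      unfolding adj_def by auto
    then show "z \<in> down ` ?V \<union> (prod.swap \<circ> down) ` ?V \<union> right ` ?H \<union> (prod.swap \<circ> right) ` ?H"
    proof cases
      case 1
      then have "z = right (i, j)" "(i, j) \<in> ?H" using z by (auto simp: right_def)
      then show ?thesis by blast
    next
      case 2
      then have "z = (prod.swap \<circ> right) (i', j')" "(i', j') \<in> ?H" using z by (auto simp: right_def)
      then show ?thesis by blast
    next
      case 3
      then have "z = down (j, i)" "(j, i) \<in> ?V" using z by (auto simp: down_def)
      then show ?thesis by blast
    next
      case 4
      then have "z = (prod.swap \<circ> down) (j', i')" "(j', i') \<in> ?V" using z by (auto simp: down_def)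
      then show ?thesis by blast
    qed
  next
    fix z assume "z \<in> down ` ?V \<union> (prod.swap \<circ> down) ` ?V \<union> right ` ?H \<union> (prod.swap \<circ> right) ` ?H"
    then show "z \<in> Z" unfolding Z_def adj_pairs_def down_def right_def adj_def by auto
  qed
  have disj: "down ` ?V \<inter> (prod.swap \<circ> down) ` ?V = {}"
    "(down ` ?V \<union> (prod.swap \<circ> down) ` ?V) \<inter> right ` ?H = {}"
    "(down ` ?V \<union> (prod.swap \<circ> down) ` ?V \<union> right ` ?H) \<inter> (prod.swap \<circ> right) ` ?H = {}"
    unfolding down_def right_def by auto
  have inj: "inj_on down ?V" "inj_on (prod.swap \<circ> down) ?V" "inj_on right ?H" "inj_on (prod.swap \<circ> right) ?H"
    unfolding down_def right_def by (auto simp: inj_on_def)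
  have fin: "finite ?V" "finite ?H" by auto
  have "sum ?g Z = sum ?g (down ` ?V) + sum ?g ((prod.swap \<circ> down) ` ?V)
      + sum ?g (right ` ?H) + sum ?g ((prod.swap \<circ> right) ` ?H)"
    unfolding Z using disj fin by (simp add: sum.union_disjoint)
  also have "\<dots> = sum (?g \<circ> down) ?V + sum (?g \<circ> (prod.swap \<circ> down)) ?V
      + sum (?g \<circ> right) ?H + sum (?g \<circ> (prod.swap \<circ> right)) ?H"
    by (simp only: sum.reindex[OF inj(1)] sum.reindex[OF inj(2)] sum.reindex[OF inj(3)] sum.reindex[OF inj(4)])
  also have "\<dots> = 2 * tv N M w"
  proof -
    have "sum (?g \<circ> down) ?V = (\<Sum>j<M. \<Sum>i<N - 1. \<bar>w (i + 1, j) - w (i, j)\<bar>)"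
      "sum (?g \<circ> (prod.swap \<circ> down)) ?V = (\<Sum>j<M. \<Sum>i<N - 1. \<bar>w (i + 1, j) - w (i, j)\<bar>)"
      "sum (?g \<circ> right) ?H = (\<Sum>i<N. \<Sum>j<M - 1. \<bar>w (i, j + 1) - w (i, j)\<bar>)"
      "sum (?g \<circ> (prod.swap \<circ> right)) ?H = (\<Sum>i<N. \<Sum>j<M - 1. \<bar>w (i, j + 1) - w (i, j)\<bar>)"
      unfolding sum.cartesian_product down_def right_def
      by (auto intro!: sum.cong simp: abs_minus_commute)
    then show ?thesis unfolding tv_def by simp
  qed
  finally show ?thesis unfolding variation_def Z_def .
qed

lemma adj_pairs_swap: "adj_pairs T S = prod.swap ` adj_pairs S T"
  by (auto simp: adj_pairs_def adj_sym image_iff)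

lemma sum_adj_pairs_swap: "sum f (adj_pairs T S) = (\<Sum>z \<in> adj_pairs S T. f (snd z, fst z))"
  unfolding adj_pairs_swap[of T S] by (subst sum.reindex) (auto simp: prod.swap_def)

lemma variation_sym: "variation w S T = variation w T S"
  unfolding variation_def sum_adj_pairs_swap[of _ S T] by (simp add: abs_minus_commute)

lemma sum_adj_pairs:
  assumes "finite S" "finite T"
  shows "sum f (adj_pairs S T) = (\<Sum>p \<in> S. \<Sum>q \<in> {q \<in> T. adj p q}. f (p, q))"
proof -
  have "adj_pairs S T = Sigma S (\<lambda>p. {q \<in> T. adj p q})" by (auto simp: adj_pairs_def)
  then show ?thesis using assms by (simp add: sum.Sigma)
qed

lemma variation_Un_left:
  assumes "finite S" "finite S'" "finite T" "S \<inter> S' = {}"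
  shows "variation w (S \<union> S') T = variation w S T + variation w S' T"
  unfolding variation_def using assms by (simp add: sum_adj_pairs sum.union_disjoint)

lemma variation_Un_right:
  assumes "finite S" "finite S'" "finite T" "S \<inter> S' = {}"
  shows "variation w T (S \<union> S') = variation w T S + variation w T S'"
  using variation_Un_left[OF assms] by (simp add: variation_sym)

lemma neighbours_Suc:
  "{q. adj (Suc i, Suc j) q} = {(i, Suc j), (Suc (Suc i), Suc j), (Suc i, j), (Suc i, Suc (Suc j))}"
  unfolding adj_def by auto

lemma card_neighbours_le: "finite {q. adj p q}" "card {q. adj p q} \<le> 4"
proof -
  obtain i j where p: "p = (i, j)" by (cases p)
  have sub: "{q. adj p q} \<subseteq> set [(i - 1, j), (Suc i, j), (i, j - 1), (i, Suc j)]"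
    unfolding adj_def p by auto
  show "finite {q. adj p q}" using finite_subset[OF sub] by simp
  have "card {q. adj p q} \<le> card (set [(i - 1, j), (Suc i, j), (i, j - 1), (i, Suc j)])"
    using card_mono[OF _ sub] by simp
  also have "\<dots> \<le> 4" by (rule order_trans[OF card_length]) simp
  finally show "card {q. adj p q} \<le> 4" .
qed

text \<open>Flipping a pixel affects at most four neighbouring pairs, each of which is counted twice.\<close>

lemma variation_change_le:
  fixes w w' :: "nat \<times> nat \<Rightarrow> int"
  assumes "finite D"
  shows "variation w' D D \<le> variation w D D + 8 * (\<Sum>p \<in> D. \<bar>w p - w' p\<bar>)"
proof -
  define d where "d = (\<lambda>p. \<bar>w p - w' p\<bar>)"
  define Z where "Z = adj_pairs D D"
  have "variation w' D D \<le> (\<Sum>z \<in> Z. \<bar>w (fst z) - w (snd z)\<bar> + d (fst z) + d (snd z))"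
    unfolding variation_def Z_def d_def by (rule sum_mono) linarith
  also have "\<dots> = variation w D D + (\<Sum>z \<in> Z. d (fst z)) + (\<Sum>z \<in> Z. d (snd z))"
    unfolding variation_def Z_def by (simp add: sum.distrib)
  also have "(\<Sum>z \<in> Z. d (snd z)) = (\<Sum>z \<in> Z. d (fst z))"
    unfolding Z_def by (subst sum_adj_pairs_swap) simp
  also have "(\<Sum>z \<in> Z. d (fst z)) \<le> 4 * (\<Sum>p \<in> D. d p)"
  proof -
    have "(\<Sum>z \<in> Z. d (fst z)) = (\<Sum>p \<in> D. int (card {q \<in> D. adj p q}) * d p)"
      unfolding Z_def using assms by (simp add: sum_adj_pairs)
    also have "\<dots> \<le> (\<Sum>p \<in> D. 4 * d p)"
    proof (rule sum_mono, rule mult_right_mono)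
      fix p
      have "card {q \<in> D. adj p q} \<le> card {q. adj p q}"
        by (rule card_mono) (auto simp: card_neighbours_le)
      then show "int (card {q \<in> D. adj p q}) \<le> 4" using card_neighbours_le(2)[of p] by linarith
    qed (simp add: d_def)
    finally show ?thesis by (simp add: sum_distrib_left)
  qed
  finally show ?thesis by (simp add: d_def)
qed

section \<open>The pixel picture of a grid graph\<close>

locale grid_graph =
  fixes V :: "(int \<times> int) set" and E :: "((int \<times> int) \<times> (int \<times> int)) set"
  assumes finV: "finite V"
    and E_sub: "E \<subseteq> V \<times> V"
    and E_sym: "(u, v) \<in> E \<Longrightarrow> (v, u) \<in> E"
    and E_grid: "(u, v) \<in> E \<Longrightarrow> (fst u - fst v)\<^sup>2 + (snd u - snd v)\<^sup>2 = 1"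
begin

text \<open>A side length that exceeds the number of arcs by \<open>40\<close> makes the area of a block more than four
  times the number of stubs (needed for the balance) and satisfies \<open>block_dichotomy\<close>.\<close>

definition m :: nat where "m = (card V + 1) div 2"
definition L :: nat where "L = card E + 40"
text \<open>The cell of a node is the square of side \<open>L + 2\<close> whose position is given by the ranks of the
  coordinates of the node. The block occupies the offsets \<open>1\<close> to \<open>L\<close>; the offsets \<open>0\<close> and \<open>L + 1\<close> form a margin.\<close>

definition row :: "int \<times> int \<Rightarrow> nat" where "row v = card {x \<in> fst ` V. x < fst v}"
definition col :: "int \<times> int \<Rightarrow> nat" where "col v = card {y \<in> snd ` V. y < snd v}"
definition pos :: "nat \<Rightarrow> nat \<Rightarrow> nat" where "pos r a = r * (L + 2) + a"
definition pix :: "int \<times> int \<Rightarrow> nat \<times> nat \<Rightarrow> nat \<times> nat" where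
  "pix v p = (pos (row v) (fst p), pos (col v) (snd p))"

text \<open>An arc owns one pixel in the margin of the cell of its tail, its stub. The stubs of an arc and of
  the opposite arc are neighbours and form the bridge of the edge. Nodes that are adjacent in the
  plane but not in the graph have no stubs, and their blocks are separated by the margins.\<close>

definition stub_off :: "(int \<times> int) \<times> (int \<times> int) \<Rightarrow> nat \<times> nat" where
  "stub_off e = (if fst (snd e) < fst (fst e) then (0, 7)
     else if fst (fst e) < fst (snd e) then (L + 1, 7)
     else if snd (snd e) < snd (fst e) then (7, 0) else (7, L + 1))"

definition dock_off :: "(int \<times> int) \<times> (int \<times> int) \<Rightarrow> nat \<times> nat" where
  "dock_off e = (if fst (snd e) < fst (fst e) then (1, 7)
     else if fst (fst e) < fst (snd e) then (L, 7)
     else if snd (snd e) < snd (fst e) then (7, 1) else (7, L))"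

definition stub :: "(int \<times> int) \<times> (int \<times> int) \<Rightarrow> nat \<times> nat" where "stub e = pix (fst e) (stub_off e)"
definition dock :: "(int \<times> int) \<times> (int \<times> int) \<Rightarrow> nat \<times> nat" where "dock e = pix (fst e) (dock_off e)"
definition body :: "int \<times> int \<Rightarrow> (nat \<times> nat) set" where "body v = pix v ` block L"
text \<open>The pixels whose colour is not forced: all blocks and all stubs.\<close>

definition live :: "(nat \<times> nat) set" where "live = (\<Union>v \<in> V. body v) \<union> stub ` E"

text \<open>Below all cells lies one row, and to their right one column followed by \<open>5 m - 1\<close> further ones. The
  strip consists of the last \<open>5 m - 1\<close> pixels of the bottom row. It touches the corner of the picture,
  so its boundary inside the picture consists of \<open>5 m - 1\<close> pairs above it and one at its left end.\<close>

definition height :: nat where "height = card (fst ` V) * (L + 2) + 1"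
definition strip_len :: nat where "strip_len = 5 * m - 1"
definition width :: nat where "width = card (snd ` V) * (L + 2) + 1 + strip_len"
definition pixels :: "(nat \<times> nat) set" where "pixels = {..<height} \<times> {..<width}"
definition strip :: "(nat \<times> nat) set" where
  "strip = {height - 1} \<times> {width - strip_len..<width}"
definition budget :: nat where "budget = L * L * m + card E"

text \<open>The rewarded pixels lie on the diagonal, in five rows and columns that contain no dock.\<close>

definition reward :: "nat \<times> nat \<Rightarrow> int" where
  "reward p = (if \<exists>v \<in> V. \<exists>k \<in> {2..6}. p = pix v (k, k) then 1 else 0)"

text \<open>The first term cancels the discordant pairs that a black pixel forms with its white forced
  neighbours.\<close>

definition cost :: "nat \<times> nat \<Rightarrow> int" where
  "cost p = (if p \<in> live then - int (card {q. adj p q \<and> q \<notin> live}) - reward p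
     else if p \<in> strip then - 5 else 5)"

definition cut :: "(int \<times> int) set \<Rightarrow> nat" where
  "cut S = card {e \<in> E. fst e \<in> S \<and> snd e \<notin> S}"

lemma L_ge: "L \<ge> 40" unfolding L_def by simp

lemma finE: "finite E" using finV E_sub by (meson finite_SigmaI finite_subset)

lemma edge_cases:
  assumes "(u, v) \<in> E"
  obtains (up) "fst v = fst u - 1" "snd v = snd u" | (down) "fst v = fst u + 1" "snd v = snd u"
    | (left) "fst v = fst u" "snd v = snd u - 1" | (right) "fst v = fst u" "snd v = snd u + 1"
proof -
  define a b where "a = fst u - fst v" and "b = snd u - snd v"
  have eq: "a\<^sup>2 + b\<^sup>2 = 1" using E_grid[OF assms] by (simp add: a_def b_def)
  have "a\<^sup>2 \<le> 1" "b\<^sup>2 \<le> 1" using eq zero_le_power2[of a] zero_le_power2[of b] by linarith+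
  then have "a \<in> {-1, 0, 1}" "b \<in> {-1, 0, 1}"
    using abs_le_square_iff[of a 1] abs_le_square_iff[of b 1] by auto
  then have "(a = 1 \<and> b = 0) \<or> (a = -1 \<and> b = 0) \<or> (a = 0 \<and> b = 1) \<or> (a = 0 \<and> b = -1)" using eq by auto
  then show thesis using up down left right unfolding a_def b_def by (elim disjE) auto
qed

text \<open>Consecutive coordinates have consecutive ranks, so compressing the coordinates preserves adjacency.\<close>

lemma rank_Suc:
  fixes X :: "int set"
  assumes "finite X" "x \<in> X"
  shows "card {y \<in> X. y < x + 1} = Suc (card {y \<in> X. y < x})"
proof -
  have "{y \<in> X. y < x + 1} = insert x {y \<in> X. y < x}" using assms(2) by auto
  then show ?thesis using assms(1) by simp
qed

lemma rank_inj:
  fixes X :: "int set"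
  assumes "finite X" "x \<in> X" "x' \<in> X" "card {y \<in> X. y < x} = card {y \<in> X. y < x'}"
  shows "x = x'"
proof -
  have less: "card {y \<in> X. y < a} < card {y \<in> X. y < b}" if "a \<in> X" "a < b" for a b
    using assms(1) that by (intro psubset_card_mono) auto
  show ?thesis using less[OF assms(2), of x'] less[OF assms(3), of x] assms(4) by (cases x x' rule: linorder_cases) auto
qed

lemma rank_less:
  fixes X :: "int set"
  assumes "finite X" "x \<in> X" shows "card {y \<in> X. y < x} < card X"
  using assms by (intro psubset_card_mono) auto

lemma row_col_inj: "u \<in> V \<Longrightarrow> v \<in> V \<Longrightarrow> row u = row v \<Longrightarrow> col u = col v \<Longrightarrow> u = v"
  using rank_inj[of "fst ` V" "fst u" "fst v"] rank_inj[of "snd ` V" "snd u" "snd v"] finV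
  unfolding row_def col_def by (auto simp: prod_eq_iff)

lemma row_less: "v \<in> V \<Longrightarrow> row v < card (fst ` V)"
  and col_less: "v \<in> V \<Longrightarrow> col v < card (snd ` V)"
  unfolding row_def col_def using finV by (auto intro!: rank_less)

lemma row_below: "v \<in> V \<Longrightarrow> fst u = fst v + 1 \<Longrightarrow> row u = Suc (row v)"
  and col_right: "v \<in> V \<Longrightarrow> snd u = snd v + 1 \<Longrightarrow> col u = Suc (col v)"
  using rank_Suc[of "fst ` V" "fst v"] rank_Suc[of "snd ` V" "snd v"] finV
  unfolding row_def col_def by simp_all

lemma row_eq: "fst u = fst v \<Longrightarrow> row u = row v"
  and col_eq: "snd u = snd v \<Longrightarrow> col u = col v"
  unfolding row_def col_def by simp_all

lemma pos_eq_iff: "a < L + 2 \<Longrightarrow> b < L + 2 \<Longrightarrow> pos r a = pos s b \<longleftrightarrow> r = s \<and> a = b"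
proof -
  assume ab: "a < L + 2" "b < L + 2"
  have "(k * P + c) div P = k \<and> (k * P + c) mod P = c" if "c < P" for k P c :: nat using that by simp
  from this[OF ab(1)] this[OF ab(2)]
  have "pos r a div (L + 2) = r" "pos s b div (L + 2) = s" "pos r a mod (L + 2) = a" "pos s b mod (L + 2) = b"
    unfolding pos_def by blast+
  then show ?thesis by metis
qed

text \<open>Stepping to the next pixel either stays in the cell or leads to the first offset of the next cell.\<close>

lemma pos_Suc_eq_iff:
  assumes "a < L + 2" "b < L + 2"
  shows "Suc (pos r a) = pos s b \<longleftrightarrow> (a < L + 1 \<and> r = s \<and> b = Suc a) \<or> (a = L + 1 \<and> s = Suc r \<and> b = 0)"
proof (cases "a = L + 1")
  case True
  then have "Suc (pos r a) = pos (Suc r) 0" by (simp add: pos_def)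
  then show ?thesis using pos_eq_iff[of 0 b "Suc r" s] assms True by auto
next
  case False
  then have "Suc (pos r a) = pos r (Suc a)" by (simp add: pos_def)
  then show ?thesis using pos_eq_iff[of "Suc a" b r s] assms False by auto
qed

lemma pix_eq_iff:
  assumes "u \<in> V" "v \<in> V" "fst p < L + 2" "snd p < L + 2" "fst q < L + 2" "snd q < L + 2"
  shows "pix u p = pix v q \<longleftrightarrow> u = v \<and> p = q"
  using assms row_col_inj[of u v] by (cases p; cases q) (auto simp: pix_def pos_eq_iff)

lemma adj_pix:
  assumes "u \<in> V" "v \<in> V" "fst p < L + 2" "snd p < L + 2" "fst q < L + 2" "snd q < L + 2"
  shows "adj (pix u p) (pix v q) \<longleftrightarrow> (u = v \<and> adj p q)
    \<or> (col u = col v \<and> snd p = snd q \<and> ((fst p = L + 1 \<and> fst q = 0 \<and> row v = Suc (row u))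
         \<or> (fst p = 0 \<and> fst q = L + 1 \<and> row u = Suc (row v))))
    \<or> (row u = row v \<and> fst p = fst q \<and> ((snd p = L + 1 \<and> snd q = 0 \<and> col v = Suc (col u))
         \<or> (snd p = 0 \<and> snd q = L + 1 \<and> col u = Suc (col v))))"
proof -
  have uv: "u = v \<longleftrightarrow> row u = row v \<and> col u = col v" using row_col_inj[OF assms(1,2)] by blast
  obtain a b where p: "p = (a, b)" by (cases p)
  obtain a' b' where q: "q = (a', b')" by (cases q)
  have less: "a < L + 2" "b < L + 2" "a' < L + 2" "b' < L + 2" using assms p q by auto
  have *: "a < L + 1 \<or> a = L + 1" "b < L + 1 \<or> b = L + 1" "a' < L + 1 \<or> a' = L + 1" "b' < L + 1 \<or> b' = L + 1"
    using less by auto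
  have lt: "a' = Suc a \<Longrightarrow> a < L + 1" "b' = Suc b \<Longrightarrow> b < L + 1" "a = Suc a' \<Longrightarrow> a' < L + 1" "b = Suc b' \<Longrightarrow> b' < L + 1"
    using less by auto
  show ?thesis
    unfolding adj_def pix_def p q fst_conv snd_conv uv pos_eq_iff[OF less(1,3)] pos_eq_iff[OF less(2,4)]
      eq_commute[of "pos _ _" "Suc _"] pos_Suc_eq_iff[OF less(1,3)] pos_Suc_eq_iff[OF less(3,1)]
      pos_Suc_eq_iff[OF less(2,4)] pos_Suc_eq_iff[OF less(4,2)]
    using lt by (intro iffI; elim disjE conjE; simp)
qed

lemma block_less: "p \<in> block L \<Longrightarrow> fst p < L + 2 \<and> snd p < L + 2 \<and> 1 \<le> fst p \<and> fst p \<le> L \<and> 1 \<le> snd p \<and> snd p \<le> L"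
  unfolding block_def by auto

lemma off_simps:
  "fst (stub_off e) < L + 2" "snd (stub_off e) < L + 2" "fst (dock_off e) < L + 2" "snd (dock_off e) < L + 2"
  "dock_off e \<in> block L" "dock_off e \<in> docks L" "stub_off e \<notin> block L"
  using L_ge unfolding stub_off_def dock_off_def block_def docks_def by auto

lemma adj_block_stub: "p \<in> block L \<Longrightarrow> adj p (stub_off e) \<longleftrightarrow> p = dock_off e"
  using L_ge unfolding stub_off_def dock_off_def block_def adj_def by (auto simp: prod_eq_iff)

lemma stub_off_not_adj: "\<not> adj (stub_off e) (stub_off e')"
  using L_ge unfolding stub_off_def adj_def by auto

lemma edge_direction:
  assumes "(u, v) \<in> E"
  obtains
    (up) "v = (fst u - 1, snd u)" "stub_off (u, v) = (0, 7)" "dock_off (u, v) = (1, 7)" "row u = Suc (row v)" "col u = col v"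
  | (down) "v = (fst u + 1, snd u)" "stub_off (u, v) = (L + 1, 7)" "dock_off (u, v) = (L, 7)" "row v = Suc (row u)" "col u = col v"
  | (left) "v = (fst u, snd u - 1)" "stub_off (u, v) = (7, 0)" "dock_off (u, v) = (7, 1)" "row u = row v" "col u = Suc (col v)"
  | (right) "v = (fst u, snd u + 1)" "stub_off (u, v) = (7, L + 1)" "dock_off (u, v) = (7, L)" "row u = row v" "col v = Suc (col u)"
proof -
  have in_V: "u \<in> V" "v \<in> V" using assms E_sub by auto
  show thesis using assms
  proof (cases rule: edge_cases)
    case up
    then show ?thesis using row_below[OF in_V(2), of u] col_eq[of u v]
      by (intro that(1)) (auto simp: stub_off_def dock_off_def prod_eq_iff)
  next
    case down
    then show ?thesis using row_below[OF in_V(1), of v] col_eq[of u v]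
      by (intro that(2)) (auto simp: stub_off_def dock_off_def prod_eq_iff)
  next
    case left
    then show ?thesis using col_right[OF in_V(2), of u] row_eq[of u v]
      by (intro that(3)) (auto simp: stub_off_def dock_off_def prod_eq_iff)
  next
    case right
    then show ?thesis using col_right[OF in_V(1), of v] row_eq[of u v]
      by (intro that(4)) (auto simp: stub_off_def dock_off_def prod_eq_iff)
  qed
qed

lemma stub_off_eq:
  assumes "e \<in> E" "e' \<in> E" "fst e = fst e'" "stub_off e = stub_off e' \<or> dock_off e = dock_off e'"
  shows "e = e'"
proof -
  obtain u v v' where e: "e = (u, v)" "e' = (u, v')" using assms(3) by (metis prod.collapse)
  have 1: "(u, v) \<in> E" and 2: "(u, v') \<in> E" using assms e by auto
  have ne: "L \<noteq> 7" "L \<noteq> 1" "L + 1 \<noteq> 7" "L + 1 \<noteq> 0" using L_ge by auto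
  show ?thesis
    by (rule edge_direction[OF 1]; rule edge_direction[OF 2]; use assms(4) ne e in simp)
qed

lemma fst_in_V: "e \<in> E \<Longrightarrow> fst e \<in> V" and snd_in_V: "e \<in> E \<Longrightarrow> snd e \<in> V" and swap_in_E: "e \<in> E \<Longrightarrow> prod.swap e \<in> E"
  using E_sub E_sym by (auto simp: prod.swap_def)

lemma adj_body_body:
  assumes "u \<in> V" "v \<in> V" "p \<in> block L" "q \<in> block L"
  shows "adj (pix u p) (pix v q) \<longleftrightarrow> u = v \<and> adj p q"
  using assms adj_pix[of u v p q] block_less[of p] block_less[of q] by auto

lemma adj_body_stub:
  assumes "v \<in> V" "p \<in> block L" "e \<in> E"
  shows "adj (pix v p) (stub e) \<longleftrightarrow> v = fst e \<and> p = dock_off e"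
  using assms adj_pix[of v "fst e" p "stub_off e"] block_less[of p] fst_in_V[of e]
    adj_block_stub[of p e] off_simps[of e] unfolding stub_def by auto

text \<open>Two cells touch only along their margins, and stubs in touching margins belong to opposite arcs.\<close>

lemma adj_stub_stub:
  assumes "e \<in> E" "e' \<in> E"
  shows "adj (stub e) (stub e') \<longleftrightarrow> e' = prod.swap e"
proof -
  obtain u v where e: "e = (u, v)" by (cases e)
  obtain u' v' where e': "e' = (u', v')" by (cases e')
  have in_E: "(u, v) \<in> E" "(u', v') \<in> E" and in_V: "u \<in> V" "v \<in> V" "u' \<in> V" "v' \<in> V"
    using assms E_sub e e' by auto
  have adj: "adj (stub e) (stub e') \<longleftrightarrow> 
    (col u = col u' \<and> snd (stub_off e) = snd (stub_off e') \<and> ((fst (stub_off e) = L + 1 \<and> fst (stub_off e') = 0 \<and> row u' = Suc (row u))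
         \<or> (fst (stub_off e) = 0 \<and> fst (stub_off e') = L + 1 \<and> row u = Suc (row u'))))
    \<or> (row u = row u' \<and> fst (stub_off e) = fst (stub_off e') \<and> ((snd (stub_off e) = L + 1 \<and> snd (stub_off e') = 0 \<and> col u' = Suc (col u))
         \<or> (snd (stub_off e) = 0 \<and> snd (stub_off e') = L + 1 \<and> col u = Suc (col u'))))"
    using adj_pix[OF in_V(1,3) off_simps(1,2)[of e] off_simps(1,2)[of e']] stub_off_not_adj[of e e']
    by (simp add: stub_def e e')
  have ne: "L \<noteq> 7" "L + 1 \<noteq> 7" "L + 1 \<noteq> 0" using L_ge by auto
  show ?thesis
  proof
    assume "adj (stub e) (stub e')"
    note a = this[unfolded adj, unfolded e e']
    have "row u' = row v \<and> col u' = col v"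
      by (rule edge_direction[OF in_E(1)]; rule edge_direction[OF in_E(2)]; use a ne in simp)
    then have uv: "u' = v" using row_col_inj[OF in_V(3,2)] by blast
    have "v' = u"
      by (rule edge_direction[OF in_E(1)]; rule edge_direction[OF in_E(2)];
          use a ne uv in \<open>simp add: prod_eq_iff\<close>)
    then show "e' = prod.swap e" using uv e e' by simp
  next
    assume "e' = prod.swap e"
    then have eq: "u' = v" "v' = u" using e e' by auto
    show "adj (stub e) (stub e')"
      unfolding adj unfolding e e' eq
      by (rule edge_direction[OF in_E(1)]; rule edge_direction[OF in_E(2)];
          use ne eq in \<open>simp add: prod_eq_iff\<close>)
  qed
qed

lemma finite_block [simp]: "finite (block L)" unfolding block_def by simp

lemma finite_live: "finite live"
  unfolding live_def body_def using finV finE by auto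

lemma inj_pix: "v \<in> V \<Longrightarrow> inj_on (pix v) (block L)"
  using block_less by (auto simp: inj_on_def pix_eq_iff)

lemma body_disjoint: "u \<in> V \<Longrightarrow> v \<in> V \<Longrightarrow> u \<noteq> v \<Longrightarrow> body u \<inter> body v = {}"
  unfolding body_def using block_less by (auto simp: pix_eq_iff)

lemma stub_notin_body:
  assumes "e \<in> E" "v \<in> V" shows "stub e \<notin> body v"
proof
  assume "stub e \<in> body v"
  then obtain q where q: "q \<in> block L" "pix (fst e) (stub_off e) = pix v q"
    unfolding body_def stub_def by blast
  then have "stub_off e = q"
    using pix_eq_iff[OF fst_in_V[OF assms(1)] assms(2) off_simps(1,2)[of e]] block_less[OF q(1)] by blast
  then show False using q(1) off_simps(7) by blast
qed

lemma in_live_cases: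
  assumes "p \<in> live"
  obtains (body) v q where "v \<in> V" "q \<in> block L" "p = pix v q" | (stub) e where "e \<in> E" "p = stub e"
  using assms unfolding live_def body_def by blast

lemma pix_in_live: "v \<in> V \<Longrightarrow> q \<in> block L \<Longrightarrow> pix v q \<in> live"
  and stub_in_live: "e \<in> E \<Longrightarrow> stub e \<in> live"
  unfolding live_def body_def by blast+

lemma inj_stub: "inj_on stub E"
proof (rule inj_onI)
  fix e e' assume e: "e \<in> E" "e' \<in> E" "stub e = stub e'"
  then have "fst e = fst e' \<and> stub_off e = stub_off e'"
    unfolding stub_def using off_simps fst_in_V by (simp add: pix_eq_iff)
  then show "e = e'" using stub_off_eq[OF e(1,2)] by simp
qed

lemma sum_live:
  "sum f live = (\<Sum>v \<in> V. \<Sum>q \<in> block L. f (pix v q)) + (\<Sum>e \<in> E. f (stub e))"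
proof -
  have "sum f live = sum f (\<Union>v \<in> V. body v) + sum f (stub ` E)"
  proof (unfold live_def, rule sum.union_disjoint)
    show "(\<Union>v \<in> V. body v) \<inter> stub ` E = {}" using stub_notin_body by blast
  qed (use finV finE in \<open>auto simp: body_def\<close>)
  also have "sum f (\<Union>v \<in> V. body v) = (\<Sum>v \<in> V. sum f (body v))"
    using finV body_disjoint by (intro sum.UNION_disjoint) (auto simp: body_def)
  also have "\<dots> = (\<Sum>v \<in> V. \<Sum>q \<in> block L. f (pix v q))"
    unfolding body_def by (rule sum.cong[OF refl]) (rule sum.reindex[OF inj_pix, unfolded o_def])
  also have "sum f (stub ` E) = (\<Sum>e \<in> E. f (stub e))" by (simp add: sum.reindex[OF inj_stub])
  finally show ?thesis .
qed

lemma live_neighbours_pix: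
  assumes "v \<in> V" "q \<in> block L"
  shows "{x \<in> live. adj (pix v q) x}
    = pix v ` {q' \<in> block L. adj q q'} \<union> stub ` {e \<in> E. fst e = v \<and> dock_off e = q}"
proof (intro equalityI subsetI)
  fix x assume x: "x \<in> {x \<in> live. adj (pix v q) x}"
  then have "x \<in> live" by blast
  then show "x \<in> pix v ` {q' \<in> block L. adj q q'} \<union> stub ` {e \<in> E. fst e = v \<and> dock_off e = q}"
  proof (cases rule: in_live_cases)
    case (body u q')
    then show ?thesis using x adj_body_body[OF assms(1) body(1) assms(2) body(2)] by blast
  next
    case (stub e)
    then show ?thesis using x adj_body_stub[OF assms stub(1)] by blast
  qed
next
  fix x assume "x \<in> pix v ` {q' \<in> block L. adj q q'} \<union> stub ` {e \<in> E. fst e = v \<and> dock_off e = q}"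
  then show "x \<in> {x \<in> live. adj (pix v q) x}"
    using adj_body_body[OF assms(1,1,2)] adj_body_stub[OF assms] pix_in_live[OF assms(1)] stub_in_live by blast
qed

lemma dock_in_live: "e \<in> E \<Longrightarrow> dock e \<in> live"
  unfolding dock_def by (rule pix_in_live) (auto simp: fst_in_V off_simps)

lemma live_neighbours_stub:
  assumes "e \<in> E"
  shows "{x \<in> live. adj (stub e) x} = {dock e, stub (prod.swap e)}"
proof (intro equalityI subsetI)
  fix x assume x: "x \<in> {x \<in> live. adj (stub e) x}"
  then have "x \<in> live" by blast
  then show "x \<in> {dock e, stub (prod.swap e)}"
  proof (cases rule: in_live_cases)
    case (body v q)
    then show ?thesis using x adj_body_stub[OF body(1,2) assms] by (simp add: adj_sym dock_def)
  next
    case (stub e')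
    then show ?thesis using x adj_stub_stub[OF assms stub(1)] by simp
  qed
next
  have "adj (stub e) (dock e)"
    using adj_body_stub[OF fst_in_V[OF assms] off_simps(5) assms, of e] by (simp add: adj_sym dock_def)
  moreover have "adj (stub e) (stub (prod.swap e))" using adj_stub_stub[OF assms swap_in_E[OF assms]] by simp
  moreover fix x assume "x \<in> {dock e, stub (prod.swap e)}"
  ultimately show "x \<in> {x \<in> live. adj (stub e) x}"
    using dock_in_live[OF assms] stub_in_live[OF swap_in_E[OF assms]] by blast
qed

lemma dock_neq_stub:
  assumes "e \<in> E" "e' \<in> E" shows "dock e \<noteq> stub e'"
proof -
  have "dock e \<in> body (fst e)" unfolding dock_def body_def by (rule imageI) (rule off_simps)
  then show ?thesis using stub_notin_body[OF assms(2) fst_in_V[OF assms(1)]] by metis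
qed

text \<open>All discordant pairs that are not forced lie inside a block, between a stub and its dock, or
  between the two stubs of a bridge. All terms
  count ordered pairs; a bridge occurs once for each of its two arcs.\<close>

lemma variation_live:
  "variation w live live = (\<Sum>v \<in> V. variation (\<lambda>q. w (pix v q)) (block L) (block L))
     + (\<Sum>e \<in> E. 2 * \<bar>w (dock e) - w (stub e)\<bar> + \<bar>w (stub e) - w (stub (prod.swap e))\<bar>)"
proof -
  let ?g = "\<lambda>e. \<bar>w (dock e) - w (stub e)\<bar>"
  have body: "(\<Sum>x \<in> {x \<in> live. adj (pix v q) x}. \<bar>w (pix v q) - w x\<bar>)
    = (\<Sum>q' \<in> {q' \<in> block L. adj q q'}. \<bar>w (pix v q) - w (pix v q')\<bar>)
      + (\<Sum>e \<in> {e \<in> E. (fst e, dock_off e) = (v, q)}. ?g e)" if "v \<in> V" "q \<in> block L" for v q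
  proof -
    have "pix v ` {q' \<in> block L. adj q q'} \<inter> stub ` {e \<in> E. fst e = v \<and> dock_off e = q} = {}"
    proof -
      have "pix v ` {q' \<in> block L. adj q q'} \<subseteq> body v" unfolding body_def by (intro image_mono) simp
      moreover have "stub ` {e \<in> E. fst e = v \<and> dock_off e = q} \<inter> body v = {}"
        using stub_notin_body[OF _ that(1)] by blast
      ultimately show ?thesis by blast
    qed
    moreover have "inj_on (pix v) {q' \<in> block L. adj q q'}" "inj_on stub {e \<in> E. fst e = v \<and> dock_off e = q}"
      using inj_pix[OF that(1)] inj_stub by (auto intro: inj_on_subset)
    ultimately show ?thesis
      unfolding live_neighbours_pix[OF that] using finE
      by (simp add: sum.union_disjoint sum.reindex) (intro sum.cong; auto simp: dock_def)
  qed
  have "variation w live live = (\<Sum>p \<in> live. \<Sum>x \<in> {x \<in> live. adj p x}. \<bar>w p - w x\<bar>)"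
    unfolding variation_def using finite_live by (simp add: sum_adj_pairs)
  also have "\<dots> = (\<Sum>v \<in> V. \<Sum>q \<in> block L. \<Sum>x \<in> {x \<in> live. adj (pix v q) x}. \<bar>w (pix v q) - w x\<bar>)
     + (\<Sum>e \<in> E. \<Sum>x \<in> {x \<in> live. adj (stub e) x}. \<bar>w (stub e) - w x\<bar>)"
    by (rule sum_live)
  also have "(\<Sum>e \<in> E. \<Sum>x \<in> {x \<in> live. adj (stub e) x}. \<bar>w (stub e) - w x\<bar>)
     = (\<Sum>e \<in> E. ?g e + \<bar>w (stub e) - w (stub (prod.swap e))\<bar>)"
    using dock_neq_stub[OF _ swap_in_E]
    by (intro sum.cong refl) (simp add: live_neighbours_stub abs_minus_commute)
  also have "(\<Sum>v \<in> V. \<Sum>q \<in> block L. \<Sum>x \<in> {x \<in> live. adj (pix v q) x}. \<bar>w (pix v q) - w x\<bar>)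
     = (\<Sum>v \<in> V. variation (\<lambda>q. w (pix v q)) (block L) (block L))
       + (\<Sum>v \<in> V. \<Sum>q \<in> block L. \<Sum>e \<in> {e \<in> E. (fst e, dock_off e) = (v, q)}. ?g e)"
    unfolding variation_def by (simp add: body sum_adj_pairs sum.distrib)
  also have "(\<Sum>v \<in> V. \<Sum>q \<in> block L. \<Sum>e \<in> {e \<in> E. (fst e, dock_off e) = (v, q)}. ?g e)
     = (\<Sum>z \<in> V \<times> block L. \<Sum>e \<in> {e \<in> E. (fst e, dock_off e) = z}. ?g e)"
    by (simp add: sum.cartesian_product case_prod_beta prod_eq_iff)
  also have "\<dots> = (\<Sum>e \<in> E. ?g e)"
    using finE finV fst_in_V off_simps(5) by (intro sum.group) auto
  finally show ?thesis by (simp add: sum.distrib sum_distrib_left)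
qed

text \<open>Pixels that are not forced keep a distance from the border of the picture, so that they have
  exactly four neighbours, and from the strip, so that all their forced neighbours are white.\<close>

lemma live_bounds:
  assumes "p \<in> live"
  shows "1 \<le> fst p" "1 \<le> snd p" "fst p + 2 < height" "snd p + 2 + strip_len \<le> width"
proof -
  obtain v q where v: "v \<in> V" and p: "p = pix v q" and q: "fst q < L + 2" "snd q < L + 2"
    and q0: "fst q \<noteq> 0 \<or> row v \<noteq> 0" "snd q \<noteq> 0 \<or> col v \<noteq> 0"
    and q1: "fst q \<noteq> L + 1 \<or> Suc (row v) < card (fst ` V)" "snd q \<noteq> L + 1 \<or> Suc (col v) < card (snd ` V)"
  proof -
    show thesis using assms
    proof (cases rule: in_live_cases)
      case (body v q)
      then show ?thesis using block_less[of q] by (intro that[of v q]) auto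
    next
      case (stub e)
      obtain u v where e: "e = (u, v)" by (cases e)
      have uv: "(u, v) \<in> E" "u \<in> V" "v \<in> V" using stub e E_sub by auto
      have less: "row u < card (fst ` V)" "row v < card (fst ` V)" "col u < card (snd ` V)" "col v < card (snd ` V)"
        using uv row_less col_less by auto
      have "(fst (stub_off e) \<noteq> 0 \<or> row u \<noteq> 0) \<and> (snd (stub_off e) \<noteq> 0 \<or> col u \<noteq> 0) \<and>
        (fst (stub_off e) \<noteq> L + 1 \<or> Suc (row u) < card (fst ` V)) \<and> (snd (stub_off e) \<noteq> L + 1 \<or> Suc (col u) < card (snd ` V))"
        by (rule edge_direction[OF uv(1)]; use less L_ge e in simp)
      then show ?thesis using stub uv off_simps(1,2)[of e] by (intro that[of u "stub_off e"]) (auto simp: stub_def e)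
    qed
  qed
  have grid: "r * (L + 2) + a + 1 < n * (L + 2)" if "r < n" "a < L + 2" "a \<noteq> L + 1 \<or> Suc r < n" for r a n
  proof -
    have "Suc r * (L + 2) \<le> n * (L + 2)" using that(1) by (intro mult_right_mono) auto
    moreover have "Suc (Suc r) * (L + 2) \<le> n * (L + 2)" if "Suc r < n" using that by (intro mult_right_mono) auto
    ultimately show ?thesis using that(2,3) by auto
  qed
  show "1 \<le> fst p" "1 \<le> snd p" using q0 by (auto simp: p pix_def pos_def)
  show "fst p + 2 < height" using grid[OF row_less[OF v] q(1) q1(1)] by (simp add: p pix_def pos_def height_def)
  show "snd p + 2 + strip_len \<le> width" using grid[OF col_less[OF v] q(2) q1(2)] by (simp add: p pix_def pos_def width_def)
qed

definition dead :: "(nat \<times> nat) set" where "dead = pixels - live - strip"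

lemma finite_pixels [simp]: "finite pixels" "finite strip" "finite dead"
  unfolding dead_def pixels_def strip_def by auto

lemma live_sub: "live \<subseteq> pixels" and live_strip: "live \<inter> strip = {}" and strip_sub: "strip \<subseteq> pixels"
proof -
  show "live \<subseteq> pixels" using live_bounds(3,4) unfolding pixels_def by force
  show "live \<inter> strip = {}" using live_bounds(3) unfolding strip_def by force
  show "strip \<subseteq> pixels" unfolding strip_def pixels_def height_def by auto
qed

lemma pixels_split: "pixels = live \<union> (strip \<union> dead)"
  using live_sub strip_sub unfolding dead_def by auto

lemma sum_pixels: "sum f pixels = sum f live + sum f strip + sum f dead"
proof -
  have "sum f pixels = sum f live + sum f (strip \<union> dead)"
    unfolding pixels_split using finite_live live_strip by (intro sum.union_disjoint) (auto simp: dead_def)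
  also have "sum f (strip \<union> dead) = sum f strip + sum f dead"
    by (intro sum.union_disjoint) (auto simp: dead_def)
  finally show ?thesis by (simp only: add.assoc)
qed

lemma live_neighbour:
  assumes "p \<in> live" "adj p q" shows "q \<in> pixels" "q \<notin> strip"
proof -
  note b = live_bounds[OF assms(1)]
  show "q \<in> pixels" using assms(2) b unfolding adj_def pixels_def by (cases q) auto
  show "q \<notin> strip" using assms(2) b unfolding adj_def strip_def by (cases q) auto
qed

text \<open>For \<open>m = 0\<close> the strip is empty, in agreement with the truncated difference \<open>5 m - 1 = 0\<close>.\<close>

lemma card_strip_dead: "int (card (adj_pairs strip dead)) = 5 * int m"
proof (cases "m = 0")
  case True
  then show ?thesis by (simp add: strip_def strip_len_def adj_pairs_def)
next
  case False
  then have "V \<noteq> {}" by (auto simp: m_def)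
  then have "card (fst ` V) \<ge> 1" using finV by (simp add: Suc_leI card_gt_0_iff)
  then have h: "height \<ge> 3" using mult_le_mono1[of 1 "card (fst ` V)" "L + 2"] by (simp add: height_def)
  have s: "strip_len + 1 = 5 * m" "strip_len \<ge> 1" "strip_len < width" using False by (auto simp: strip_len_def width_def)
  let ?W = "width - strip_len"
  have dead1: "(height - 2, j) \<in> dead" if "j < width" for j
    using that h live_bounds(3)[of "(height - 2, j)"] by (auto simp: dead_def pixels_def strip_def)
  have dead2: "(height - 1, ?W - 1) \<in> dead"
    using h s live_bounds(3)[of "(height - 1, ?W - 1)"] by (auto simp: dead_def pixels_def strip_def)
  have eq: "adj_pairs strip dead = (\<lambda>j. ((height - 1, j), (height - 2, j))) ` {?W..<width}
     \<union> {((height - 1, ?W), (height - 1, ?W - 1))}" (is "_ = ?R")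
  proof (intro equalityI subsetI)
    fix z assume "z \<in> adj_pairs strip dead"
    then obtain j a b where z: "z = ((height - 1, j), (a, b))" "?W \<le> j" "j < width" "(a, b) \<in> dead" "adj (height - 1, j) (a, b)"
      unfolding adj_pairs_def strip_def by (cases z) auto
    have ab: "a < height" "b < width" "\<not> (a = height - 1 \<and> ?W \<le> b)"
      using z(4) by (auto simp: dead_def pixels_def strip_def)
    have "(b = j \<and> a = height - 2) \<or> (a = height - 1 \<and> j = ?W \<and> b = ?W - 1)"
      using z(2,3,5) ab h unfolding adj_def by auto
    then show "z \<in> ?R" using z by auto
  next
    fix z assume "z \<in> ?R"
    then show "z \<in> adj_pairs strip dead"
      using dead1 dead2 h s by (auto simp: adj_pairs_def strip_def adj_def)
  qed
  have "card ?R = card ((\<lambda>j. ((height - 1, j), (height - 2, j))) ` {?W..<width}) + 1"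
    using h by (subst card_Un_disjoint) auto
  also have "card ((\<lambda>j. ((height - 1, j), (height - 2, j))) ` {?W..<width}) = card {?W..<width}"
    by (rule card_image) (auto simp: inj_on_def)
  finally have "card (adj_pairs strip dead) = 5 * m" using s eq by simp
  then show ?thesis by simp
qed

definition forced :: "(nat \<times> nat \<Rightarrow> int) \<Rightarrow> nat \<times> nat \<Rightarrow> int" where
  "forced w p = (if p \<in> live then w p else if p \<in> strip then 1 else 0)"

lemma variation_forced:
  assumes w: "\<And>p. p \<in> live \<Longrightarrow> w p \<in> {0, 1}" "\<And>p. p \<in> strip \<Longrightarrow> w p = 1" "\<And>p. p \<in> dead \<Longrightarrow> w p = 0"
  shows "variation w pixels pixels = variation w live live
     + 2 * (\<Sum>p \<in> live. w p * int (card {q. adj p q \<and> q \<notin> live})) + 10 * int m"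
proof -
  have zero: "variation w S T = 0" if "\<And>p q. p \<in> S \<Longrightarrow> q \<in> T \<Longrightarrow> adj p q \<Longrightarrow> w p = w q" for S T
    unfolding variation_def using that by (intro sum.neutral) (auto simp: adj_pairs_def)
  have ld: "variation w live dead = (\<Sum>p \<in> live. w p * int (card {q. adj p q \<and> q \<notin> live}))"
  proof -
    have "variation w live dead = (\<Sum>p \<in> live. \<Sum>q \<in> {q \<in> dead. adj p q}. \<bar>w p - w q\<bar>)"
      unfolding variation_def using finite_live by (simp add: sum_adj_pairs)
    also have "\<dots> = (\<Sum>p \<in> live. w p * int (card {q. adj p q \<and> q \<notin> live}))"
    proof (rule sum.cong[OF refl])
      fix p assume p: "p \<in> live"
      have "{q \<in> dead. adj p q} = {q. adj p q \<and> q \<notin> live}" using live_neighbour[OF p] by (auto simp: dead_def)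
      moreover have "(\<Sum>q \<in> {q \<in> dead. adj p q}. \<bar>w p - w q\<bar>) = (\<Sum>q \<in> {q \<in> dead. adj p q}. w p)"
        using w(1)[OF p] w(3) by (intro sum.cong) auto
      ultimately show "(\<Sum>q \<in> {q \<in> dead. adj p q}. \<bar>w p - w q\<bar>) = w p * int (card {q. adj p q \<and> q \<notin> live})"
        by simp
    qed
    finally show ?thesis .
  qed
  have sd: "variation w strip dead = 5 * int m"
  proof -
    have "variation w strip dead = (\<Sum>z \<in> adj_pairs strip dead. 1)"
      unfolding variation_def using w(2,3) by (intro sum.cong) (auto simp: adj_pairs_def)
    then show ?thesis using card_strip_dead by simp
  qed
  have ls: "variation w live strip = 0"
    unfolding variation_def using live_neighbour(2) by (intro sum.neutral) (auto simp: adj_pairs_def)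
  have fin: "finite live" by (rule finite_live)
  have disj: "live \<inter> (strip \<union> dead) = {}" "strip \<inter> dead = {}" using live_strip by (auto simp: dead_def)
  have "variation w pixels pixels
    = variation w live live + 2 * variation w live strip + 2 * variation w live dead
      + variation w strip strip + 2 * variation w strip dead + variation w dead dead"
    unfolding pixels_split using fin disj variation_sym[of w strip live] variation_sym[of w dead live] variation_sym[of w dead strip]
    by (simp add: variation_Un_left variation_Un_right)
  also have "variation w strip strip = 0" by (rule zero) (simp add: w)
  also have "variation w dead dead = 0" by (rule zero) (simp add: w)
  finally show ?thesis using ld sd ls by simp
qed

definition start :: "nat \<times> nat \<Rightarrow> int" where "start p = of_bool (p \<in> strip)"

definition energy :: "(nat \<times> nat \<Rightarrow> int) \<Rightarrow> int" where
  "energy w = (\<Sum>p \<in> pixels. cost p * (w p - start p)) + tv height width w"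

lemma sum_reward: "(\<Sum>p \<in> live. reward p * w p) = (\<Sum>v \<in> V. \<Sum>k \<in> {2..6}. w (pix v (k, k)))"
proof -
  let ?h = "\<lambda>z. pix (fst z) (snd z, snd z)"
  have kb: "(k, k) \<in> block L" if "k \<in> {2..6}" for k using that L_ge by (auto simp: block_def)
  have rew: "reward (pix v (k, k)) = 1" if "v \<in> V" "k \<in> {2..6}" for v k
    unfolding reward_def using that by (simp, blast)
  have rew0: "reward p = 0" if "p \<notin> ?h ` (V \<times> {2..6})" for p
  proof -
    have "p \<noteq> pix v (k, k)" if "v \<in> V" "k \<in> {2..6}" for v k
    proof
      assume "p = pix v (k, k)"
      then have "p = ?h (v, k)" "(v, k) \<in> V \<times> {2..6}" using that by auto
      then show False using \<open>p \<notin> ?h ` (V \<times> {2..6})\<close> by blast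
    qed
    then show ?thesis unfolding reward_def by simp
  qed
  have sub: "?h ` (V \<times> {2..6}) \<subseteq> live" using kb by (intro image_subsetI pix_in_live) auto
  have "inj_on ?h (V \<times> {2..6})"
  proof (rule inj_onI)
    fix z z' assume z: "z \<in> V \<times> {2..6}" "z' \<in> V \<times> {2..6}" "?h z = ?h z'"
    then have "fst z \<in> V" "fst z' \<in> V" "snd z < L + 2" "snd z' < L + 2" using L_ge by auto
    then show "z = z'" using z(3) pix_eq_iff[of "fst z" "fst z'" "(snd z, snd z)" "(snd z', snd z')"]
      by (simp add: prod_eq_iff)
  qed
  then have "(\<Sum>v \<in> V. \<Sum>k \<in> {2..6}. w (pix v (k, k))) = sum w (?h ` (V \<times> {2..6}))"
    by (simp add: sum.reindex sum.cartesian_product case_prod_beta)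
  also have "\<dots> = (\<Sum>p \<in> ?h ` (V \<times> {2..6}). reward p * w p)"
    by (rule sum.cong) (auto simp: rew)
  also have "\<dots> = (\<Sum>p \<in> live. reward p * w p)"
    using finite_live sub rew0 by (intro sum.mono_neutral_left) simp_all
  finally show ?thesis by simp
qed

text \<open>Twice the objective of a picture whose forced pixels are as intended.\<close>

definition live_energy :: "(nat \<times> nat \<Rightarrow> int) \<Rightarrow> int" where
  "live_energy w = variation w live live - 2 * (\<Sum>v \<in> V. \<Sum>k \<in> {2..6}. w (pix v (k, k))) + 10 * int m"

lemma sum_cost:
  assumes w: "\<And>p. p \<in> pixels \<Longrightarrow> w p \<in> {0, 1}"
  shows "(\<Sum>p \<in> pixels. cost p * (w p - start p)) = (\<Sum>p \<in> live. cost p * w p) + 5 * (\<Sum>p \<in> pixels. \<bar>w p - forced w p\<bar>)"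
proof -
  have "(\<Sum>p \<in> live. cost p * (w p - start p)) = (\<Sum>p \<in> live. cost p * w p + 5 * \<bar>w p - forced w p\<bar>)"
    using live_strip by (intro sum.cong) (auto simp: start_def forced_def)
  moreover have "(\<Sum>p \<in> strip. cost p * (w p - start p)) = (\<Sum>p \<in> strip. 5 * \<bar>w p - forced w p\<bar>)"
  proof (rule sum.cong[OF refl])
    fix p assume p: "p \<in> strip"
    then have "w p = 0 \<or> w p = 1" "p \<notin> live" using w[of p] strip_sub live_strip by blast+
    then show "cost p * (w p - start p) = 5 * \<bar>w p - forced w p\<bar>"
      using p by (auto simp: start_def forced_def cost_def)
  qed
  moreover have "(\<Sum>p \<in> dead. cost p * (w p - start p)) = (\<Sum>p \<in> dead. 5 * \<bar>w p - forced w p\<bar>)"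
  proof (rule sum.cong[OF refl])
    fix p assume p: "p \<in> dead"
    then have "w p = 0 \<or> w p = 1" using w[of p] by (simp add: dead_def)
    then show "cost p * (w p - start p) = 5 * \<bar>w p - forced w p\<bar>"
      using p by (auto simp: start_def forced_def cost_def dead_def)
  qed
  ultimately show ?thesis
    by (simp add: sum_pixels sum.distrib sum_distrib_left)
qed

lemma live_part_forced:
  assumes w: "\<And>p. p \<in> live \<Longrightarrow> w p \<in> {0, 1}" "\<And>p. p \<in> strip \<Longrightarrow> w p = 1" "\<And>p. p \<in> dead \<Longrightarrow> w p = 0"
  shows "2 * (\<Sum>p \<in> live. cost p * w p) + variation w pixels pixels = live_energy w"
proof -
  have "(\<Sum>p \<in> live. cost p * w p) = (\<Sum>p \<in> live. - (w p * int (card {q. adj p q \<and> q \<notin> live})) - reward p * w p)"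
    by (rule sum.cong) (auto simp: cost_def algebra_simps)
  also have "\<dots> = - (\<Sum>p \<in> live. w p * int (card {q. adj p q \<and> q \<notin> live})) - (\<Sum>p \<in> live. reward p * w p)"
    by (simp add: sum_subtractf sum_negf)
  finally have "(\<Sum>p \<in> live. cost p * w p)
     = - (\<Sum>p \<in> live. w p * int (card {q. adj p q \<and> q \<notin> live})) - (\<Sum>v \<in> V. \<Sum>k \<in> {2..6}. w (pix v (k, k)))"
    unfolding sum_reward .
  moreover have "variation w pixels pixels = variation w live live
     + 2 * (\<Sum>p \<in> live. w p * int (card {q. adj p q \<and> q \<notin> live})) + 10 * int m"
    by (rule variation_forced) (fact w)+
  ultimately show ?thesis unfolding live_energy_def by simp
qed

text \<open>Resetting the forced pixels saves \<open>5\<close> in linear cost for every reset pixel and adds at most \<open>4\<close> to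
  the total variation.\<close>

lemma energy_ge:
  assumes w: "\<And>p. p \<in> pixels \<Longrightarrow> w p \<in> {0, 1}"
  shows "2 * energy w \<ge> live_energy w"
proof -
  let ?w = "forced w"
  have fw: "\<And>p. p \<in> live \<Longrightarrow> ?w p = w p" by (simp add: forced_def)
  have "2 * (\<Sum>p \<in> live. cost p * ?w p) + variation ?w pixels pixels = live_energy ?w"
    using w live_sub live_strip by (intro live_part_forced) (auto simp: forced_def dead_def)
  also have "live_energy ?w = live_energy w"
  proof -
    have "variation ?w live live = variation w live live"
      unfolding variation_def by (rule sum.cong) (auto simp: adj_pairs_def fw)
    moreover have "?w (pix v (k, k)) = w (pix v (k, k))" if "v \<in> V" "k \<in> {2..6}" for v k
      using that L_ge by (intro fw pix_in_live) (auto simp: block_def)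
    ultimately show ?thesis unfolding live_energy_def by simp
  qed
  also have "(\<Sum>p \<in> live. cost p * ?w p) = (\<Sum>p \<in> live. cost p * w p)" by (simp add: fw)
  finally have 1: "2 * (\<Sum>p \<in> live. cost p * w p) + variation ?w pixels pixels = live_energy w" .
  define d where "d = (\<Sum>p \<in> pixels. \<bar>w p - ?w p\<bar>)"
  have "(\<Sum>p \<in> pixels. cost p * (w p - start p)) = (\<Sum>p \<in> live. cost p * w p) + 5 * d"
    unfolding d_def by (rule sum_cost) (fact w)
  then have 2: "2 * energy w = 2 * (\<Sum>p \<in> live. cost p * w p) + 10 * d + 2 * tv height width w"
    unfolding energy_def by simp
  have 3: "variation ?w pixels pixels \<le> 2 * tv height width w + 8 * d"
    using variation_change_le[of pixels ?w w] variation_eq_tv[of w height width] by (simp add: pixels_def d_def)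
  have "0 \<le> d" unfolding d_def by (rule sum_nonneg) simp
  then show ?thesis using 1 2 3 by linarith
qed

lemma energy_forced:
  assumes w: "\<And>p. p \<in> live \<Longrightarrow> w p \<in> {0, 1}" "\<And>p. p \<in> strip \<Longrightarrow> w p = 1" "\<And>p. p \<in> dead \<Longrightarrow> w p = 0"
  shows "2 * energy w = live_energy w"
proof -
  have "(\<Sum>p \<in> pixels. \<bar>w p - forced w p\<bar>) = 0"
    unfolding pixels_split using w by (intro sum.neutral) (auto simp: forced_def)
  moreover have "w p \<in> {0, 1}" if "p \<in> pixels" for p
    using that w[of p] unfolding pixels_split by blast
  ultimately have "(\<Sum>p \<in> pixels. cost p * (w p - start p)) = (\<Sum>p \<in> live. cost p * w p)"
    using sum_cost[of w] by simp
  moreover have "2 * (\<Sum>p \<in> live. cost p * w p) + variation w pixels pixels = live_energy w"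
    by (rule live_part_forced) (fact w)+
  moreover have "variation w pixels pixels = 2 * tv height width w"
    unfolding pixels_def by (rule variation_eq_tv)
  ultimately show ?thesis unfolding energy_def by simp
qed

section \<open>Optimal pictures are optimal bisections\<close>

lemma card_out_edges: "card {e \<in> E. fst e \<in> T} \<le> 4 * card T" if "finite T"
proof -
  have one: "card {e \<in> E. fst e = v} \<le> 4" for v
  proof -
    have "card {e \<in> E. fst e = v} \<le> card (docks L)"
    proof (rule card_inj_on_le[where f = dock_off])
      show "inj_on dock_off {e \<in> E. fst e = v}" by (rule inj_onI, rule stub_off_eq) simp_all
    qed (use off_simps(6) in blast, simp add: docks_def)
    also have "\<dots> \<le> 4" by (rule card_docks)
    finally show ?thesis .
  qed
  have "{e \<in> E. fst e \<in> T} = (\<Union>v \<in> T. {e \<in> E. fst e = v})" by auto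
  then have "card {e \<in> E. fst e \<in> T} \<le> (\<Sum>v \<in> T. card {e \<in> E. fst e = v})"
    using card_UN_le[OF that] by simp
  also have "\<dots> \<le> (\<Sum>v \<in> T. 4)" by (rule sum_mono) (rule one)
  finally show ?thesis by simp
qed

lemma bij_swap_E: "bij_betw prod.swap E E"
  by (rule bij_betw_byWitness[where f' = prod.swap]) (auto simp: E_sym)

lemma card_in_edges:
  assumes "finite T" shows "card {e \<in> E. snd e \<in> T} \<le> 4 * card T"
proof -
  have "{e \<in> E. snd e \<in> T} = prod.swap ` {e \<in> E. fst e \<in> T}"
    using E_sym by (force simp: image_iff)
  then have "card {e \<in> E. snd e \<in> T} \<le> card {e \<in> E. fst e \<in> T}"
    using finE by (simp add: card_image_le)
  then show ?thesis using card_out_edges[OF assms] by linarith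
qed

text \<open>Nodes of a grid graph have at most four neighbours.\<close>

lemma cut_change:
  assumes "S \<subseteq> S'" "S' \<subseteq> V"
  shows "cut S' \<le> cut S + 4 * card (S' - S)" "cut S \<le> cut S' + 4 * card (S' - S)"
proof -
  have fin: "finite (S' - S)" using assms finV by (meson finite_Diff finite_subset)
  have "cut S' \<le> card ({e \<in> E. fst e \<in> S \<and> snd e \<notin> S} \<union> {e \<in> E. fst e \<in> S' - S})"
    unfolding cut_def using finE assms(1) by (intro card_mono) auto
  also have "\<dots> \<le> cut S + 4 * card (S' - S)"
    unfolding cut_def using card_Un_le card_out_edges[OF fin] by (meson add_left_mono le_trans)
  finally show "cut S' \<le> cut S + 4 * card (S' - S)" .
  have "cut S \<le> card ({e \<in> E. fst e \<in> S' \<and> snd e \<notin> S'} \<union> {e \<in> E. snd e \<in> S' - S})"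
    unfolding cut_def using finE assms(1) by (intro card_mono) auto
  also have "\<dots> \<le> cut S' + 4 * card (S' - S)"
    unfolding cut_def using card_Un_le card_in_edges[OF fin] by (meson add_left_mono le_trans)
  finally show "cut S \<le> cut S' + 4 * card (S' - S)" .
qed

definition bisection_width :: nat where
  "bisection_width = Min (cut ` {S. S \<subseteq> V \<and> card S = m})"

lemma m_le: "m \<le> card V" unfolding m_def by simp

lemma bisections: "finite {S. S \<subseteq> V \<and> card S = m}" "{S. S \<subseteq> V \<and> card S = m} \<noteq> {}"
proof -
  show "finite {S. S \<subseteq> V \<and> card S = m}" using finV by simp
  obtain T where "T \<subseteq> V" "card T = m" using obtain_subset_with_card_n[OF m_le] by blast
  then show "{S. S \<subseteq> V \<and> card S = m} \<noteq> {}" by blast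
qed

lemma bisection_width_le: "S \<subseteq> V \<Longrightarrow> card S = m \<Longrightarrow> bisection_width \<le> cut S"
  unfolding bisection_width_def using bisections by (intro Min_le) auto

lemma bisection_width_attained:
  obtains S where "S \<subseteq> V" "card S = m" "cut S = bisection_width"
proof -
  have "bisection_width \<in> cut ` {S. S \<subseteq> V \<and> card S = m}"
    unfolding bisection_width_def using bisections by (intro Min_in) auto
  then show ?thesis using that by auto
qed

lemma cut_ge_small:
  assumes "S \<subseteq> V" "card S \<le> m"
  shows "int bisection_width + 4 * int (card S) \<le> int (cut S) + 4 * int m"
proof -
  have "m - card S \<le> card (V - S)"
    using m_le card_Diff_subset[of S V] assms finV by (simp add: finite_subset diff_le_mono)
  then obtain T where T: "T \<subseteq> V - S" "card T = m - card S" "finite T"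
    using obtain_subset_with_card_n by metis
  have fin: "finite S" using assms finV finite_subset by blast
  have "card (S \<union> T) = m" using T assms fin by (subst card_Un_disjoint) auto
  then have "bisection_width \<le> cut (S \<union> T)" using T assms by (intro bisection_width_le) auto
  also have "\<dots> \<le> cut S + 4 * card T"
  proof -
    have "S \<union> T - S = T" using T by auto
    then show ?thesis using cut_change(1)[of S "S \<union> T"] T assms by auto
  qed
  finally have "int bisection_width \<le> int (cut S) + 4 * int (card T)" by linarith
  moreover have "int (card T) = int m - int (card S)" using T(2) assms(2) by (simp add: of_nat_diff)
  ultimately show ?thesis by linarith
qed

lemma cut_ge_large:
  assumes "S \<subseteq> V" "m \<le> card S"
  shows "int bisection_width + 4 * int m \<le> int (cut S) + 4 * int (card S)"
proof -
  obtain T where T: "T \<subseteq> S" "card T = m" "finite T"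
    using obtain_subset_with_card_n[OF assms(2)] by metis
  have "bisection_width \<le> cut T" using T assms by (intro bisection_width_le) auto
  also have "\<dots> \<le> cut S + 4 * card (S - T)" using cut_change(2)[OF T(1) assms(1)] .
  finally have "int bisection_width \<le> int (cut S) + 4 * int (card (S - T))" by linarith
  moreover have "int (card (S - T)) = int (card S) - int m"
    using T assms(2) by (simp add: card_Diff_subset of_nat_diff)
  ultimately show ?thesis by linarith
qed

lemma sum_swap_E: "(\<Sum>e \<in> E. f (prod.swap e)) = (\<Sum>e \<in> E. f e)"
  by (rule sum.reindex_bij_betw[OF bij_swap_E])

lemma sum_cut:
  fixes val :: "int \<times> int \<Rightarrow> int"
  assumes "\<And>v. v \<in> V \<Longrightarrow> val v \<in> {0, 1}"
  shows "(\<Sum>e \<in> E. \<bar>val (fst e) - val (snd e)\<bar>) = 2 * int (cut {v \<in> V. val v = 1})"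
proof -
  let ?S = "{v \<in> V. val v = 1}"
  let ?f = "\<lambda>e. of_bool (fst e \<in> ?S \<and> snd e \<notin> ?S) :: int"
  have "(\<Sum>e \<in> E. \<bar>val (fst e) - val (snd e)\<bar>) = (\<Sum>e \<in> E. ?f e + ?f (prod.swap e))"
  proof (rule sum.cong[OF refl])
    fix e assume e: "e \<in> E"
    then have "fst e \<in> V" "snd e \<in> V" using fst_in_V snd_in_V by auto
    then show "\<bar>val (fst e) - val (snd e)\<bar> = ?f e + ?f (prod.swap e)"
      using assms[of "fst e"] assms[of "snd e"] by auto
  qed
  also have "\<dots> = 2 * (\<Sum>e \<in> E. ?f e)" by (simp only: sum.distrib sum_swap_E[of ?f] mult_2)
  also have "(\<Sum>e \<in> E. ?f e) = int (cut ?S)"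
    unfolding cut_def using finE by (simp add: sum_of_bool_eq Int_def)
  finally show ?thesis .
qed

text \<open>A bridge has at least one discordant pair if its two docks differ in colour. Docks whose colour is
  not that of their block are accounted for separately.\<close>

lemma sum_edges_ge:
  fixes w :: "nat \<times> nat \<Rightarrow> int" and val :: "int \<times> int \<Rightarrow> int"
  assumes val: "\<And>v. v \<in> V \<Longrightarrow> val v \<in> {0, 1}" and w: "\<And>p. p \<in> live \<Longrightarrow> w p \<in> {0, 1}"
  shows "(\<Sum>e \<in> E. 2 * \<bar>w (dock e) - w (stub e)\<bar> + \<bar>w (stub e) - w (stub (prod.swap e))\<bar>)
    \<ge> 2 * int (cut {v \<in> V. val v = 1}) - 2 * (\<Sum>v \<in> V. int (card {q \<in> docks L. w (pix v q) \<noteq> val v}))"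
proof -
  define d where "d = (\<lambda>e. \<bar>w (dock e) - val (fst e)\<bar>)"
  define g where "g = (\<lambda>e. \<bar>w (dock e) - w (stub e)\<bar>)"
  have "(\<Sum>e \<in> E. d e) = (\<Sum>v \<in> V. \<Sum>e \<in> {e \<in> E. fst e = v}. d e)"
    using finE finV fst_in_V by (intro sum.group[symmetric]) auto
  also have "\<dots> \<le> (\<Sum>v \<in> V. int (card {q \<in> docks L. w (pix v q) \<noteq> val v}))"
  proof (rule sum_mono)
    fix v assume v: "v \<in> V"
    have "(\<Sum>e \<in> {e \<in> E. fst e = v}. d e) = (\<Sum>e \<in> {e \<in> E. fst e = v}. of_bool (w (dock e) \<noteq> val v))"
    proof (rule sum.cong[OF refl])
      fix e assume e: "e \<in> {e \<in> E. fst e = v}"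
      then have "w (dock e) = 0 \<or> w (dock e) = 1" using w[OF dock_in_live] by simp
      then show "d e = of_bool (w (dock e) \<noteq> val v)" using val[OF v] e by (auto simp: d_def)
    qed
    also have "\<dots> = int (card {e \<in> {e \<in> E. fst e = v}. w (dock e) \<noteq> val v})"
      using finE by (simp add: sum_of_bool_eq Int_def)
    also have "\<dots> \<le> int (card {q \<in> docks L. w (pix v q) \<noteq> val v})"
    proof (rule of_nat_mono, rule card_inj_on_le[where f = dock_off])
      show "inj_on dock_off {e \<in> {e \<in> E. fst e = v}. w (dock e) \<noteq> val v}"
        by (rule inj_onI, rule stub_off_eq) simp_all
      show "dock_off ` {e \<in> {e \<in> E. fst e = v}. w (dock e) \<noteq> val v} \<subseteq> {q \<in> docks L. w (pix v q) \<noteq> val v}"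
        using off_simps(6) by (auto simp: dock_def)
    qed (simp add: docks_def)
    finally show "(\<Sum>e \<in> {e \<in> E. fst e = v}. d e) \<le> int (card {q \<in> docks L. w (pix v q) \<noteq> val v})" .
  qed
  finally have d: "(\<Sum>e \<in> E. d e) \<le> (\<Sum>v \<in> V. int (card {q \<in> docks L. w (pix v q) \<noteq> val v}))" .
  have "2 * int (cut {v \<in> V. val v = 1}) = (\<Sum>e \<in> E. \<bar>val (fst e) - val (snd e)\<bar>)"
    by (rule sum_cut[symmetric]) (fact val)
  also have "\<dots> \<le> (\<Sum>e \<in> E. (g e + \<bar>w (stub e) - w (stub (prod.swap e))\<bar> + g (prod.swap e)) + (d e + d (prod.swap e)))"
    by (rule sum_mono) (auto simp: d_def g_def)
  also have "\<dots> = (\<Sum>e \<in> E. 2 * g e + \<bar>w (stub e) - w (stub (prod.swap e))\<bar>) + 2 * (\<Sum>e \<in> E. d e)"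
    by (simp only: sum.distrib sum_swap_E mult_2)
  finally show ?thesis using d unfolding g_def by linarith
qed

text \<open>The colours \<open>val v\<close> given by \<open>block_dichotomy\<close> turn a picture into a set \<open>S0\<close> of black blocks. The
  number \<open>G v\<close> is what the imperfections of the block of \<open>v\<close> cost after deducting all advantages that they can bring
  at its docks and at its rewarded pixels.

  If \<open>S0\<close> has at most \<open>m\<close> nodes, then every missing node loses a reward of \<open>5\<close> and could have cut at
  most \<open>4\<close> edges more. If \<open>S0\<close> has \<open>t > 0\<close> nodes too many, the budget leaves almost \<open>t\<close> blocks' worth of
  white pixels inside blocks of \<open>S0\<close>, and by the second inequality of \<open>block_dichotomy\<close> these cost more than
  the at most \<open>9 t\<close> that the surplus nodes gain in rewards and cut edges. In an optimal picture the blocks are monochromatic, so that one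
  pixel of a block tells its colour.\<close>

lemma energy_lower_bound:
  assumes w: "\<And>p. p \<in> pixels \<Longrightarrow> w p \<in> {0, 1}"
    and le: "(\<Sum>p \<in> pixels. \<bar>w p - start p\<bar>) \<le> int budget"
  defines "S \<equiv> {v \<in> V. w (pix v (7, 7)) = 1}"
  shows "int bisection_width \<le> energy w"
    and "energy w \<le> int bisection_width \<Longrightarrow> card S = m \<and> cut S \<le> bisection_width"
proof -
  have wl: "\<And>p. p \<in> live \<Longrightarrow> w p \<in> {0, 1}" using w live_sub by blast
  have wb: "w (pix v q) \<in> {0, 1}" if "v \<in> V" "q \<in> block L" for v q using wl pix_in_live that by blast
  define X where "X = (\<lambda>v. variation (\<lambda>q. w (pix v q)) (block L) (block L))"
  define dis where "dis = (\<lambda>v val. card {q \<in> block L. w (pix v q) \<noteq> val})"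
  define a where "a = (\<lambda>v val. card {q \<in> docks L. w (pix v q) \<noteq> val})"
  define rd where "rd = (\<lambda>v val. card {k \<in> {2..6}. w (pix v (k, k)) \<noteq> val})"
  have "\<forall>v \<in> V. \<exists>val. val \<in> {0, 1} \<and> (dis v val = 0 \<or> (X v \<ge> 2 * int (a v val + rd v val + 1)
      \<and> (X v - 2 * int (a v val)) * int (L * L) \<ge> 24 * int (dis v val)))"
  proof
    fix v assume v: "v \<in> V"
    show "\<exists>val. val \<in> {0, 1} \<and> (dis v val = 0 \<or> (X v \<ge> 2 * int (a v val + rd v val + 1)
      \<and> (X v - 2 * int (a v val)) * int (L * L) \<ge> 24 * int (dis v val)))"
      using block_dichotomy[of L "\<lambda>q. w (pix v q)", OF wb[OF v] L_ge]
      unfolding Let_def X_def dis_def a_def rd_def by blast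
  qed
  from bchoice[OF this] obtain val where val_all:
    "\<forall>v \<in> V. val v \<in> {0, 1 :: int} \<and> (dis v (val v) = 0 \<or> (X v \<ge> 2 * int (a v (val v) + rd v (val v) + 1)
      \<and> (X v - 2 * int (a v (val v))) * int (L * L) \<ge> 24 * int (dis v (val v))))" ..
  have val: "\<And>v. v \<in> V \<Longrightarrow> val v \<in> {0, 1}" using val_all by blast
  define D where "D = (\<lambda>v. dis v (val v))"
  define Av where "Av = (\<lambda>v. a v (val v))"
  define Rv where "Rv = (\<lambda>v. rd v (val v))"
  have dich: "D v = 0 \<or> (X v \<ge> 2 * int (Av v + Rv v + 1) \<and> (X v - 2 * int (Av v)) * int (L * L) \<ge> 24 * int (D v))"
    if "v \<in> V" for v
    using val_all that unfolding D_def Av_def Rv_def by blast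
  have D0: "w (pix v q) = val v" if "D v = 0" "q \<in> block L" for v q
  proof -
    have fin: "finite {q \<in> block L. w (pix v q) \<noteq> val v}" by simp
    then show ?thesis using that card_0_eq[OF fin] unfolding D_def dis_def by blast
  qed
  have docks_sub: "docks L \<subseteq> block L" using L_ge by (auto simp: docks_def block_def)
  have A0: "Av v = 0" if "D v = 0" for v
  proof -
    have "{q \<in> docks L. w (pix v q) \<noteq> val v} = {}" using D0[OF that] docks_sub by blast
    then show ?thesis unfolding Av_def a_def by (simp only: card.empty)
  qed
  have R0: "Rv v = 0" if "D v = 0" for v
  proof -
    have "(k, k) \<in> block L" if "k \<in> {2..6}" for k using that L_ge by (auto simp: block_def)
    then have "{k \<in> {2..6}. w (pix v (k, k)) \<noteq> val v} = {}" using D0[OF that] by blast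
    then show ?thesis unfolding Rv_def rd_def by (simp only: card.empty)
  qed
  have X0: "X v \<ge> 0" for v unfolding X_def variation_def by (rule sum_nonneg) simp
  define G where "G = (\<lambda>v. X v - 2 * int (Av v) - (if val v = 0 then 2 * int (Rv v) else 0))"
  have G0: "G v \<ge> 0" if "v \<in> V" for v
    using dich[OF that] A0[of v] R0[of v] X0[of v] unfolding G_def by auto
  have G2: "G v \<ge> 2" if "v \<in> V" "D v \<noteq> 0" for v
    using dich[OF that(1)] that(2) unfolding G_def by auto
  have G1: "G v * int (L * L) \<ge> 24 * int (D v)" if "v \<in> V" "val v = 1" for v
    using dich[OF that(1)] A0[of v] X0[of v] that(2) unfolding G_def by auto
  define S0 where "S0 = {v \<in> V. val v = 1}"
  have S0: "S0 \<subseteq> V" "finite S0" using finV by (auto simp: S0_def)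
  have var: "variation w live live \<ge> (\<Sum>v \<in> V. X v) + 2 * int (cut S0) - 2 * (\<Sum>v \<in> V. int (Av v))"
  proof -
    have "(\<Sum>e \<in> E. 2 * \<bar>w (dock e) - w (stub e)\<bar> + \<bar>w (stub e) - w (stub (prod.swap e))\<bar>)
      \<ge> 2 * int (cut {v \<in> V. val v = 1}) - 2 * (\<Sum>v \<in> V. int (card {q \<in> docks L. w (pix v q) \<noteq> val v}))"
      by (rule sum_edges_ge) (fact val wl)+
    then show ?thesis unfolding variation_live X_def Av_def a_def S0_def by simp
  qed
  have rew: "(\<Sum>k \<in> {2..6}. w (pix v (k, k))) \<le> 5 * val v + (if val v = 0 then int (Rv v) else 0)" if v: "v \<in> V" for v
  proof -
    have w01: "w (pix v (k, k)) \<in> {0, 1}" if "k \<in> {2..6}" for k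
      using that L_ge by (intro wb[OF v]) (auto simp: block_def)
    show ?thesis
    proof (cases "val v = 0")
      case True
      have "(\<Sum>k \<in> {2..6}. w (pix v (k, k))) = (\<Sum>k \<in> {2..6}. of_bool (w (pix v (k, k)) \<noteq> 0))"
        using w01 by (intro sum.cong) auto
      also have "\<dots> = int (Rv v)" using True by (simp add: Rv_def rd_def sum_of_bool_eq Int_def)
      finally show ?thesis using True by simp
    next
      case False
      have "(\<Sum>k \<in> {2..6}. w (pix v (k, k))) \<le> (\<Sum>k \<in> {2..6 :: nat}. 1)"
      proof (rule sum_mono)
        fix k :: nat assume "k \<in> {2..6}"
        from w01[OF this] show "w (pix v (k, k)) \<le> 1" by auto
      qed
      then show ?thesis using False val[OF v] by simp
    qed
  qed
  have sum_val: "(\<Sum>v \<in> V. val v) = int (card S0)"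
  proof -
    have "(\<Sum>v \<in> V. val v) = (\<Sum>v \<in> V. of_bool (val v = 1))" using val by (intro sum.cong) auto
    then show ?thesis using finV by (simp add: sum_of_bool_eq S0_def Int_def)
  qed
  have "(\<Sum>v \<in> V. \<Sum>k \<in> {2..6}. w (pix v (k, k))) \<le> (\<Sum>v \<in> V. 5 * val v + (if val v = 0 then int (Rv v) else 0))"
    by (rule sum_mono) (rule rew)
  also have "\<dots> = 5 * int (card S0) + (\<Sum>v \<in> V. if val v = 0 then int (Rv v) else 0)"
    by (simp add: sum.distrib sum_distrib_left[symmetric] sum_val)
  finally have rews: "(\<Sum>v \<in> V. \<Sum>k \<in> {2..6}. w (pix v (k, k)))
    \<le> 5 * int (card S0) + (\<Sum>v \<in> V. if val v = 0 then int (Rv v) else 0)" .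
  have sumG: "(\<Sum>v \<in> V. G v) = (\<Sum>v \<in> V. X v) - 2 * (\<Sum>v \<in> V. int (Av v)) - 2 * (\<Sum>v \<in> V. if val v = 0 then int (Rv v) else 0)"
  proof -
    have "G v = X v - 2 * int (Av v) - 2 * (if val v = 0 then int (Rv v) else 0)" for v
      unfolding G_def by simp
    then show ?thesis by (simp only: sum_subtractf sum_distrib_left)
  qed
  have "2 * energy w \<ge> live_energy w" by (rule energy_ge) (fact w)
  then have main: "2 * energy w \<ge> 2 * int (cut S0) - 10 * int (card S0) + 10 * int m + (\<Sum>v \<in> V. G v)"
    using var rews sumG unfolding live_energy_def by linarith
  \<comment> \<open>black pixels of blocks are not black from the start, hence they are paid from the budget\<close>
  have ones: "(\<Sum>v \<in> V. \<Sum>q \<in> block L. w (pix v q)) \<le> int budget"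
  proof -
    have "(\<Sum>v \<in> V. \<Sum>q \<in> block L. w (pix v q)) \<le> sum w live"
    proof -
      have "0 \<le> (\<Sum>e \<in> E. w (stub e))"
      proof (rule sum_nonneg)
        fix e assume "e \<in> E"
        from wl[OF stub_in_live[OF this]] show "0 \<le> w (stub e)" by auto
      qed
      then show ?thesis unfolding sum_live by simp
    qed
    also have "\<dots> = (\<Sum>p \<in> live. \<bar>w p - start p\<bar>)"
    proof (rule sum.cong[OF refl])
      fix p assume p: "p \<in> live"
      then have "start p = 0" using live_strip by (auto simp: start_def)
      then show "w p = \<bar>w p - start p\<bar>" using wl[OF p] by auto
    qed
    also have "\<dots> \<le> (\<Sum>p \<in> pixels. \<bar>w p - start p\<bar>)" by (rule sum_mono2) (auto simp: live_sub)
    finally show ?thesis using le by simp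
  qed
  have cardb: "card (block L) = L * L" by (simp add: block_def)
  have body_ones: "(\<Sum>q \<in> block L. w (pix v q)) = int (L * L) - int (D v)" if "v \<in> S0" for v
  proof -
    have v: "v \<in> V" "val v = 1" using that by (auto simp: S0_def)
    have "(\<Sum>q \<in> block L. w (pix v q)) = (\<Sum>q \<in> block L. 1 - of_bool (w (pix v q) \<noteq> 1))"
      using wb[OF v(1)] by (intro sum.cong) auto
    also have "\<dots> = int (L * L) - int (D v)"
      using v(2) by (simp add: sum_subtractf cardb sum_of_bool_eq D_def dis_def Int_def)
    finally show ?thesis .
  qed
  have "(\<Sum>v \<in> S0. int (L * L) - int (D v)) = (\<Sum>v \<in> S0. \<Sum>q \<in> block L. w (pix v q))"
    by (rule sum.cong[OF refl]) (rule body_ones[symmetric])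
  also have "\<dots> \<le> (\<Sum>v \<in> V. \<Sum>q \<in> block L. w (pix v q))"
    using finV S0 wb by (intro sum_mono2 sum_nonneg) force+
  finally have deficit: "int (L * L) * int (card S0) - (\<Sum>v \<in> S0. int (D v)) \<le> int (L * L) * int m + int (card E)"
    using ones unfolding budget_def by (simp add: sum_subtractf mult.commute)
  have LL: "int (L * L) > 4 * int (card E)"
  proof -
    have "40 * L \<le> L * L" using L_ge by simp
    moreover have "4 * card E < 40 * L" by (simp add: L_def)
    ultimately have "4 * card E < L * L" by (rule less_le_trans[rotated])
    then show ?thesis by linarith
  qed
  have S_eq: "S = S0" if "\<And>v. v \<in> V \<Longrightarrow> D v = 0"
  proof -
    have "w (pix v (7, 7)) = val v" if "v \<in> V" for v
      using L_ge by (intro D0 \<open>\<And>v. v \<in> V \<Longrightarrow> D v = 0\<close> that) (auto simp: block_def)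
    then show ?thesis unfolding S_def S0_def by auto
  qed
  have sumG0: "0 \<le> (\<Sum>v \<in> V. G v)" by (rule sum_nonneg) (rule G0)
  show "int bisection_width \<le> energy w" "energy w \<le> int bisection_width \<Longrightarrow> card S = m \<and> cut S \<le> bisection_width"
  proof -
    have "int bisection_width \<le> energy w \<and> (energy w \<le> int bisection_width \<longrightarrow> card S = m \<and> cut S \<le> bisection_width)"
    proof (cases "card S0 \<le> m")
      case True
      have c: "int bisection_width + 4 * int (card S0) \<le> int (cut S0) + 4 * int m"
        by (rule cut_ge_small[OF S0(1) True])
      have lower: "int bisection_width \<le> energy w" using main c sumG0 True by linarith
      moreover have "card S = m \<and> cut S \<le> bisection_width" if opt: "energy w \<le> int bisection_width"
      proof -
        have card: "card S0 = m" using main c sumG0 True opt by linarith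
        have "(\<Sum>v \<in> V. G v) < 2" using main c card opt bisection_width_le[OF S0(1) card] by linarith
        have "D v = 0" if v: "v \<in> V" for v
        proof (rule ccontr)
          assume "D v \<noteq> 0"
          then have "2 \<le> G v" by (rule G2[OF v])
          also have "\<dots> \<le> (\<Sum>v \<in> V. G v)" using finV G0 v by (intro member_le_sum) auto
          finally show False using \<open>(\<Sum>v \<in> V. G v) < 2\<close> by simp
        qed
        then have "S = S0" by (rule S_eq)
        moreover have "cut S0 \<le> bisection_width" using main card opt sumG0 by linarith
        ultimately show ?thesis using card by simp
      qed
      ultimately show ?thesis by blast
    next
      case False
      define t where "t = int (card S0) - int m"
      have t: "t \<ge> 1" using False by (simp add: t_def)
      have c: "int bisection_width + 4 * int m \<le> int (cut S0) + 4 * int (card S0)"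
        using False by (intro cut_ge_large[OF S0(1)]) simp
      \<comment> \<open>\<open>24\<close> times the white pixels in \<open>S0\<close>, of which there are at least \<open>L\<^sup>2 t - card E \<ge> 3 L\<^sup>2 t / 4\<close>, gives \<open>18 t\<close>\<close>
      have "24 * (\<Sum>v \<in> S0. int (D v)) = (\<Sum>v \<in> S0. 24 * int (D v))" by (simp add: sum_distrib_left)
      also have "\<dots> \<le> (\<Sum>v \<in> S0. G v * int (L * L))"
        by (rule sum_mono) (auto simp: S0_def intro: G1[simplified])
      also have "\<dots> = (\<Sum>v \<in> S0. G v) * int (L * L)" by (simp add: sum_distrib_right)
      also have "\<dots> \<le> (\<Sum>v \<in> V. G v) * int (L * L)"
        using finV S0 G0 by (intro mult_right_mono sum_mono2) auto
      finally have "24 * (\<Sum>v \<in> S0. int (D v)) \<le> (\<Sum>v \<in> V. G v) * int (L * L)" .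
      moreover have "(\<Sum>v \<in> S0. int (D v)) \<ge> int (L * L) * t - int (card E)"
        using deficit unfolding t_def by (simp add: algebra_simps)
      ultimately have "24 * (int (L * L) * t) - 24 * int (card E) \<le> (\<Sum>v \<in> V. G v) * int (L * L)" by linarith
      moreover have "6 * int (L * L) \<le> 6 * (int (L * L) * t)"
        using t mult_left_mono[of 1 t "int (L * L)"] by simp
      ultimately have "18 * (int (L * L) * t) < (\<Sum>v \<in> V. G v) * int (L * L)" using LL by linarith
      then have "(18 * t) * int (L * L) < (\<Sum>v \<in> V. G v) * int (L * L)" by (simp add: algebra_simps)
      then have "18 * t < (\<Sum>v \<in> V. G v)" by (rule mult_right_less_imp_less) simp
      moreover have "int (card S0) = int m + t" by (simp add: t_def)
      ultimately have "energy w > int bisection_width" using main c t by linarith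
      then show ?thesis by simp
    qed
    then show "int bisection_width \<le> energy w" "energy w \<le> int bisection_width \<Longrightarrow> card S = m \<and> cut S \<le> bisection_width"
      by blast+
  qed
qed

text \<open>The picture of a set of nodes; every stub has the colour of the block that it is attached to.\<close>

definition picture :: "(int \<times> int) set \<Rightarrow> nat \<times> nat \<Rightarrow> int" where
  "picture S p = of_bool (p \<in> strip \<or> (\<exists>v \<in> S. p \<in> body v) \<or> (\<exists>e \<in> E. fst e \<in> S \<and> p = stub e))"

lemma picture_01: "picture S p \<in> {0, 1}"
proof -
  have "of_bool b \<in> {0, 1 :: int}" for b by (cases b) auto
  then show ?thesis unfolding picture_def .
qed

lemma energy_upper_bound:
  assumes S: "S \<subseteq> V" "card S = m"
  shows "energy (picture S) = int (cut S)" "(\<Sum>p \<in> pixels. \<bar>picture S p - start p\<bar>) \<le> int budget"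
proof -
  let ?w = "picture S"
  have pixv: "?w (pix v q) = of_bool (v \<in> S)" if v: "v \<in> V" "q \<in> block L" for v q
  proof -
    have b: "pix v q \<in> body v" using v by (simp add: body_def)
    have "pix v q \<notin> strip" using pix_in_live[OF v] live_strip by blast
    moreover have "(\<exists>u \<in> S. pix v q \<in> body u) \<longleftrightarrow> v \<in> S" using b body_disjoint[OF v(1)] S(1) by blast
    moreover have "pix v q \<noteq> stub e" if "e \<in> E" for e using stub_notin_body[OF that v(1)] b by metis
    ultimately show ?thesis unfolding picture_def by auto
  qed
  have stubv: "?w (stub e) = of_bool (fst e \<in> S)" if e: "e \<in> E" for e
  proof -
    have "stub e \<notin> strip" using stub_in_live[OF e] live_strip by blast
    moreover have "\<not> (\<exists>u \<in> S. stub e \<in> body u)" using stub_notin_body[OF e] S(1) by blast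
    moreover have "(\<exists>e' \<in> E. fst e' \<in> S \<and> stub e = stub e') \<longleftrightarrow> fst e \<in> S" using inj_stub e by (auto dest: inj_onD)
    ultimately show ?thesis unfolding picture_def by simp
  qed
  have w1: "?w p \<in> {0, 1}" for p by (rule picture_01)
  have w2: "?w p = 1" if "p \<in> strip" for p using that unfolding picture_def by simp
  have w3: "?w p = 0" if "p \<in> dead" for p
  proof -
    have "p \<notin> strip" "p \<notin> live" using that by (auto simp: dead_def)
    then show ?thesis unfolding picture_def live_def using S(1) by auto
  qed
  have sum_S: "(\<Sum>v \<in> V. of_bool (v \<in> S)) = int m"
    using finV S by (simp add: sum_of_bool_eq Int_absorb1 Int_absorb2)
  have flat: "variation (\<lambda>q. ?w (pix v q)) (block L) (block L) = 0" if "v \<in> V" for v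
    unfolding variation_def using that by (intro sum.neutral) (auto simp: adj_pairs_def pixv)
  have dockv: "?w (dock e) = of_bool (fst e \<in> S)" if "e \<in> E" for e
    unfolding dock_def using that by (intro pixv fst_in_V off_simps)
  have "variation ?w live live = (\<Sum>e \<in> E. \<bar>of_bool (fst e \<in> S) - of_bool (snd e \<in> S)\<bar>)"
    unfolding variation_live using swap_in_E by (simp add: flat dockv stubv)
  also have "\<dots> = 2 * int (cut S)"
  proof -
    have "{v \<in> V. (of_bool (v \<in> S) :: int) = 1} = S" using S(1) by auto
    then show ?thesis using sum_cut[of "\<lambda>v. of_bool (v \<in> S)"] by simp
  qed
  finally have "variation ?w live live = 2 * int (cut S)" .
  moreover have "(\<Sum>v \<in> V. \<Sum>k \<in> {2..6}. ?w (pix v (k, k))) = (\<Sum>v \<in> V. 5 * of_bool (v \<in> S))"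
  proof (rule sum.cong[OF refl])
    fix v assume v: "v \<in> V"
    have "(\<Sum>k \<in> {2..6}. ?w (pix v (k, k))) = (\<Sum>k \<in> {2..6 :: nat}. of_bool (v \<in> S))"
      using L_ge by (intro sum.cong refl pixv[OF v]) (auto simp: block_def)
    then show "(\<Sum>k \<in> {2..6}. ?w (pix v (k, k))) = 5 * of_bool (v \<in> S)" by simp
  qed
  moreover have "\<dots> = 5 * int m" by (simp only: sum_distrib_left[symmetric] sum_S)
  moreover have "2 * energy ?w = live_energy ?w" by (rule energy_forced) (rule w1, erule w2, erule w3)
  ultimately show "energy ?w = int (cut S)" unfolding live_energy_def by simp
  have "(\<Sum>p \<in> pixels. \<bar>?w p - start p\<bar>) = (\<Sum>p \<in> live. \<bar>?w p - start p\<bar>)"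
    unfolding sum_pixels using w2 w3 by (simp add: start_def dead_def)
  also have "\<dots> = sum ?w live"
  proof (rule sum.cong[OF refl])
    fix p assume "p \<in> live"
    then have "start p = 0" using live_strip by (auto simp: start_def)
    then show "\<bar>?w p - start p\<bar> = ?w p" using w1[of p] by auto
  qed
  also have "\<dots> = int (L * L) * int m + (\<Sum>e \<in> E. of_bool (fst e \<in> S))"
  proof -
    have "(\<Sum>v \<in> V. \<Sum>q \<in> block L. ?w (pix v q)) = (\<Sum>v \<in> V. int (L * L) * of_bool (v \<in> S))"
      by (rule sum.cong) (auto simp: pixv block_def)
    also have "\<dots> = int (L * L) * int m" by (simp only: sum_distrib_left[symmetric] sum_S)
    finally show ?thesis unfolding sum_live by (simp add: stubv)
  qed
  also have "\<dots> \<le> int (L * L) * int m + (\<Sum>e \<in> E. 1)" by (intro add_left_mono sum_mono) simp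
  finally show "(\<Sum>p \<in> pixels. \<bar>?w p - start p\<bar>) \<le> int budget" unfolding budget_def by simp
qed

end

section \<open>The program\<close>

type_synonym graph_lists = "(int \<times> int) list \<times> ((int \<times> int) \<times> (int \<times> int)) list"

definition row_coords :: "graph_lists \<Rightarrow> int list" where
  "row_coords i = sorted_list_of_set (set (map fst (fst i)))"
definition col_coords :: "graph_lists \<Rightarrow> int list" where
  "col_coords i = sorted_list_of_set (set (map snd (fst i)))"

text \<open>The offsets inside a cell are classified by small numbers: \<open>0\<close> and \<open>10\<close> are the margins, \<open>1\<close> and \<open>9\<close> the
  first and the last line of the block, \<open>2\<close> to \<open>6\<close> the lines with a rewarded pixel, \<open>7\<close> the lines of the docks,
  and \<open>8\<close> all remaining lines. The cost of a pixel depends on the kinds of its row and of its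
  column and on the arcs at its node only, so no arithmetic on positions is needed.\<close>

definition kinds :: "graph_lists \<Rightarrow> int list" where
  "kinds i = [0, 1, 2, 3, 4, 5, 6, 7] @ map (\<lambda>_. 8) (snd i) @ replicate 32 8 @ [9, 10]"

definition row_labels :: "graph_lists \<Rightarrow> (int \<times> int) list" where
  "row_labels i = concat (map (\<lambda>x. map (\<lambda>k. (x, k)) (kinds i)) (row_coords i))"
definition col_labels :: "graph_lists \<Rightarrow> (int \<times> int) list" where
  "col_labels i = concat (map (\<lambda>x. map (\<lambda>k. (x, k)) (kinds i)) (col_coords i))"

definition has_node :: "graph_lists \<Rightarrow> int \<Rightarrow> int \<Rightarrow> bool" where
  "has_node i x y = list_ex (\<lambda>v. fst v = x \<and> snd v = y) (fst i)"
definition has_arc_up :: "graph_lists \<Rightarrow> int \<Rightarrow> int \<Rightarrow> bool" where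
  "has_arc_up i x y = list_ex (\<lambda>e. fst (fst e) = x \<and> snd (fst e) = y \<and> fst (snd e) < x) (snd i)"
definition has_arc_down :: "graph_lists \<Rightarrow> int \<Rightarrow> int \<Rightarrow> bool" where
  "has_arc_down i x y = list_ex (\<lambda>e. fst (fst e) = x \<and> snd (fst e) = y \<and> x < fst (snd e)) (snd i)"
definition has_arc_left :: "graph_lists \<Rightarrow> int \<Rightarrow> int \<Rightarrow> bool" where
  "has_arc_left i x y = list_ex (\<lambda>e. fst (fst e) = x \<and> snd (fst e) = y \<and> snd (snd e) < y) (snd i)"
definition has_arc_right :: "graph_lists \<Rightarrow> int \<Rightarrow> int \<Rightarrow> bool" where
  "has_arc_right i x y = list_ex (\<lambda>e. fst (fst e) = x \<and> snd (fst e) = y \<and> y < snd (snd e)) (snd i)"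

text \<open>The number of sides at which the pixel is not continued by the block or a stub, increased by one
  on rewarded pixels, with a negative sign. Corner pixels have two such sides.\<close>

definition block_cost :: "bool \<Rightarrow> bool \<Rightarrow> bool \<Rightarrow> bool \<Rightarrow> int \<Rightarrow> int \<Rightarrow> int" where
  "block_cost u d l r k k' =
     (if (k = 1 \<or> k = 9) \<and> (k' = 1 \<or> k' = 9) then - 2
      else if (k = 1 \<and> \<not> (k' = 7 \<and> u)) \<or> (k = 9 \<and> \<not> (k' = 7 \<and> d))
        \<or> (k' = 1 \<and> \<not> (k = 7 \<and> l)) \<or> (k' = 9 \<and> \<not> (k = 7 \<and> r)) then - 1
      else if k = k' \<and> 1 < k \<and> k < 7 then - 1 else 0)"

definition cell_cost :: "graph_lists \<Rightarrow> int \<times> int \<Rightarrow> int \<times> int \<Rightarrow> int" where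
  "cell_cost i p q =
    (if \<not> has_node i (fst p) (fst q) then 5
     else if 0 < snd p \<and> snd p < 10 \<and> 0 < snd q \<and> snd q < 10
       then block_cost (has_arc_up i (fst p) (fst q)) (has_arc_down i (fst p) (fst q)) (has_arc_left i (fst p) (fst q)) (has_arc_right i (fst p) (fst q))
         (snd p) (snd q)
     else if (snd p = 0 \<and> snd q = 7 \<and> has_arc_up i (fst p) (fst q)) \<or> (snd p = 10 \<and> snd q = 7 \<and> has_arc_down i (fst p) (fst q))
       \<or> (snd p = 7 \<and> snd q = 0 \<and> has_arc_left i (fst p) (fst q)) \<or> (snd p = 7 \<and> snd q = 10 \<and> has_arc_right i (fst p) (fst q))
     then - 2 else 5)"

text \<open>Unary numbers: the lengths of these lists are \<open>m\<close>, the length of the strip, \<open>L\<close>, and the budget.\<close>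

definition half_list :: "graph_lists \<Rightarrow> unit list" where
  "half_list i = replicate ((length (fst i) + 1) div 2) ()"
definition strip_list :: "graph_lists \<Rightarrow> unit list" where
  "strip_list i = tl (concat (map (\<lambda>_. [(), (), (), (), ()]) (half_list i)))"
definition side_list :: "graph_lists \<Rightarrow> unit list" where
  "side_list i = map (\<lambda>_. ()) (snd i) @ replicate 40 ()"
definition budget_list :: "graph_lists \<Rightarrow> unit list" where
  "budget_list i = concat (map (\<lambda>_. concat (map (\<lambda>_. side_list i) (side_list i))) (half_list i)) @ map (\<lambda>_. ()) (snd i)"

definition cost_rows :: "graph_lists \<Rightarrow> int list list" where
  "cost_rows i = map (\<lambda>p. map (cell_cost i p) (col_labels i) @ 5 # map (\<lambda>_. 5) (strip_list i)) (row_labels i)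
     @ [map (\<lambda>_. 5) (col_labels i) @ 5 # map (\<lambda>_. - 5) (strip_list i)]"
definition start_rows :: "graph_lists \<Rightarrow> int list list" where
  "start_rows i = map (\<lambda>p. map (\<lambda>_. 0) (col_labels i) @ 0 # map (\<lambda>_. 0) (strip_list i)) (row_labels i)
     @ [map (\<lambda>_. 0) (col_labels i) @ 0 # map (\<lambda>_. 1) (strip_list i)]"

definition height_of :: "graph_lists \<Rightarrow> nat" where
  "height_of i = length (() # map (\<lambda>_. ()) (row_labels i))"
definition width_of :: "graph_lists \<Rightarrow> nat" where
  "width_of i = length (map (\<lambda>_. ()) (col_labels i) @ () # strip_list i)"

type_synonym 'a matrix_lists = "nat \<times> nat \<times> 'a list list"

definition reduce :: "graph_lists \<Rightarrow>
    nat \<times> nat \<times> int list \<times> int matrix_lists \<times> (int \<times> nat) matrix_lists \<times> (int \<times> nat) \<times> nat" where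
  "reduce i = (height_of i, width_of i, [0, 1], (height_of i, width_of i, start_rows i),
     (height_of i, width_of i, map (map (\<lambda>z. (z, 1))) (cost_rows i)), (1, 1), length (budget_list i))"

text \<open>The solution equals the picture inside blocks, so the entry at offset \<open>(7, 7)\<close> of its block tells the part of a node.\<close>

definition decode :: "graph_lists \<times> int matrix_lists \<Rightarrow> (int \<times> int) list" where
  "decode z = filter (\<lambda>v. list_ex (\<lambda>r. fst (fst r) = fst v \<and> snd (fst r) = 7 \<and>
       list_ex (\<lambda>c. fst (fst c) = snd v \<and> snd (fst c) = 7 \<and> snd c = 1) (zip (col_labels (fst z)) (snd r)))
     (zip (row_labels (fst z)) (snd (snd (snd z))))) (fst (fst z))"

lemmas ptime_rules = ptime_intros ptime_rev ptime_append ptime_map ptime_filter ptime_concat ptime_list_ex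
  ptime_zip ptime_length ptime_int_less ptime_int_eq ptime_sorted_list_of_set ptime_upper_half

lemma ptime_row_coords: "ptime f \<Longrightarrow> ptime (\<lambda>x. row_coords (f x))"
  unfolding row_coords_def by (intro ptime_rules)

lemma ptime_col_coords: "ptime f \<Longrightarrow> ptime (\<lambda>x. col_coords (f x))"
  unfolding col_coords_def by (intro ptime_rules)

lemma ptime_kinds: "ptime f \<Longrightarrow> ptime (\<lambda>x. kinds (f x))"
  unfolding kinds_def by (intro ptime_rules)

lemma ptime_row_labels: "ptime f \<Longrightarrow> ptime (\<lambda>x. row_labels (f x))"
proof -
  assume f: "ptime f"
  have "ptime (\<lambda>i. row_labels i)" unfolding row_labels_def by (intro ptime_rules ptime_kinds ptime_row_coords)
  then show ?thesis using f by (rule ptime_comp)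
qed

lemma ptime_col_labels: "ptime f \<Longrightarrow> ptime (\<lambda>x. col_labels (f x))"
proof -
  assume f: "ptime f"
  have "ptime (\<lambda>i. col_labels i)" unfolding col_labels_def by (intro ptime_rules ptime_kinds ptime_col_coords)
  then show ?thesis using f by (rule ptime_comp)
qed

lemma ptime_tests:
  assumes i: "ptime i" and x: "ptime x" and y: "ptime y"
  shows "ptime (\<lambda>z. has_node (i z) (x z) (y z))" "ptime (\<lambda>z. has_arc_up (i z) (x z) (y z))"
    "ptime (\<lambda>z. has_arc_down (i z) (x z) (y z))" "ptime (\<lambda>z. has_arc_left (i z) (x z) (y z))" "ptime (\<lambda>z. has_arc_right (i z) (x z) (y z))"
  unfolding has_node_def has_arc_up_def has_arc_down_def has_arc_left_def has_arc_right_def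
  by (intro ptime_rules i x y ptime_comp[OF i ptime_fst[OF ptime_id]] ptime_comp[OF x ptime_fst[OF ptime_id]]
      ptime_comp[OF y ptime_fst[OF ptime_id]])+

lemma ptime_cell_cost:
  assumes i: "ptime i" and p: "ptime p" and q: "ptime q"
  shows "ptime (\<lambda>z. cell_cost (i z) (p z) (q z))"
  unfolding cell_cost_def block_cost_def by (intro ptime_rules ptime_tests i p q)

lemma ptime_half_list: "ptime f \<Longrightarrow> ptime (\<lambda>x. half_list (f x))"
  unfolding half_list_def by (intro ptime_rules)

lemma ptime_strip_list: "ptime f \<Longrightarrow> ptime (\<lambda>x. strip_list (f x))"
  unfolding strip_list_def by (intro ptime_rules ptime_half_list)

lemma ptime_side_list: "ptime f \<Longrightarrow> ptime (\<lambda>x. side_list (f x))"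
  unfolding side_list_def by (intro ptime_rules)

lemma ptime_budget_list: "ptime (\<lambda>i. budget_list i)"
  unfolding budget_list_def by (intro ptime_rules ptime_half_list ptime_side_list)

lemma ptime_cost_rows: "ptime (\<lambda>i. cost_rows i)"
  unfolding cost_rows_def
  by (intro ptime_rules ptime_row_labels ptime_col_labels ptime_strip_list ptime_cell_cost)

lemma ptime_start_rows: "ptime (\<lambda>i. start_rows i)"
  unfolding start_rows_def
  by (intro ptime_rules ptime_row_labels ptime_col_labels ptime_strip_list)

lemma ptime_reduce: "ptime (\<lambda>i. reduce i)"
  unfolding reduce_def height_of_def width_of_def
  by (intro ptime_rules ptime_row_labels ptime_col_labels ptime_strip_list ptime_cost_rows ptime_start_rows ptime_budget_list)

lemma ptime_decode: "ptime (\<lambda>z. decode z)"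
  unfolding decode_def
  by (intro ptime_rules ptime_row_labels ptime_col_labels)

section \<open>The program computes the pixel picture\<close>

lemma nth_strictly_sorted_rank:
  fixes l :: "'a::linorder list"
  assumes sorted: "sorted_wrt (<) l" and k: "k < length l"
  shows "card {y \<in> set l. y < l ! k} = k"
proof -
  have less: "l ! j < l ! k \<longleftrightarrow> j < k" if j: "j < length l" for j
  proof (cases j k rule: linorder_cases)
    case less
    then show ?thesis using sorted_wrt_nth_less[OF sorted less k] by blast
  next
    case equal
    then show ?thesis by blast
  next
    case greater
    then show ?thesis using sorted_wrt_nth_less[OF sorted greater j] by (meson not_less_iff_gr_or_eq)
  qed
  have "{y \<in> set l. y < l ! k} = (!) l ` {..<k}"
  proof (intro equalityI subsetI)
    fix y assume y: "y \<in> {y \<in> set l. y < l ! k}"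
    then obtain j where "j < length l" "y = l ! j" unfolding in_set_conv_nth by blast
    then show "y \<in> (!) l ` {..<k}" using less[of j] y by blast
  next
    fix y assume "y \<in> (!) l ` {..<k}"
    then obtain j where j: "j < k" "y = l ! j" by blast
    then have "j < length l" using k by simp
    then show "y \<in> {y \<in> set l. y < l ! k}" using less[of j] j nth_mem[of j l] by blast
  qed
  moreover have "inj_on ((!) l) {..<k}"
  proof (rule inj_on_nth)
    show "distinct l" using sorted by (simp only: strict_sorted_iff)
    show "\<forall>i \<in> {..<k}. i < length l" using k by simp
  qed
  ultimately show ?thesis by (simp add: card_image)
qed

lemma nth_sorted_list_of_set_rank:
  fixes X :: "int set"
  assumes "finite X" "x \<in> X"
  shows "sorted_list_of_set X ! card {y \<in> X. y < x} = x"
proof -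
  have set: "set (sorted_list_of_set X) = X" using assms(1) by (rule set_sorted_list_of_set)
  then obtain k where k: "k < length (sorted_list_of_set X)" "sorted_list_of_set X ! k = x"
    using assms(2) by (metis in_set_conv_nth)
  have "card {y \<in> X. y < x} = k"
    using nth_strictly_sorted_rank[OF _ k(1)] strict_sorted_list_of_set[of X] unfolding set k(2) by blast
  then show ?thesis using k(2) by simp
qed

lemma length_concat_grid: "length (concat (map (\<lambda>x. map (f x) ks) xs)) = length xs * length ks"
  by (induct xs) auto

lemma nth_concat_grid:
  "I < length xs \<Longrightarrow> a < length ks \<Longrightarrow> concat (map (\<lambda>x. map (f x) ks) xs) ! (I * length ks + a) = f (xs ! I) (ks ! a)"
proof (induct xs arbitrary: I)
  case (Cons x xs)
  then show ?case
    by (cases I) (simp_all add: nth_append add.assoc)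
qed simp

text \<open>A graph together with a listing of its nodes and arcs; the computed instance is the same for all listings.\<close>

locale listed_grid_graph = grid_graph V E for V E +
  fixes vs :: "(int \<times> int) list" and es :: "((int \<times> int) \<times> (int \<times> int)) list"
  assumes vs: "distinct vs" "set vs = V" and es: "distinct es" "set es = E"
begin

abbreviation lists :: graph_lists where "lists \<equiv> (vs, es)"

definition kind :: "nat \<Rightarrow> int" where
  "kind a = (if a < 8 then int a else if a < L then 8 else if a = L then 9 else 10)"

lemma len: "length vs = card V" "length es = card E"
  using vs es distinct_card by metis+

lemma kinds_eq: "kinds lists = map kind [0..<L + 2]"
proof (rule nth_equalityI)
  have eight: "[0, 1, 2, 3, 4, 5, 6, 7] = map int [0..<8]" by (simp add: upt_rec numeral_eq_Suc)
  have eq: "kinds lists = map int [0..<8] @ replicate (card E + 32) 8 @ [9, 10]"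
    unfolding kinds_def eight using len by (simp add: map_replicate_const replicate_add)
  then show l: "length (kinds lists) = length (map kind [0..<L + 2])" by (simp add: L_def)
  fix a assume "a < length (kinds lists)"
  then have a: "a < card E + 42" using l by (simp add: L_def)
  consider "a < 8" | "8 \<le> a" "a < card E + 40" | "a = card E + 40" | "a = card E + 41" using a by linarith
  then show "kinds lists ! a = map kind [0..<L + 2] ! a"
    by cases (simp_all add: eq nth_append kind_def L_def)
qed

lemma kind_iff:
  assumes "a < L + 2"
  shows "kind a = 0 \<longleftrightarrow> a = 0" "kind a = 1 \<longleftrightarrow> a = 1" "kind a = 7 \<longleftrightarrow> a = 7" "kind a = 9 \<longleftrightarrow> a = L"
    "kind a = 10 \<longleftrightarrow> a = L + 1" "0 < kind a \<and> kind a < 10 \<longleftrightarrow> 1 \<le> a \<and> a \<le> L"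
    "1 < kind a \<and> kind a < 7 \<longleftrightarrow> 2 \<le> a \<and> a \<le> 6"
  using assms L_ge unfolding kind_def by auto

lemma kind_eq_iff: "2 \<le> a \<Longrightarrow> a \<le> 6 \<Longrightarrow> b < L + 2 \<Longrightarrow> kind a = kind b \<longleftrightarrow> a = b"
  using L_ge unfolding kind_def by auto

lemma coords: "row_coords lists = sorted_list_of_set (fst ` V)" "col_coords lists = sorted_list_of_set (snd ` V)"
  using vs by (simp_all add: row_coords_def col_coords_def)

lemma length_coords: "length (row_coords lists) = card (fst ` V)" "length (col_coords lists) = card (snd ` V)"
  using finV by (simp_all add: coords)

lemma coords_rank:
  assumes "v \<in> V" shows "row_coords lists ! row v = fst v" "col_coords lists ! col v = snd v"
  using assms finV unfolding coords row_def col_def by (simp_all add: nth_sorted_list_of_set_rank)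

lemma coords_distinct: "distinct (row_coords lists)" "distinct (col_coords lists)"
  unfolding coords by simp_all

lemma coords_eq_iff:
  assumes "v \<in> V"
  shows "I < card (fst ` V) \<Longrightarrow> row_coords lists ! I = fst v \<longleftrightarrow> I = row v"
    "J < card (snd ` V) \<Longrightarrow> col_coords lists ! J = snd v \<longleftrightarrow> J = col v"
proof -
  show "I < card (fst ` V) \<Longrightarrow> row_coords lists ! I = fst v \<longleftrightarrow> I = row v"
    using nth_eq_iff_index_eq[OF coords_distinct(1), of I "row v"] row_less[OF assms]
    by (simp add: coords_rank(1)[OF assms] length_coords)
  show "J < card (snd ` V) \<Longrightarrow> col_coords lists ! J = snd v \<longleftrightarrow> J = col v"
    using nth_eq_iff_index_eq[OF coords_distinct(2), of J "col v"] col_less[OF assms]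
    by (simp add: coords_rank(2)[OF assms] length_coords)
qed

lemma length_labels:
  "length (row_labels lists) = card (fst ` V) * (L + 2)" "length (col_labels lists) = card (snd ` V) * (L + 2)"
  unfolding row_labels_def col_labels_def 
  by (simp_all only: length_concat_grid length_coords kinds_eq length_map length_upt diff_zero)

lemma nth_labels:
  assumes "a < L + 2"
  shows "I < card (fst ` V) \<Longrightarrow> row_labels lists ! pos I a = (row_coords lists ! I, kind a)"
    "I < card (snd ` V) \<Longrightarrow> col_labels lists ! pos I a = (col_coords lists ! I, kind a)"
  using nth_concat_grid[of I "row_coords lists" a "kinds lists" Pair] nth_concat_grid[of I "col_coords lists" a "kinds lists" Pair] assms
  unfolding row_labels_def col_labels_def pos_def by (simp_all add: length_coords kinds_eq del: upt_Suc)

lemma pos_cases: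
  assumes "r < n * (L + 2)"
  obtains I a where "I < n" "a < L + 2" "r = pos I a"
proof (rule that)
  show "r div (L + 2) < n" using assms by (simp add: less_mult_imp_div_less)
  show "r mod (L + 2) < L + 2" by simp
  show "r = pos (r div (L + 2)) (r mod (L + 2))" unfolding pos_def by (rule div_mult_mod_eq[symmetric])
qed

lemma pos_less: "I < n \<Longrightarrow> a < L + 2 \<Longrightarrow> pos I a < n * (L + 2)"
proof -
  assume "I < n" "a < L + 2"
  then have "Suc I * (L + 2) \<le> n * (L + 2)" by (intro mult_right_mono) auto
  then show ?thesis using \<open>a < L + 2\<close> by (simp add: pos_def)
qed

definition toward :: "(int \<times> int \<Rightarrow> int \<times> int \<Rightarrow> bool) \<Rightarrow> int \<times> int \<Rightarrow> bool" where
  "toward d v \<longleftrightarrow> (\<exists>e \<in> E. fst e = v \<and> d (fst e) (snd e))"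

abbreviation is_up :: "int \<times> int \<Rightarrow> int \<times> int \<Rightarrow> bool" where "is_up u v \<equiv> fst v < fst u"
abbreviation is_down :: "int \<times> int \<Rightarrow> int \<times> int \<Rightarrow> bool" where "is_down u v \<equiv> fst u < fst v"
abbreviation is_left :: "int \<times> int \<Rightarrow> int \<times> int \<Rightarrow> bool" where "is_left u v \<equiv> snd v < snd u"
abbreviation is_right :: "int \<times> int \<Rightarrow> int \<times> int \<Rightarrow> bool" where "is_right u v \<equiv> snd u < snd v"

lemma tests:
  "has_node lists (fst v) (snd v) \<longleftrightarrow> v \<in> V"
  "has_arc_up lists (fst v) (snd v) \<longleftrightarrow> toward is_up v" "has_arc_down lists (fst v) (snd v) \<longleftrightarrow> toward is_down v"
  "has_arc_left lists (fst v) (snd v) \<longleftrightarrow> toward is_left v" "has_arc_right lists (fst v) (snd v) \<longleftrightarrow> toward is_right v"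
proof -
  show "has_node lists (fst v) (snd v) \<longleftrightarrow> v \<in> V"
    unfolding has_node_def list_ex_iff fst_conv vs(2) by (metis prod_eqI)
  show "has_arc_up lists (fst v) (snd v) \<longleftrightarrow> toward is_up v" "has_arc_down lists (fst v) (snd v) \<longleftrightarrow> toward is_down v"
    "has_arc_left lists (fst v) (snd v) \<longleftrightarrow> toward is_left v" "has_arc_right lists (fst v) (snd v) \<longleftrightarrow> toward is_right v"
    unfolding has_arc_up_def has_arc_down_def has_arc_left_def has_arc_right_def toward_def list_ex_iff snd_conv es(2)
    by (rule bex_cong[OF refl]; metis prod_eqI)+
qed

lemma edge_offsets:
  assumes "e \<in> E"
  shows "dock_off e = (1, 7) \<longleftrightarrow> is_up (fst e) (snd e)" "dock_off e = (L, 7) \<longleftrightarrow> is_down (fst e) (snd e)"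
    "dock_off e = (7, 1) \<longleftrightarrow> is_left (fst e) (snd e)" "dock_off e = (7, L) \<longleftrightarrow> is_right (fst e) (snd e)"
    "stub_off e = (0, 7) \<longleftrightarrow> is_up (fst e) (snd e)" "stub_off e = (L + 1, 7) \<longleftrightarrow> is_down (fst e) (snd e)"
    "stub_off e = (7, 0) \<longleftrightarrow> is_left (fst e) (snd e)" "stub_off e = (7, L + 1) \<longleftrightarrow> is_right (fst e) (snd e)"
proof -
  obtain u v where e: "e = (u, v)" by (cases e)
  have uv: "(u, v) \<in> E" using assms e by simp
  have ne: "L \<noteq> 7" "L \<noteq> 1" "L + 1 \<noteq> 7" "L + 1 \<noteq> 0" "L \<noteq> 0" "L \<noteq> 6" using L_ge by auto
  show "dock_off e = (1, 7) \<longleftrightarrow> is_up (fst e) (snd e)" "dock_off e = (L, 7) \<longleftrightarrow> is_down (fst e) (snd e)"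
    "dock_off e = (7, 1) \<longleftrightarrow> is_left (fst e) (snd e)" "dock_off e = (7, L) \<longleftrightarrow> is_right (fst e) (snd e)"
    "stub_off e = (0, 7) \<longleftrightarrow> is_up (fst e) (snd e)" "stub_off e = (L + 1, 7) \<longleftrightarrow> is_down (fst e) (snd e)"
    "stub_off e = (7, 0) \<longleftrightarrow> is_left (fst e) (snd e)" "stub_off e = (7, L + 1) \<longleftrightarrow> is_right (fst e) (snd e)"
    unfolding e fst_conv snd_conv by (rule edge_direction[OF uv]; use ne in simp)+
qed

lemma stub_off_iff:
  assumes "v \<in> V"
  shows "(\<exists>e \<in> E. fst e = v \<and> stub_off e = (a, b)) \<longleftrightarrow> (a = 0 \<and> b = 7 \<and> toward is_up v)
    \<or> (a = L + 1 \<and> b = 7 \<and> toward is_down v) \<or> (a = 7 \<and> b = 0 \<and> toward is_left v) \<or> (a = 7 \<and> b = L + 1 \<and> toward is_right v)"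
proof -
  have "stub_off e \<in> {(0, 7), (L + 1, 7), (7, 0), (7, L + 1)}" for e unfolding stub_off_def by simp
  then show ?thesis unfolding toward_def using edge_offsets(5-8) by (smt (verit, del_insts) empty_iff insert_iff prod.inject)
qed

lemma dock_off_iff:
  assumes "v \<in> V"
  shows "(\<exists>e \<in> E. fst e = v \<and> dock_off e = (a, b)) \<longleftrightarrow> (a = 1 \<and> b = 7 \<and> toward is_up v)
    \<or> (a = L \<and> b = 7 \<and> toward is_down v) \<or> (a = 7 \<and> b = 1 \<and> toward is_left v) \<or> (a = 7 \<and> b = L \<and> toward is_right v)"
proof -
  have "dock_off e \<in> {(1, 7), (L, 7), (7, 1), (7, L)}" for e unfolding dock_off_def by simp
  then show ?thesis unfolding toward_def using edge_offsets(1-4) by (smt (verit, del_insts) empty_iff insert_iff prod.inject)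
qed

lemma live_iff:
  assumes "v \<in> V" "a < L + 2" "b < L + 2"
  shows "pix v (a, b) \<in> live \<longleftrightarrow> (a, b) \<in> block L \<or> (\<exists>e \<in> E. fst e = v \<and> stub_off e = (a, b))"
proof
  assume "pix v (a, b) \<in> live"
  then show "(a, b) \<in> block L \<or> (\<exists>e \<in> E. fst e = v \<and> stub_off e = (a, b))"
  proof (cases rule: in_live_cases)
    case (body u q)
    then show ?thesis using pix_eq_iff[OF assms(1) body(1), of "(a, b)" q] block_less[of q] assms by auto
  next
    case (stub e)
    then show ?thesis using pix_eq_iff[OF assms(1) fst_in_V[OF stub(1)], of "(a, b)" "stub_off e"] off_simps(1,2)[of e] assms
      by (auto simp: stub_def)
  qed
next
  assume "(a, b) \<in> block L \<or> (\<exists>e \<in> E. fst e = v \<and> stub_off e = (a, b))"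
  then show "pix v (a, b) \<in> live"
    using pix_in_live[OF assms(1)] stub_in_live by (force simp: stub_def)
qed

lemma cell_in_live:
  assumes "(pos I a, pos J b) \<in> live" "a < L + 2" "b < L + 2"
  shows "\<exists>u \<in> V. row u = I \<and> col u = J"
  using assms(1)
proof (cases rule: in_live_cases)
  case (body u q)
  then show ?thesis using block_less[of q] assms(2,3) by (auto simp: pix_def pos_eq_iff)
next
  case (stub e)
  then show ?thesis using off_simps(1,2)[of e] assms(2,3)
    by (intro bexI[OF _ fst_in_V[OF stub(1)]]) (simp add: stub_def pix_def pos_eq_iff)
qed

text \<open>Counting live neighbours is easier, as they have been determined explicitly.\<close>

lemma card_dead_neighbours:
  assumes "p \<in> live"
  shows "int (card {q. adj p q \<and> q \<notin> live}) = 4 - int (card {q \<in> live. adj p q})"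
proof -
  obtain i j where p: "p = (Suc i, Suc j)"
    using live_bounds(1,2)[OF assms] by (cases p; cases "fst p"; cases "snd p") auto
  have "card {q. adj p q} = 4" unfolding p neighbours_Suc by simp
  moreover have "{q. adj p q} = {q. adj p q \<and> q \<notin> live} \<union> {q \<in> live. adj p q}" by auto
  moreover have "finite {q. adj p q}" by (rule card_neighbours_le)
  ultimately have "4 = card {q. adj p q \<and> q \<notin> live} + card {q \<in> live. adj p q}"
    by (metis (no_types, lifting) card_Un_disjoint disjoint_iff finite_Un mem_Collect_eq)
  then show ?thesis by linarith
qed

lemma card_block_neighbours:
  assumes "(a, b) \<in> block L"
  shows "card {q \<in> block L. adj (a, b) q} = of_bool (a \<noteq> 1) + of_bool (a \<noteq> L) + of_bool (b \<noteq> 1) + of_bool (b \<noteq> L)"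
proof -
  obtain i j where ij: "a = Suc i" "b = Suc j" using assms by (cases a; cases b) (auto simp: block_def)
  have bounds: "i < L" "j < L" using assms ij by (auto simp: block_def)
  have "{q \<in> block L. adj (a, b) q} = {q \<in> {(i, Suc j), (Suc (Suc i), Suc j), (Suc i, j), (Suc i, Suc (Suc j))}. q \<in> block L}"
    using neighbours_Suc[of i j] ij by auto
  also have "\<dots> = (if i \<noteq> 0 then {(i, Suc j)} else {}) \<union> (if Suc i \<noteq> L then {(Suc (Suc i), Suc j)} else {})
     \<union> (if j \<noteq> 0 then {(Suc i, j)} else {}) \<union> (if Suc j \<noteq> L then {(Suc i, Suc (Suc j))} else {})"
    using bounds by (auto simp: block_def)
  also have "card \<dots> = of_bool (a \<noteq> 1) + of_bool (a \<noteq> L) + of_bool (b \<noteq> 1) + of_bool (b \<noteq> L)"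
    unfolding ij by (simp add: card_insert_if)
  finally show ?thesis .
qed

lemma reward_pix:
  assumes "v \<in> V" "a < L + 2" "b < L + 2"
  shows "reward (pix v (a, b)) = of_bool (a = b \<and> 2 \<le> a \<and> a \<le> 6)"
proof -
  have "pix v (a, b) = pix u (k, k) \<longleftrightarrow> u = v \<and> a = k \<and> b = k" if "u \<in> V" "k \<in> {2..6}" for u k
    using pix_eq_iff[OF assms(1) that(1), of "(a, b)" "(k, k)"] that(2) assms L_ge by auto
  then have "(\<exists>u \<in> V. \<exists>k \<in> {2..6}. pix v (a, b) = pix u (k, k)) \<longleftrightarrow> (\<exists>u \<in> V. \<exists>k \<in> {2..6}. u = v \<and> a = k \<and> b = k)"
    by blast
  also have "\<dots> \<longleftrightarrow> a = b \<and> 2 \<le> a \<and> a \<le> 6" using assms(1) by auto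
  finally show ?thesis unfolding reward_def by simp
qed

lemma block_cost_count:
  assumes "\<not> (a1 \<and> al)" "\<not> (a1 \<and> a7)" "\<not> (al \<and> a7)" "\<not> (b1 \<and> bl)" "\<not> (b1 \<and> b7)" "\<not> (bl \<and> b7)"
    and "diag \<longrightarrow> \<not> a1 \<and> \<not> al \<and> \<not> b1 \<and> \<not> bl"
  shows "of_bool (\<not> a1) + of_bool (\<not> al) + of_bool (\<not> b1) + of_bool (\<not> bl)
      + of_bool ((a1 \<and> b7 \<and> u) \<or> (al \<and> b7 \<and> d) \<or> (a7 \<and> b1 \<and> l) \<or> (a7 \<and> bl \<and> r))
      - 4 - of_bool diag
    = (if (a1 \<or> al) \<and> (b1 \<or> bl) then - 2
      else if (a1 \<and> \<not> (b7 \<and> u)) \<or> (al \<and> \<not> (b7 \<and> d)) \<or> (b1 \<and> \<not> (a7 \<and> l)) \<or> (bl \<and> \<not> (a7 \<and> r)) then - 1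
      else if diag then - 1 else (0 :: int))"
  using assms
  by (cases a1; cases al; cases b1; cases bl; simp only: simp_thms if_True if_False of_bool_eq)
    (simp_all add: of_bool_def)

lemma cost_block:
  assumes v: "v \<in> V" and q: "(a, b) \<in> block L"
  shows "cost (pix v (a, b)) = block_cost (toward is_up v) (toward is_down v) (toward is_left v) (toward is_right v) (kind a) (kind b)"
proof -
  have ab: "1 \<le> a" "a \<le> L" "1 \<le> b" "b \<le> L" "a < L + 2" "b < L + 2" using q by (auto simp: block_def)
  let ?D = "{e \<in> E. fst e = v \<and> dock_off e = (a, b)}"
  have cD: "card ?D = of_bool (\<exists>e \<in> E. fst e = v \<and> dock_off e = (a, b))"
  proof (cases "?D = {}")
    case False
    then obtain e where e: "e \<in> ?D" by blast
    have "e' = e" if "e' \<in> ?D" for e'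
    proof (rule stub_off_eq)
      show "e' \<in> E" "e \<in> E" "fst e' = fst e" "stub_off e' = stub_off e \<or> dock_off e' = dock_off e"
        using that e by simp_all
    qed
    then have "?D = {e}" using e by blast
    moreover have "\<exists>e \<in> E. fst e = v \<and> dock_off e = (a, b)" using e by blast
    ultimately show ?thesis by simp
  next
    case True
    then have "\<not> (\<exists>e \<in> E. fst e = v \<and> dock_off e = (a, b))" by blast
    then show ?thesis unfolding True by simp
  qed
  have cl: "card {x \<in> live. adj (pix v (a, b)) x} = card {q' \<in> block L. adj (a, b) q'} + card ?D"
  proof -
    have "pix v ` {q' \<in> block L. adj (a, b) q'} \<inter> stub ` ?D = {}"
    proof -
      have "pix v ` {q' \<in> block L. adj (a, b) q'} \<subseteq> body v" unfolding body_def by (intro image_mono) simp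
      moreover have "stub ` ?D \<inter> body v = {}" using stub_notin_body[OF _ v] by blast
      ultimately show ?thesis by blast
    qed
    moreover have "inj_on (pix v) {q' \<in> block L. adj (a, b) q'}" by (rule inj_on_subset[OF inj_pix[OF v]]) blast
    moreover have "inj_on stub ?D" by (rule inj_on_subset[OF inj_stub]) blast
    ultimately show ?thesis
      unfolding live_neighbours_pix[OF v q] using finE by (simp add: card_Un_disjoint card_image)
  qed
  note pl = pix_in_live[OF v q]
  have "cost (pix v (a, b)) = int (card {q' \<in> block L. adj (a, b) q'} + card ?D) - 4 - reward (pix v (a, b))"
    using pl unfolding cl[symmetric] by (simp add: cost_def card_dead_neighbours[OF pl])
  then have cost: "cost (pix v (a, b)) = of_bool (a \<noteq> 1) + of_bool (a \<noteq> L) + of_bool (b \<noteq> 1) + of_bool (b \<noteq> L)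
      + of_bool ((a = 1 \<and> b = 7 \<and> toward is_up v) \<or> (a = L \<and> b = 7 \<and> toward is_down v)
        \<or> (a = 7 \<and> b = 1 \<and> toward is_left v) \<or> (a = 7 \<and> b = L \<and> toward is_right v))
      - 4 - of_bool (a = b \<and> 2 \<le> a \<and> a \<le> 6)"
    unfolding cD card_block_neighbours[OF q] reward_pix[OF v ab(5,6)] dock_off_iff[OF v]
    by (simp only: of_nat_add of_nat_of_bool)
  have diag: "kind a = kind b \<and> 1 < kind a \<and> kind a < 7 \<longleftrightarrow> a = b \<and> 2 \<le> a \<and> a \<le> 6"
    using kind_iff(7)[OF ab(5)] kind_eq_iff[OF _ _ ab(6), of a] by blast
  show ?thesis
    unfolding cost block_cost_def diag kind_iff(2,3,4)[OF ab(5)] kind_iff(2,3,4)[OF ab(6)]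
    by (rule block_cost_count) (use L_ge in auto)
qed

lemma cost_stub: "e \<in> E \<Longrightarrow> cost (stub e) = - 2"
proof -
  assume e: "e \<in> E"
  have "reward (stub e) = 0"
  proof -
    have "stub e \<noteq> pix u (k, k)" if "u \<in> V" "k \<in> {2..6}" for u k
    proof -
      have "(k, k) \<in> block L" using that(2) L_ge by (auto simp: block_def)
      then show ?thesis using stub_notin_body[OF e that(1)] unfolding body_def by blast
    qed
    then show ?thesis unfolding reward_def by auto
  qed
  moreover have "card {x \<in> live. adj (stub e) x} = 2"
    unfolding live_neighbours_stub[OF e] using dock_neq_stub[OF e swap_in_E[OF e]] by simp
  ultimately show ?thesis
    using stub_in_live[OF e] card_dead_neighbours[OF stub_in_live[OF e]] unfolding cost_def by simp
qed

text \<open>A cell without a node contains no live pixel; in the cell of a node the live pixels are the block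
  and the stubs of the arcs that leave the node.\<close>

lemma cost_cell:
  assumes I: "I < card (fst ` V)" and J: "J < card (snd ` V)" and a: "a < L + 2" and b: "b < L + 2"
  shows "cell_cost lists (row_coords lists ! I, kind a) (col_coords lists ! J, kind b) = cost (pos I a, pos J b)"
proof -
  have nstrip: "(pos I a, pos J b) \<notin> strip"
    using pos_less[OF I a] by (simp add: strip_def height_def)
  define v where "v = (row_coords lists ! I, col_coords lists ! J)"
  show ?thesis
  proof (cases "v \<in> V")
    case False
    have "(pos I a, pos J b) \<notin> live"
    proof
      assume "(pos I a, pos J b) \<in> live"
      then obtain u where u: "u \<in> V" "row u = I" "col u = J" using cell_in_live[OF _ a b] by blast
      have "v = (row_coords lists ! row u, col_coords lists ! col u)" unfolding v_def u(2,3) ..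
      then have "v = u" by (simp only: coords_rank[OF u(1)] prod.collapse)
      then show False using False \<open>u \<in> V\<close> by simp
    qed
    then show ?thesis using False nstrip tests(1)[of v] by (simp add: cell_cost_def cost_def v_def)
  next
    case True
    have IJ: "row v = I" "col v = J"
      using coords_eq_iff(1)[OF True I] coords_eq_iff(2)[OF True J] by (auto simp: v_def)
    have p: "(pos I a, pos J b) = pix v (a, b)" by (simp add: pix_def IJ)
    have cc: "cell_cost lists (row_coords lists ! I, kind a) (col_coords lists ! J, kind b) =
       (if 1 \<le> a \<and> a \<le> L \<and> 1 \<le> b \<and> b \<le> L
        then block_cost (toward is_up v) (toward is_down v) (toward is_left v) (toward is_right v) (kind a) (kind b)
        else if \<exists>e \<in> E. fst e = v \<and> stub_off e = (a, b) then - 2 else 5)"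
    proof -
      have fv: "row_coords lists ! I = fst v" "col_coords lists ! J = snd v" by (simp_all add: v_def)
      have inner: "0 < kind a \<and> kind a < 10 \<and> 0 < kind b \<and> kind b < 10 \<longleftrightarrow> 1 \<le> a \<and> a \<le> L \<and> 1 \<le> b \<and> b \<le> L"
        using kind_iff(6)[OF a] kind_iff(6)[OF b] by blast
      show ?thesis
        unfolding cell_cost_def fst_conv snd_conv fv tests inner stub_off_iff[OF True]
          kind_iff(1,3,5)[OF a] kind_iff(1,3,5)[OF b]
        by (simp only: True not_True_eq_False if_False)
    qed
    show ?thesis
    proof (cases "(a, b) \<in> block L")
      case block: True
      then have "1 \<le> a \<and> a \<le> L \<and> 1 \<le> b \<and> b \<le> L" by (auto simp: block_def)
      then show ?thesis unfolding cc p cost_block[OF True block] by simp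
    next
      case block: False
      then have nb: "\<not> (1 \<le> a \<and> a \<le> L \<and> 1 \<le> b \<and> b \<le> L)" by (auto simp: block_def)
      show ?thesis
      proof (cases "\<exists>e \<in> E. fst e = v \<and> stub_off e = (a, b)")
        case stub: True
        then obtain e where "e \<in> E" "fst e = v" "stub_off e = (a, b)" by blast
        then have "cost (pix v (a, b)) = - 2" using cost_stub[of e] by (simp add: stub_def)
        then show ?thesis unfolding cc p if_not_P[OF nb] if_P[OF stub] by simp
      next
        case stub: False
        then have "pix v (a, b) \<notin> live" using live_iff[OF True a b] block by blast
        then have "cost (pix v (a, b)) = 5" using nstrip p by (simp add: cost_def)
        then show ?thesis unfolding cc p if_not_P[OF nb] if_not_P[OF stub] by simp
      qed
    qed
  qed
qed

lemma length_strip_list: "length (strip_list lists) = strip_len"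
proof -
  have "length (concat (replicate n [(), (), (), (), ()])) = 5 * n" for n by (induct n) auto
  then show ?thesis using len by (simp add: strip_list_def half_list_def strip_len_def m_def)
qed

lemma height_of: "height_of lists = height"
  and width_of: "width_of lists = width"
  by (simp_all add: height_of_def width_of_def height_def width_def length_labels length_strip_list)

lemma length_budget_list: "length (budget_list lists) = budget"
proof -
  have l: "length (concat (replicate n ys)) = n * length ys" for n and ys :: "unit list"
    by (induct n) auto
  have "length (side_list lists) = L" using len by (simp add: side_list_def L_def)
  then show ?thesis using len 
    by (simp add: budget_list_def map_replicate_const l budget_def half_list_def m_def mult.commute)
qed

lemma cost_margin:
  assumes "card (snd ` V) * (L + 2) \<le> c \<or> height - 1 \<le> r"
  shows "cost (r, c) = (if (r, c) \<in> strip then - 5 else 5)"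
proof -
  have "(r, c) \<notin> live"
    using live_bounds(3,4)[of "(r, c)"] assms by (auto simp: width_def)
  then show ?thesis by (simp add: cost_def)
qed

lemma in_strip_iff: "(r, c) \<in> strip \<longleftrightarrow> r = height - 1 \<and> card (snd ` V) * (L + 2) + 1 \<le> c \<and> c < width"
  by (auto simp: strip_def width_def)

lemma rows_eqI:
  assumes "length rs = height"
    and "\<And>r. r < height \<Longrightarrow> length (rs ! r) = width"
    and "\<And>r c. r < height \<Longrightarrow> c < width \<Longrightarrow> rs ! r ! c = f (r, c)"
  shows "rs = map (\<lambda>r. map (\<lambda>c. f (r, c)) [0..<width]) [0..<height]"
proof (rule nth_equalityI)
  fix r assume "r < length rs"
  then have r: "r < height" using assms(1) by simp
  have "rs ! r = map (\<lambda>c. f (r, c)) [0..<width]"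
    by (rule nth_equalityI) (use assms(2,3) r in auto)
  then show "rs ! r = map (\<lambda>r. map (\<lambda>c. f (r, c)) [0..<width]) [0..<height] ! r" using r by simp
qed (use assms in simp)

lemma cost_rows_eq: "cost_rows lists = map (\<lambda>r. map (\<lambda>c. cost (r, c)) [0..<width]) [0..<height]"
proof (rule rows_eqI)
  let ?h = "card (fst ` V) * (L + 2)" and ?w = "card (snd ` V) * (L + 2)"
  have h: "height = ?h + 1" by (simp add: height_def)
  have w: "width = ?w + 1 + strip_len" by (simp add: width_def)
  show "length (cost_rows lists) = height" by (simp add: cost_rows_def length_labels h)
  have nth: "cost_rows lists ! r = (if r < ?h then map (cell_cost lists (row_labels lists ! r)) (col_labels lists) @ 5 # map (\<lambda>_. 5) (strip_list lists)
     else map (\<lambda>_. 5) (col_labels lists) @ 5 # map (\<lambda>_. - 5) (strip_list lists))" if "r < height" for r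
    using that by (simp add: cost_rows_def nth_append length_labels h)
  show "length (cost_rows lists ! r) = width" if "r < height" for r
    using nth[OF that] by (simp add: length_labels length_strip_list w)
  fix r c assume r: "r < height" and c: "c < width"
  have c': "c - ?w - 1 < strip_len" if "c \<ge> ?w + 1" using that c w by simp
  show "cost_rows lists ! r ! c = cost (r, c)"
  proof (cases "r < ?h \<and> c < ?w")
    case True
    then obtain I a J b where "I < card (fst ` V)" "a < L + 2" "r = pos I a" "J < card (snd ` V)" "b < L + 2" "c = pos J b"
      by (metis pos_cases)
    then show ?thesis using True cost_cell[of I J a b] nth[OF r] c
      by (simp add: nth_append length_labels nth_labels)
  next
    case False
    then have "cost (r, c) = (if (r, c) \<in> strip then - 5 else 5)" using r h by (intro cost_margin) auto
    then show ?thesis using False r c nth[OF r] h c'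
      by (auto simp: nth_append nth_Cons' length_labels in_strip_iff length_strip_list)
  qed
qed

lemma start_rows_eq: "start_rows lists = map (\<lambda>r. map (\<lambda>c. start (r, c)) [0..<width]) [0..<height]"
proof (rule rows_eqI)
  let ?h = "card (fst ` V) * (L + 2)" and ?w = "card (snd ` V) * (L + 2)"
  have h: "height = ?h + 1" by (simp add: height_def)
  have w: "width = ?w + 1 + strip_len" by (simp add: width_def)
  show "length (start_rows lists) = height" by (simp add: start_rows_def length_labels h)
  have nth: "start_rows lists ! r = (if r < ?h then map (\<lambda>_. 0) (col_labels lists) @ 0 # map (\<lambda>_. 0) (strip_list lists)
     else map (\<lambda>_. 0) (col_labels lists) @ 0 # map (\<lambda>_. 1) (strip_list lists))" if "r < height" for r
    using that by (simp add: start_rows_def nth_append length_labels h)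
  show "length (start_rows lists ! r) = width" if "r < height" for r
    using nth[OF that] by (simp add: length_labels length_strip_list w)
  fix r c assume r: "r < height" and c: "c < width"
  have c': "c - ?w - 1 < strip_len" if "c \<ge> ?w + 1" using that c w by simp
  show "start_rows lists ! r ! c = start (r, c)"
    using r c nth[OF r] h c'
    by (auto simp: start_def nth_append nth_Cons' length_labels in_strip_iff length_strip_list)
qed

end

section \<open>From encodings to representations\<close>

lemma rep_list_enc:
  assumes "\<And>t x. r t x \<longleftrightarrow> t = enc x"
  shows "rep_list r t xs \<longleftrightarrow> t = enc xs"
proof -
  have "list_all2 r ts xs \<longleftrightarrow> ts = map enc xs" for ts
    by (auto simp: list_all2_conv_all_nth assms intro: nth_equalityI)
  then show ?thesis unfolding rep_list_def enc_list_def by auto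
qed

lemma rep_prod_enc:
  assumes "\<And>t x. ra t x \<longleftrightarrow> t = enc x" "\<And>t y. rb t y \<longleftrightarrow> t = enc y"
  shows "rep_prod ra rb t p \<longleftrightarrow> t = enc p"
  by (cases p) (auto simp: assms)

lemma rep_int_enc: "rep_int t z \<longleftrightarrow> t = enc z"
  by (simp add: rep_int_def enc_int_class)

lemma rep_nat_enc: "rep_nat t n \<longleftrightarrow> t = enc n"
  by (simp add: rep_nat_def enc_nat_class)

lemma rep_set_enc:
  assumes "\<And>t x. r t x \<longleftrightarrow> t = enc x"
  shows "rep_set r t A \<longleftrightarrow> (\<exists>xs. distinct xs \<and> set xs = A \<and> t = enc xs)"
  unfolding rep_set_def rep_list_enc[OF assms] ..

lemma rep_grid_node_enc: "rep_grid_node t v \<longleftrightarrow> t = enc v"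
  unfolding rep_grid_node_def by (rule rep_prod_enc[OF rep_int_enc rep_int_enc])

lemma rep_grid_graphE:
  assumes "rep_grid_graph t G"
  obtains vs es where "distinct vs" "set vs = pverts G" "distinct es" "set es = parcs G" "t = enc (vs, es)"
  using assms unfolding rep_grid_graph_def rep_prod.simps rep_set_enc[OF rep_grid_node_enc]
    rep_set_enc[OF rep_prod_enc[OF rep_grid_node_enc rep_grid_node_enc]]
  by auto

lemma rep_mat_int_enc: "rep_mat rep_int t A \<longleftrightarrow> t = enc (dim_row A, dim_col A, mat_to_list A)"
  unfolding rep_mat_def
  by (rule rep_prod_enc[OF rep_nat_enc rep_prod_enc[OF rep_nat_enc rep_list_enc[OF rep_list_enc[OF rep_int_enc]]]])

lemma mat_to_list_mat: "mat_to_list (mat n k f) = map (\<lambda>i. map (\<lambda>j. f (i, j)) [0..<k]) [0..<n]"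
  unfolding mat_to_list_def by simp

lemma rep_list_map:
  assumes "\<And>x. r (enc (g x)) (h x)"
  shows "rep_list r (enc (map g xs)) (map h xs)"
  unfolding rep_list_def enc_list_def
  by (rule exI[of _ "map (enc \<circ> g) xs"]) (simp add: list_all2_conv_all_nth assms)

lemma rep_real_int: "rep_real (enc (z, 1 :: nat)) (real_of_int z)"
  unfolding rep_real_def
  by (rule exI[of _ z], rule exI[of _ 1]) (simp add: enc_int_class enc_nat_class)

text \<open>A representation may be a proper relation, as sets can be listed in any order; it suffices that
  every representing tree is the encoding of some object to which the program applies.\<close>

lemma polytime_computable_on_ptime:
  fixes F :: "'x::encodable \<Rightarrow> 'y::encodable"
  assumes "ptime F" and "\<And>a t. a \<in> D \<Longrightarrow> rin t a \<Longrightarrow> \<exists>x. t = enc x \<and> rout (enc (F x)) (f a)"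
  shows "polytime_computable_on D rin rout f"
proof -
  obtain c C where c: "computes c C F" using assms(1) unfolding ptime_def by blast
  have "\<exists>k s. wexec c ((\<lambda>_. Atom)(0 := t)) k s \<and> k \<le> poly ([:2, 1:] ^ C) (size t) \<and> rout (s 0) (f a)"
    if a: "a \<in> D" "rin t a" for a t
  proof -
    obtain x where x: "t = enc x" "rout (enc (F x)) (f a)" using assms(2)[OF a] by blast
    let ?s = "(\<lambda>_. Atom)(0 := t) :: wstate"
    have "halts_within c ?s ((size t + 2) ^ C) (\<lambda>s'. s' 0 = enc (F x) \<and> s' 2 = ?s 2)"
      by (rule computesD[OF c]) (simp_all add: x(1))
    then obtain k s' where "wexec c ?s k s'" "k \<le> (size t + 2) ^ C" "s' 0 = enc (F x)"
      unfolding halts_within_def by blast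
    then show ?thesis using x(2) by (intro exI[of _ k] exI[of _ s']) (simp add: poly_power add.commute)
  qed
  then show ?thesis unfolding polytime_computable_on_def by blast
qed

section \<open>The trust-region instance\<close>

context grid_graph
begin

definition tr_instance :: tr_ip_instance where
  "tr_instance = \<lparr> ti_N = height, ti_M = width, ti_Xi = {0, 1}, ti_x = mat height width start,
     ti_c = mat height width (\<lambda>p. real_of_int (cost p)), ti_alpha = 1, ti_Delta = budget \<rparr>"

lemma tr_instance_valid: "tr_ip_valid tr_instance"
proof -
  have "{0, 1 :: int} = {0..1}" by auto
  then show ?thesis unfolding tr_ip_valid_def tr_instance_def
    by (auto simp: height_def width_def start_def intro!: exI[of _ 0] exI[of _ 1])
qed

lemma sum_pixels_nested: "(\<Sum>i<height. \<Sum>j<width. f (i, j)) = (\<Sum>p \<in> pixels. f p)"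
  unfolding pixels_def by (simp add: sum.cartesian_product)

lemma tr_feasible_iff:
  "d \<in> tr_ip_feasible tr_instance \<longleftrightarrow> d \<in> carrier_mat height width
     \<and> (\<forall>p \<in> pixels. start p + d $$ p \<in> {0, 1}) \<and> (\<Sum>p \<in> pixels. \<bar>d $$ p\<bar>) \<le> int budget"
  unfolding tr_ip_feasible_def tr_instance_def
  by (simp add: sum_pixels_nested[of "\<lambda>p. \<bar>d $$ p\<bar>"]) (auto simp: pixels_def)

lemma tr_objective_eq: "tr_ip_objective tr_instance d = real_of_int (energy (\<lambda>p. start p + d $$ p))"
proof -
  let ?w = "\<lambda>p. start p + d $$ p"
  have "(\<Sum>i<height. \<Sum>j<width. mat height width (\<lambda>p. real_of_int (cost p)) $$ (i, j) * real_of_int (d $$ (i, j)))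
     = (\<Sum>i<height. \<Sum>j<width. real_of_int (cost (i, j) * d $$ (i, j)))"
    by (intro sum.cong refl) simp
  also have "\<dots> = real_of_int (\<Sum>p \<in> pixels. cost p * d $$ p)"
    unfolding sum_pixels_nested[of "\<lambda>p. real_of_int (cost p * d $$ p)"] by simp
  finally have 1: "(\<Sum>i<height. \<Sum>j<width. mat height width (\<lambda>p. real_of_int (cost p)) $$ (i, j) * real_of_int (d $$ (i, j)))
     = real_of_int (\<Sum>p \<in> pixels. cost p * d $$ p)" .
  have 2: "(\<Sum>j<width. \<Sum>i<height - 1. real_of_int \<bar>mat height width start $$ (i + 1, j) + d $$ (i + 1, j)
        - mat height width start $$ (i, j) - d $$ (i, j)\<bar>)
     = real_of_int (\<Sum>j<width. \<Sum>i<height - 1. \<bar>?w (i + 1, j) - ?w (i, j)\<bar>)"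
    unfolding of_int_sum by (intro sum.cong refl) (auto simp: algebra_simps)
  have 3: "(\<Sum>i<height. \<Sum>j<width - 1. real_of_int \<bar>mat height width start $$ (i, j + 1) + d $$ (i, j + 1)
        - mat height width start $$ (i, j) - d $$ (i, j)\<bar>)
     = real_of_int (\<Sum>i<height. \<Sum>j<width - 1. \<bar>?w (i, j + 1) - ?w (i, j)\<bar>)"
    unfolding of_int_sum by (intro sum.cong refl) (auto simp: algebra_simps)
  show ?thesis
    unfolding tr_ip_objective_def Let_def tr_instance_def tr_ip_instance.simps 1 2 3 energy_def tv_def
    by simp
qed

lemma tr_lower_bound:
  assumes "d \<in> tr_ip_feasible tr_instance"
  shows "real bisection_width \<le> tr_ip_objective tr_instance d"
    and "tr_ip_objective tr_instance d \<le> real bisection_width \<Longrightarrow>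
      card {v \<in> V. d $$ pix v (7, 7) = 1} = m \<and> cut {v \<in> V. d $$ pix v (7, 7) = 1} \<le> bisection_width"
proof -
  let ?w = "\<lambda>p. start p + d $$ p"
  have w: "\<And>p. p \<in> pixels \<Longrightarrow> ?w p \<in> {0, 1}" and le: "(\<Sum>p \<in> pixels. \<bar>?w p - start p\<bar>) \<le> int budget"
    using assms unfolding tr_feasible_iff by auto
  have bound1: "int bisection_width \<le> energy ?w"
    by (rule energy_lower_bound(1)[where w = ?w]) (fact w, fact le)
  have bound2: "card {v \<in> V. ?w (pix v (7, 7)) = 1} = m \<and> cut {v \<in> V. ?w (pix v (7, 7)) = 1} \<le> bisection_width"
    if h: "energy ?w \<le> int bisection_width"
    by (rule energy_lower_bound(2)[where w = ?w]) (fact w, fact le, fact h)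
  show "real bisection_width \<le> tr_ip_objective tr_instance d"
    using bound1 unfolding tr_objective_eq by linarith
  have "(7, 7) \<in> block L" using L_ge by (simp add: block_def)
  then have "start (pix v (7, 7)) = 0" if "v \<in> V" for v
    using pix_in_live[OF that] live_strip by (auto simp: start_def)
  then have S: "{v \<in> V. ?w (pix v (7, 7)) = 1} = {v \<in> V. d $$ pix v (7, 7) = 1}" by auto
  assume "tr_ip_objective tr_instance d \<le> real bisection_width"
  then have "energy ?w \<le> int bisection_width" unfolding tr_objective_eq by linarith
  from bound2[OF this] show "card {v \<in> V. d $$ pix v (7, 7) = 1} = m \<and> cut {v \<in> V. d $$ pix v (7, 7) = 1} \<le> bisection_width"
    unfolding S .
qed

lemma tr_upper_bound:
  obtains d where "d \<in> tr_ip_feasible tr_instance" "tr_ip_objective tr_instance d = real bisection_width"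
proof -
  obtain S where S: "S \<subseteq> V" "card S = m" "cut S = bisection_width" by (rule bisection_width_attained)
  let ?d = "mat height width (\<lambda>p. picture S p - start p)"
  have d: "?d $$ p = picture S p - start p" if "p \<in> pixels" for p
    using that by (cases p) (simp add: pixels_def)
  have eq: "start p + ?d $$ p = picture S p" if "p \<in> pixels" for p using d[OF that] by simp
  have "\<forall>p \<in> pixels. start p + ?d $$ p \<in> {0, 1}"
  proof
    fix p assume p: "p \<in> pixels"
    show "start p + ?d $$ p \<in> {0, 1}" unfolding eq[OF p] by (rule picture_01)
  qed
  moreover have "(\<Sum>p \<in> pixels. \<bar>?d $$ p\<bar>) \<le> int budget"
    using energy_upper_bound(2)[OF S(1,2)] d by simp
  ultimately have "?d \<in> tr_ip_feasible tr_instance" unfolding tr_feasible_iff by simp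
  moreover have "energy (\<lambda>p. start p + ?d $$ p) = energy (picture S)"
  proof -
    have "variation (\<lambda>p. start p + ?d $$ p) pixels pixels = variation (picture S) pixels pixels"
      unfolding variation_def by (intro sum.cong refl) (auto simp: adj_pairs_def eq)
    then have "tv height width (\<lambda>p. start p + ?d $$ p) = tv height width (picture S)"
      unfolding pixels_def variation_eq_tv by simp
    then show ?thesis unfolding energy_def using eq by simp
  qed
  ultimately show thesis
    using that energy_upper_bound(1)[OF S(1,2)] S(3) by (simp add: tr_objective_eq)
qed

lemma cost_bounds: "\<bar>cost p\<bar> \<le> 5"
proof -
  have "card {q. adj p q \<and> q \<notin> live} \<le> card {q. adj p q}"
    by (rule card_mono) (auto simp: card_neighbours_le)
  then have "int (card {q. adj p q \<and> q \<notin> live}) \<le> 4" using card_neighbours_le(2)[of p] by linarith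
  moreover have "reward p = 0 \<or> reward p = 1" by (simp add: reward_def)
  ultimately show ?thesis unfolding cost_def by auto
qed

end

lemma optimal_value_eq:
  assumes "optimal P i s" shows "optimal_value P i = objective P i s"
  unfolding optimal_value_def using assms unfolding optimal_def
  by (intro cInf_eq_minimum) auto

section \<open>The reduction\<close>

lemma MBFH_grid_graph:
  assumes "G \<in> instances MBFH" shows "grid_graph (pverts G) (parcs G)"
proof -
  have G: "pair_graph G" "subgraph (with_proj G) (with_proj infinite_grid)"
    using assms by (auto simp: MBFH_def MBP_def)
  interpret pair_graph G by (rule G(1))
  show ?thesis
  proof
    show "finite (pverts G)" by (rule pair_finite_verts)
    show "parcs G \<subseteq> pverts G \<times> pverts G" using arc_fst_in_verts arc_snd_in_verts by force
    show "(v, u) \<in> parcs G" if "(u, v) \<in> parcs G" for u v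
      using pair_sym_arcs that unfolding symmetric_def by (auto dest: symD)
    show "(fst u - fst v)\<^sup>2 + (snd u - snd v)\<^sup>2 = 1" if "(u, v) \<in> parcs G" for u v
    proof -
      have "parcs G \<subseteq> parcs infinite_grid" using G(2) by (auto simp: subgraph_def)
      then show ?thesis using that by (auto simp: infinite_grid_def)
    qed
  qed
qed

definition reduction :: "(int \<times> int) pair_pre_digraph \<Rightarrow> tr_ip_instance" where
  "reduction G = grid_graph.tr_instance (pverts G) (parcs G)"

definition bisection_of :: "(int \<times> int) pair_pre_digraph \<times> int mat \<Rightarrow> (int \<times> int) set" where
  "bisection_of z = {v \<in> pverts (fst z). snd z $$ grid_graph.pix (pverts (fst z)) (parcs (fst z)) v (7, 7) = 1}"

context
  fixes G :: "(int \<times> int) pair_pre_digraph"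
  assumes G: "G \<in> instances MBFH"
begin

interpretation grid_graph "pverts G" "parcs G" by (rule MBFH_grid_graph[OF G])

lemma objective_MBFH: "objective MBFH G S = real (cut S)"
proof -
  have "cut_edges G S = {e \<in> parcs G. fst e \<in> S \<and> snd e \<notin> S}"
    using snd_in_V by (auto simp: cut_edges_def)
  then show ?thesis by (simp add: MBFH_def MBP_def cut_def)
qed

lemma ceiling_half: "\<lceil>real (card (pverts G)) / 2\<rceil> = int m"
  unfolding m_def by (cases "even (card (pverts G))") (auto elim!: evenE oddE simp: ceiling_eq_iff)

lemma feasible_MBFH_iff:
  "S \<in> feasible MBFH G \<longleftrightarrow> S \<subseteq> pverts G \<and> card S \<le> m \<and> card (pverts G - S) \<le> m"
  by (simp add: MBFH_def MBP_def ceiling_half)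

text \<open>Arcs come in opposite pairs.\<close>

lemma cut_complement: "S \<subseteq> pverts G \<Longrightarrow> cut (pverts G - S) = cut S"
proof -
  assume S: "S \<subseteq> pverts G"
  have "{e \<in> parcs G. fst e \<in> pverts G - S \<and> snd e \<notin> pverts G - S} = prod.swap ` {e \<in> parcs G. fst e \<in> S \<and> snd e \<notin> S}"
    (is "?A = prod.swap ` ?B")
  proof (intro equalityI subsetI)
    fix e assume e: "e \<in> ?A"
    then have "prod.swap e \<in> ?B" using swap_in_E[of e] snd_in_V[of e] by auto
    then have "prod.swap (prod.swap e) \<in> prod.swap ` ?B" by (rule imageI)
    then show "e \<in> prod.swap ` ?B" by simp
  next
    fix e assume "e \<in> prod.swap ` ?B"
    then obtain e' where "e' \<in> ?B" "e = prod.swap e'" by blast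
    then show "e \<in> ?A" using swap_in_E[of e'] snd_in_V[of e'] S by auto
  qed
  then show ?thesis unfolding cut_def by (simp add: card_image)
qed

text \<open>One of the two parts has exactly \<open>m\<close> nodes, also if the number of nodes is odd.\<close>

lemma bisection_width_le_feasible:
  assumes "S \<in> feasible MBFH G" shows "bisection_width \<le> cut S"
proof -
  have S: "S \<subseteq> pverts G" "card S \<le> m" "card (pverts G - S) \<le> m" using assms by (auto simp: feasible_MBFH_iff)
  have sum: "card S + card (pverts G - S) = card (pverts G)"
    using S(1) finV by (metis card_Diff_subset card_mono finite_subset le_add_diff_inverse)
  show ?thesis
  proof (cases "card S = m")
    case True
    then show ?thesis using bisection_width_le S by blast
  next
    case False
    then have "card (pverts G - S) = m" using S sum unfolding m_def by linarith
    then show ?thesis using bisection_width_le[of "pverts G - S"] cut_complement[OF S(1)] by simp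
  qed
qed

lemma optimal_MBFH:
  assumes "S \<subseteq> pverts G" "card S = m" "cut S \<le> bisection_width"
  shows "optimal MBFH G S" "objective MBFH G S = real bisection_width"
proof -
  have "card (pverts G - S) \<le> m"
    using assms finV card_Diff_subset[of S "pverts G"] finite_subset[OF assms(1)] unfolding m_def by linarith
  then have feas: "S \<in> feasible MBFH G" using assms by (simp add: feasible_MBFH_iff)
  then have cut: "cut S = bisection_width" using assms(3) bisection_width_le_feasible by (meson le_antisym)
  then show "optimal MBFH G S" "objective MBFH G S = real bisection_width"
    using feas bisection_width_le_feasible by (auto simp: optimal_def objective_MBFH)
qed

lemma optimal_value_MBFH: "optimal_value MBFH G = real bisection_width"
proof -
  obtain S where "S \<subseteq> pverts G" "card S = m" "cut S = bisection_width" by (rule bisection_width_attained)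
  then show ?thesis using optimal_MBFH[of S] optimal_value_eq by fastforce
qed

lemma TR_IP_simps: "feasible TR_IP (reduction G) = tr_ip_feasible tr_instance"
  "objective TR_IP (reduction G) = tr_ip_objective tr_instance"
  by (simp_all add: TR_IP_def reduction_def)

lemma reduction_valid: "reduction G \<in> instances TR_IP"
  using tr_instance_valid by (simp add: TR_IP_def reduction_def)

lemma optimal_TR_IP_iff:
  "optimal TR_IP (reduction G) d \<longleftrightarrow>
     d \<in> tr_ip_feasible tr_instance \<and> tr_ip_objective tr_instance d = real bisection_width"
proof
  assume "optimal TR_IP (reduction G) d"
  then have d: "d \<in> tr_ip_feasible tr_instance"
    "\<And>d'. d' \<in> tr_ip_feasible tr_instance \<Longrightarrow> tr_ip_objective tr_instance d \<le> tr_ip_objective tr_instance d'"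
    by (auto simp: optimal_def TR_IP_simps)
  obtain d' where "d' \<in> tr_ip_feasible tr_instance" "tr_ip_objective tr_instance d' = real bisection_width"
    by (rule tr_upper_bound)
  then show "d \<in> tr_ip_feasible tr_instance \<and> tr_ip_objective tr_instance d = real bisection_width"
    using d tr_lower_bound(1)[OF d(1)] by (metis order_antisym)
next
  assume "d \<in> tr_ip_feasible tr_instance \<and> tr_ip_objective tr_instance d = real bisection_width"
  then show "optimal TR_IP (reduction G) d" using tr_lower_bound(1) by (simp add: optimal_def TR_IP_simps)
qed

lemma optimal_bisection_of:
  assumes "optimal TR_IP (reduction G) d" shows "optimal MBFH G (bisection_of (G, d))"
  using assms tr_lower_bound(2)[of d] optimal_MBFH(1)[of "bisection_of (G, d)"]
  unfolding optimal_TR_IP_iff bisection_of_def fst_conv snd_conv by auto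

lemma optimal_value_TR_IP: "optimal_value TR_IP (reduction G) = optimal_value MBFH G"
proof -
  obtain d where d: "d \<in> tr_ip_feasible tr_instance" "tr_ip_objective tr_instance d = real bisection_width"
    by (rule tr_upper_bound)
  then have "optimal TR_IP (reduction G) d" unfolding optimal_TR_IP_iff by simp
  from optimal_value_eq[OF this] d(2) show ?thesis by (simp add: optimal_value_MBFH TR_IP_simps)
qed

lemma optimal_TR_IP_dims:
  assumes "optimal TR_IP (reduction G) d" shows "d \<in> carrier_mat height width"
  using assms unfolding optimal_TR_IP_iff tr_feasible_iff by blast

lemma reduction_cost:
  assumes "i < ti_N (reduction G)" "j < ti_M (reduction G)"
  shows "ti_c (reduction G) $$ (i, j) = real_of_int (cost (i, j))"
  using assms by (simp add: reduction_def tr_instance_def)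

context
  fixes vs es
  assumes vs: "distinct vs" "set vs = pverts G" and es: "distinct es" "set es = parcs G"
begin

interpretation listed_grid_graph "pverts G" "parcs G" vs es
  by unfold_locales (rule vs es)+

lemma rep_reduction: "rep_tr_ip (enc (reduce (vs, es))) (reduction G)"
proof -
  have x: "rep_mat rep_int (enc (height, width, start_rows (vs, es))) (mat height width start)"
    unfolding rep_mat_int_enc by (simp add: mat_to_list_mat start_rows_eq)
  have "rep_list (rep_list rep_real) (enc (map (map (\<lambda>z. (z, 1 :: nat))) (cost_rows (vs, es)))) (map (map real_of_int) (cost_rows (vs, es)))"
    by (intro rep_list_map rep_real_int)
  then have c: "rep_mat rep_real (enc (height, width, map (map (\<lambda>z. (z, 1 :: nat))) (cost_rows (vs, es))))
      (mat height width (\<lambda>p. real_of_int (cost p)))"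
    unfolding rep_mat_def by (simp add: mat_to_list_mat cost_rows_eq rep_nat_enc comp_def)
  have xi: "rep_set rep_int (enc [0, 1 :: int]) {0, 1}"
    unfolding rep_set_enc[OF rep_int_enc] by (rule exI[of _ "[0, 1]"]) auto
  have a: "rep_real (enc (1 :: int, 1 :: nat)) 1" using rep_real_int[of 1] by simp
  show ?thesis
    using x c xi a
    unfolding rep_tr_ip_def reduce_def reduction_def tr_instance_def height_of width_of length_budget_list
    by (simp add: rep_nat_enc del: enc_Cons enc_Nil)
qed

lemma row_label_iff:
  assumes "v \<in> pverts G" "r < card (fst ` pverts G) * (L + 2)"
  shows "fst (row_labels (vs, es) ! r) = fst v \<and> snd (row_labels (vs, es) ! r) = 7 \<longleftrightarrow> r = pos (row v) 7"
proof -
  obtain I a where I: "I < card (fst ` pverts G)" "a < L + 2" "r = pos I a" using assms(2) by (rule pos_cases)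
  have "7 < L + 2" using L_ge by simp
  then show ?thesis
    unfolding I(3) nth_labels(1)[OF I(2,1)] fst_conv snd_conv coords_eq_iff(1)[OF assms(1) I(1)] kind_iff(3)[OF I(2)]
    using pos_eq_iff[OF I(2), of 7 I "row v"] by blast
qed

lemma col_label_iff:
  assumes "v \<in> pverts G" "c < card (snd ` pverts G) * (L + 2)"
  shows "fst (col_labels (vs, es) ! c) = snd v \<and> snd (col_labels (vs, es) ! c) = 7 \<longleftrightarrow> c = pos (col v) 7"
proof -
  obtain I a where I: "I < card (snd ` pverts G)" "a < L + 2" "c = pos I a" using assms(2) by (rule pos_cases)
  have "7 < L + 2" using L_ge by simp
  then show ?thesis
    unfolding I(3) nth_labels(2)[OF I(2,1)] fst_conv snd_conv coords_eq_iff(2)[OF assms(1) I(1)] kind_iff(3)[OF I(2)]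
    using pos_eq_iff[OF I(2), of 7 I "col v"] by blast
qed

lemma list_ex_zip: "list_ex P (zip xs ys) \<longleftrightarrow> (\<exists>k < min (length xs) (length ys). P (xs ! k, ys ! k))"
  unfolding list_ex_iff set_zip by auto

lemma set_decode:
  assumes d: "d \<in> carrier_mat height width"
  shows "set (decode ((vs, es), (dim_row d, dim_col d, mat_to_list d))) = bisection_of (G, d)"
proof -
  have dims: "dim_row d = height" "dim_col d = width" using d by auto
  have len: "length (mat_to_list d) = height" by (simp add: mat_to_list_def dims)
  have row: "mat_to_list d ! r = map (\<lambda>c. d $$ (r, c)) [0..<width]" if "r < height" for r
    using that by (simp add: mat_to_list_def dims)
  have h: "card (fst ` pverts G) * (L + 2) \<le> height" "card (snd ` pverts G) * (L + 2) \<le> width"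
    by (simp_all add: height_def width_def)
  have seven: "7 < L + 2" using L_ge by simp
  have inner: "list_ex (\<lambda>c. fst (fst c) = snd v \<and> snd (fst c) = 7 \<and> snd c = 1)
      (zip (col_labels (vs, es)) (mat_to_list d ! r)) \<longleftrightarrow> d $$ (r, pos (col v) 7) = 1"
    if v: "v \<in> pverts G" and r: "r < height" for v r
  proof -
    have lt: "pos (col v) 7 < card (snd ` pverts G) * (L + 2)" by (rule pos_less[OF col_less[OF v] seven])
    have "list_ex (\<lambda>c. fst (fst c) = snd v \<and> snd (fst c) = 7 \<and> snd c = 1) (zip (col_labels (vs, es)) (mat_to_list d ! r))
      \<longleftrightarrow> (\<exists>c < card (snd ` pverts G) * (L + 2). (fst (col_labels (vs, es) ! c) = snd v \<and> snd (col_labels (vs, es) ! c) = 7)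
           \<and> d $$ (r, c) = 1)"
      unfolding list_ex_zip row[OF r] length_labels using h by (auto simp: min_absorb1)
    also have "\<dots> \<longleftrightarrow> (\<exists>c < card (snd ` pverts G) * (L + 2). c = pos (col v) 7 \<and> d $$ (r, c) = 1)"
      using col_label_iff[OF v] by blast
    also have "\<dots> \<longleftrightarrow> d $$ (r, pos (col v) 7) = 1" using lt by blast
    finally show ?thesis .
  qed
  have "list_ex (\<lambda>r. fst (fst r) = fst v \<and> snd (fst r) = 7 \<and>
       list_ex (\<lambda>c. fst (fst c) = snd v \<and> snd (fst c) = 7 \<and> snd c = 1) (zip (col_labels (vs, es)) (snd r)))
     (zip (row_labels (vs, es)) (mat_to_list d)) \<longleftrightarrow> d $$ pix v (7, 7) = 1" (is "?L \<longleftrightarrow> _")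
    if v: "v \<in> pverts G" for v
  proof -
    have lt: "pos (row v) 7 < card (fst ` pverts G) * (L + 2)" by (rule pos_less[OF row_less[OF v] seven])
    have "?L \<longleftrightarrow> (\<exists>r < card (fst ` pverts G) * (L + 2). (fst (row_labels (vs, es) ! r) = fst v \<and> snd (row_labels (vs, es) ! r) = 7)
           \<and> list_ex (\<lambda>c. fst (fst c) = snd v \<and> snd (fst c) = 7 \<and> snd c = 1) (zip (col_labels (vs, es)) (mat_to_list d ! r)))"
      unfolding list_ex_zip[of _ "row_labels (vs, es)"] len length_labels min_absorb1[OF h(1)] fst_conv snd_conv by blast
    also have "\<dots> \<longleftrightarrow> (\<exists>r < card (fst ` pverts G) * (L + 2). r = pos (row v) 7 \<and> d $$ (r, pos (col v) 7) = 1)"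
    proof -
      have "((fst (row_labels (vs, es) ! r) = fst v \<and> snd (row_labels (vs, es) ! r) = 7)
           \<and> list_ex (\<lambda>c. fst (fst c) = snd v \<and> snd (fst c) = 7 \<and> snd c = 1) (zip (col_labels (vs, es)) (mat_to_list d ! r)))
         \<longleftrightarrow> r = pos (row v) 7 \<and> d $$ (r, pos (col v) 7) = 1" if r: "r < card (fst ` pverts G) * (L + 2)" for r
        unfolding row_label_iff[OF v r] inner[OF v less_le_trans[OF r h(1)]] ..
      then show ?thesis by blast
    qed
    also have "\<dots> \<longleftrightarrow> d $$ (pos (row v) 7, pos (col v) 7) = 1" using lt by blast
    finally show ?thesis by (simp add: pix_def)
  qed
  then show ?thesis
    unfolding decode_def bisection_of_def fst_conv snd_conv set_filter vs(2) by blast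
qed

end

end

lemma reduction_polytime: "polytime_computable_on (instances MBFH) rep_grid_graph rep_tr_ip reduction"
proof (rule polytime_computable_on_ptime[OF ptime_reduce])
  fix G t assume G: "G \<in> instances MBFH" and "rep_grid_graph t G"
  from this(2) show "\<exists>x. t = enc x \<and> rep_tr_ip (enc (reduce x)) (reduction G)"
    by (elim rep_grid_graphE) (use rep_reduction[OF G] in blast)
qed

lemma bisection_of_polytime:
  "polytime_computable_on {(i, s). i \<in> instances MBFH \<and> optimal TR_IP (reduction i) s}
     (rep_prod rep_grid_graph (rep_mat rep_int)) (rep_set rep_grid_node) bisection_of"
proof (rule polytime_computable_on_ptime[OF ptime_decode])
  fix z t assume "z \<in> {(i, s). i \<in> instances MBFH \<and> optimal TR_IP (reduction i) s}"
    and rep: "rep_prod rep_grid_graph (rep_mat rep_int) t z"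
  then obtain G d where z: "z = (G, d)" and G: "G \<in> instances MBFH" and d: "optimal TR_IP (reduction G) d" by auto
  obtain u where u: "rep_grid_graph u G" "t = Cell u (enc (dim_row d, dim_col d, mat_to_list d))"
    using rep unfolding z rep_prod.simps rep_mat_int_enc by blast
  from u(1) obtain vs es where l: "distinct vs" "set vs = pverts G" "distinct es" "set es = parcs G" "u = enc (vs, es)"
    by (rule rep_grid_graphE)
  let ?x = "((vs, es), (dim_row d, dim_col d, mat_to_list d))"
  have "distinct (decode ?x)" unfolding decode_def fst_conv by (rule distinct_filter[OF l(1)])
  moreover have "set (decode ?x) = bisection_of (G, d)"
    by (rule set_decode[OF G l(1-4) optimal_TR_IP_dims[OF G d]])
  ultimately have "rep_set rep_grid_node (enc (decode ?x)) (bisection_of (G, d))"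
    unfolding rep_set_enc[OF rep_grid_node_enc] by blast
  moreover have "t = enc ?x" using u(2) l(5) by simp
  ultimately show "\<exists>x. t = enc x \<and> rep_set rep_grid_node (enc (decode x)) (bisection_of z)" unfolding z by blast
qed

text \<open>The optimal values of the two problems agree, so the value is handed back as it is represented.\<close>

lemma value_polytime: "polytime_computable_on D (rep_prod ri rep_real) rep_real snd"
proof (rule polytime_computable_on_ptime)
  show "ptime tree_tl" by (rule ptime_tree_tl[OF ptime_id]) simp
  fix a t assume "rep_prod ri rep_real t a"
  then show "\<exists>x. t = enc x \<and> rep_real (enc (tree_tl x)) (snd a)"
    by (cases a) (auto intro!: exI[of _ t])
qed

theorem theorem1:
  "\<exists>(f :: (int \<times> int) pair_pre_digraph \<Rightarrow> tr_ip_instance) (p :: nat poly).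
     polynomial_reduction rep_grid_graph (rep_set rep_grid_node) MBFH
       rep_tr_ip (rep_mat rep_int) TR_IP f \<and>
     (\<forall>G \<in> instances MBFH.
        ti_Xi (f G) = {0, 1} \<and>
        (let n = (if even (card (pverts G)) then card (pverts G) else card (pverts G) + 1) in
           \<forall>i < ti_N (f G). \<forall>j < ti_M (f G).
             ti_c (f G) $$ (i, j) \<in> \<rat> \<and>
             - 9 \<le> ti_c (f G) $$ (i, j) \<and> ti_c (f G) $$ (i, j) \<le> 5 \<and>
             (\<exists>z :: int. ti_c (f G) $$ (i, j) * real n ^ 4 = real_of_int z \<and>
                \<bar>z\<bar> \<le> int (poly p (grid_graph_size G)))))"
proof (intro exI[of _ reduction] exI[of _ "[:5:] * [:1, 1:] ^ 4"] conjI ballI)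
  show "polynomial_reduction rep_grid_graph (rep_set rep_grid_node) MBFH rep_tr_ip (rep_mat rep_int) TR_IP reduction"
    unfolding polynomial_reduction_def
  proof (intro conjI)
    show "\<forall>i \<in> instances MBFH. reduction i \<in> instances TR_IP" using reduction_valid by blast
    show "polytime_computable_on (instances MBFH) rep_grid_graph rep_tr_ip reduction" by (rule reduction_polytime)
    show "\<exists>g. polytime_computable_on {(i, s). i \<in> instances MBFH \<and> optimal TR_IP (reduction i) s}
        (rep_prod rep_grid_graph (rep_mat rep_int)) (rep_set rep_grid_node) g \<and>
      (\<forall>i \<in> instances MBFH. \<forall>s. optimal TR_IP (reduction i) s \<longrightarrow> optimal MBFH i (g (i, s)))"
      using bisection_of_polytime optimal_bisection_of by blast
    show "\<exists>h. polytime_computable_on {(i, v). i \<in> instances MBFH \<and> v = optimal_value TR_IP (reduction i)}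
        (rep_prod rep_grid_graph rep_real) rep_real h \<and>
      (\<forall>i \<in> instances MBFH. h (i, optimal_value TR_IP (reduction i)) = optimal_value MBFH i)"
      by (rule exI[of _ snd]) (simp add: value_polytime optimal_value_TR_IP)
  qed
  fix G assume G: "G \<in> instances MBFH"
  show "ti_Xi (reduction G) = {0, 1}"
    by (simp add: reduction_def grid_graph.tr_instance_def[OF MBFH_grid_graph[OF G]])
  define n where "n = (if even (card (pverts G)) then card (pverts G) else card (pverts G) + 1)"
  have n: "n \<le> grid_graph_size G + 1" by (auto simp: n_def grid_graph_size_def)
  have "ti_c (reduction G) $$ (i, j) \<in> \<rat> \<and> - 9 \<le> ti_c (reduction G) $$ (i, j) \<and> ti_c (reduction G) $$ (i, j) \<le> 5 \<and>
     (\<exists>z :: int. ti_c (reduction G) $$ (i, j) * real n ^ 4 = real_of_int z \<and>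
        \<bar>z\<bar> \<le> int (poly ([:5:] * [:1, 1:] ^ 4) (grid_graph_size G)))"
    if ij: "i < ti_N (reduction G)" "j < ti_M (reduction G)" for i j
  proof -
    define k where "k = grid_graph.cost (pverts G) (parcs G) (i, j)"
    have c: "ti_c (reduction G) $$ (i, j) = real_of_int k" unfolding k_def by (rule reduction_cost[OF G ij])
    have k: "\<bar>k\<bar> \<le> 5" unfolding k_def by (rule grid_graph.cost_bounds[OF MBFH_grid_graph[OF G]])
    have "\<bar>k * int n ^ 4\<bar> \<le> 5 * int (grid_graph_size G + 1) ^ 4"
      using k n by (auto simp: abs_mult intro!: mult_mono power_mono)
    also have "\<dots> = int (poly ([:5:] * [:1, 1:] ^ 4) (grid_graph_size G))"
      by (simp add: poly_power add.commute)
    finally have "\<bar>k * int n ^ 4\<bar> \<le> int (poly ([:5:] * [:1, 1:] ^ 4) (grid_graph_size G))" .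
    moreover have "real_of_int k * real n ^ 4 = real_of_int (k * int n ^ 4)" by simp
    moreover have "- 9 \<le> real_of_int k" "real_of_int k \<le> 5" using k by linarith+
    ultimately show ?thesis unfolding c by (intro conjI exI[of _ "k * int n ^ 4"]) auto
  qed
  then show "let n = (if even (card (pverts G)) then card (pverts G) else card (pverts G) + 1) in
     \<forall>i < ti_N (reduction G). \<forall>j < ti_M (reduction G).
       ti_c (reduction G) $$ (i, j) \<in> \<rat> \<and> - 9 \<le> ti_c (reduction G) $$ (i, j) \<and> ti_c (reduction G) $$ (i, j) \<le> 5 \<and>
       (\<exists>z :: int. ti_c (reduction G) $$ (i, j) * real n ^ 4 = real_of_int z \<and>
          \<bar>z\<bar> \<le> int (poly ([:5:] * [:1, 1:] ^ 4) (grid_graph_size G)))"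
    unfolding Let_def n_def by blast
qed

end
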